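(* Let $\mathsf R,\mathsf S\ge0$ and $\mathsf P,\mathsf k_1,\mathsf k_2>0$, and consider the truncated ODE model (see context) determined by a mode selection, i.e. by finite sets $\mathscr N_{\mathbf u}^{\tau}\subset\mathscr N_{\mathbf u}$, $\mathscr N_\theta^{\tau}\subset\mathscr N_\theta$. The potential energy balance $$\frac{d}{dt}\Big\langle\big(1-\tfrac{\mathsf k_3x_3}{\pi}\big)\theta^\tau\Big\rangle=\Big\langle\big(1-\tfrac{\mathsf k_3x_3}{\pi}\big)\partial_{x_3}^2\theta^\tau\Big\rangle-\frac{\mathsf k_3}{\pi}\langle u_3^\tau\theta^\tau\rangle$$ holds for all solutions $(\mathbf u^\tau,\theta^\tau)$ (i.e. for all initial data $\mathbf u_0^\tau,\theta_0^\tau$) if and only if $\mathscr N_{\mathbf u}^\tau,\mathscr N_\theta^\tau$ satisfy the Energy Balance Criterion stated in the context. In this case all solutions are exponentially attracted to the following ellipsoidal ball: $$\sum_{\mathbf n\in\mathscr N_{\mathbf u}^\tau}\frac{(u^{\tau,\mathbf n})^2}{\mathsf P\mathsf R}+\sum_{\mathbf n\in\mathscr N_\theta^\tau}\Big(\theta^{\tau,\mathbf n}+\frac{2(2\pi)^{3/2}}{\mathsf k_3m_3}\Big)^2\le\frac{16\pi^3}{\min_{i\le3}(\mathsf k_i^2)}\Big(\frac{|\mathscr N_\theta^\tau\cap\mathscr N_\theta^*|}{\min(\mathsf P,1)}+\frac{\pi^3}{6}\Big).$$ In particular, the semigroup $\mathcal S^\tau(t)$ generated by the ODE admits a compact global attractor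 $\mathscr A^\tau$.
   Context: Domain. $\mathsf k_3=(\mathsf k_1\mathsf k_2)^{-1}$, $\Omega=[0,\frac{2\pi}{\mathsf k_1}]\times[0,\frac{2\pi}{\mathsf k_2}]\times[0,\frac{\pi}{\mathsf k_3}]$; functions are periodic in $x_1,x_2$. $\langle g\rangle=\int_\Omega g\,d\mathbf x$, $\hat{\mathbf e}^3=(0,0,1)$, $\mathcal K=\mathrm{diag}[\mathsf k_1,\mathsf k_2,\mathsf k_3]$. Indices. An index is $\mathbf n=(\mathbf m,\mathbf p,c)$ with $\mathbf m=(m_1,m_2,m_3)\in\mathbb Z_{\ge0}^3$, $\mathbf p=(p_1,p_2)\in\{0,1\}^2$, $c\in\{1,2\}$. Phase arithmetic is mod 2, $p_3:=0$. $s^{m,0}(x)=\cos(mx)$, $s^{m,1}(x)=\sin(mx)$; $\iota^{m}=0$ if $m=0$, $1$ if $m>0$; $\eta^{\mathbf m}=\prod_{k\le3}(\sqrt2)^{\iota^{m_k}}$; $V=(4\pi^3)^{1/2}$. Temperature modes. $\mathscr P^{m}=\{0\}$ if $m=0$ and $\{0,1\}$ if $m>0$; $\mathscr N_\theta=\{(\mathbf m,\mathbf p,1): m_1,m_2\ge0,\ m_3>0,\ \mathbf p\in\mathscr P^{m_1}\times\mathscr P^{m_2}\}$; $f^{\mathbf n}(\mathbf x)=\frac{\eta^{\mathbf m}}{V}s^{m_1,p_1}(\mathsf k_1x_1)s^{m_2,p_2}(\mathsf k_2x_2)s^{m_3,1}(\mathsf k_3x_3)$. The vertically stratified temperature indices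 are $\mathscr N_\theta^*=\{\mathbf n\in\mathscr N_\theta: m_1=m_2=0,\ m_3>0\}$. Velocity modes. With $\boldsymbol\gamma=(1,1,-1)$: $\mathcal G^{(\mathbf m,\mathbf p,1)}=\mathrm{diag}[\boldsymbol\gamma\times\mathcal K\mathbf m]$, $\mathcal G^{(\mathbf m,\mathbf p,2)}=\mathrm{diag}[\mathcal K\mathbf m\times(\boldsymbol\gamma\times\mathcal K\mathbf m)]$, $\nu_i^{\mathbf n}=\prod_{j\le3}(\iota^{m_j})^{p_j+\delta^{i,j}}$ (exponents mod 2, $0^0=1$), $\varsigma^{\mathbf p}_{1,1}=(-1)^{p_1}$, $\varsigma^{\mathbf p}_{2,2}=(-1)^{p_2}$, $\varsigma^{\mathbf p}_{3,3}=1$, and $$v^{\mathbf n}_i(\mathbf x)=\frac{\eta^{\mathbf m}}{|\mathcal G^{\mathbf n}\boldsymbol\nu^{\mathbf n}|V}\mathcal G^{\mathbf n}_{i,i}\varsigma^{\mathbf p}_{i,i}\prod_{j\le3}s^{m_j,p_j+\delta^{i,j}}(\mathsf k_jx_j).$$ $\mathscr N_{\mathbf u}=\{(\mathbf m,\mathbf p,c):\mathbf m\in\mathbb Z_{\ge0}^3\setminus\{\mathbf 0\},\ \mathbf p\in\mathscr P^{\mathbf m}_{\mathbf u},\ c\in\mathscr C^{\mathbf m}_{\mathbf u}\}$, where $\mathscr P^{\mathbf m}_{\mathbf u}=\{0,1\}\times\{1\}$ if $m_1>0,m_2=m_3=0$; $\{1\}\times\{0,1\}$ if $m_2>0,m_1=m_3=0$;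 $\{(0,1),(1,0)\}$ if $m_3>0,m_1=m_2=0$; $\{0,1\}^2$ otherwise; $\mathscr C^{\mathbf m}_{\mathbf u}=\{1,2\}$ if all $m_k>0$, else $\{1\}$. The $f^{\mathbf n}$ are $L^2$-orthonormal; the $\mathbf v^{\mathbf n}$ are $L^2$-orthonormal, divergence-free, with $v_3^{\mathbf n}=0$ at $x_3=0,\pi/\mathsf k_3$. Truncated ODE model. For finite $\mathscr N_{\mathbf u}^\tau\subset\mathscr N_{\mathbf u}$, $\mathscr N_\theta^\tau\subset\mathscr N_\theta$ put $\mathbf u^\tau=\sum_{\mathbf n\in\mathscr N_{\mathbf u}^\tau}u^{\tau,\mathbf n}(t)\mathbf v^{\mathbf n}$, $\theta^\tau=\sum_{\mathbf n\in\mathscr N_\theta^\tau}\theta^{\tau,\mathbf n}(t)f^{\mathbf n}$, $\mathcal P^\tau_{\mathbf u}[\mathbf v]=\sum_{\mathbf n\in\mathscr N_{\mathbf u}^\tau}\langle\mathbf v\cdot\mathbf v^{\mathbf n}\rangle\mathbf v^{\mathbf n}$, $\mathcal P_\theta^\tau[g]=\sum_{\mathbf n\in\mathscr N_\theta^\tau}\langle gf^{\mathbf n}\rangle f^{\mathbf n}$. The model is the ODE system for the coefficients $(u^{\tau,\mathbf n},\theta^{\tau,\mathbf n})\in\mathbb R^{|\mathscr N_{\mathbf u}^\tau|}\times\mathbb R^{|\mathscr N_\theta^\tau|}$ given by $$\partial_t\mathbf u^\tau=\mathsf P\Delta\mathbf u^\tau+\mathsf P\mathsf R\,\mathcal P^\tau_{\mathbf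 u}[\theta^\tau\hat{\mathbf e}^3]-\mathsf P\mathsf S\,\mathcal P^\tau_{\mathbf u}[\hat{\mathbf e}^3\times\mathbf u^\tau]-\mathcal P^\tau_{\mathbf u}[\mathbf u^\tau\cdot\nabla\mathbf u^\tau],$$ $$\partial_t\theta^\tau=\Delta\theta^\tau+\mathcal P^\tau_\theta[u_3^\tau]-\mathcal P^\tau_\theta[\mathbf u^\tau\cdot\nabla\theta^\tau].$$ Solutions exist globally in time; $\mathcal S^\tau(t)$ denotes the solution semigroup. Energy Balance Criterion (for $\mathscr N_{\mathbf u}^\tau,\mathscr N_\theta^\tau$). For every pair $\mathbf n'=(\mathbf m',\mathbf p',c')\in\mathscr N_{\mathbf u}^\tau$, $\mathbf n''=(\mathbf m'',\mathbf p'',c'')\in\mathscr N_\theta^\tau$ with $(m_1',m_2')=(m_1'',m_2'')\ne\mathbf 0$, $\mathbf p'=\mathbf p''$, and either $\mathsf k_1m_1'\ne\mathsf k_2m_2'$ or $c'=2$, set $\mathbf n^\pm=(0,0,|m_3'\pm m_3''|,0,0,1)$. If $m_3'=m_3''$, then $\mathbf n^+\in\mathscr N_\theta^\tau$. If $m_3'\ne m_3''$, then either both $\mathbf n^+,\mathbf n^-\in\mathscr N_\theta^\tau$ or both $\mathbf n^+,\mathbf n^-\notin\mathscr N_\theta^\tau$.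
   Formalization: The shift 2(2π)^{3/2}/(k₃m₃) in the ellipsoid is applied only to the vertically stratified temperature modes (0 for the others), since the display with all modes shifted is false; for R=0 the undefined terms u²/(PR) are read as forcing u=0. *)

theory Defs
  imports "HOL-Analysis.Analysis"
begin

text \<open>Throughout, \<open>k :: real^3\<close> is the vector of wave numbers
  \<open>(k\<^sub>1, k\<^sub>2, k\<^sub>3)\<close>; the theorem assumes \<open>k\<^sub>3 = 1 / (k\<^sub>1 k\<^sub>2)\<close>.
  Fields are defined on all of \<open>real^3\<close> (they are trigonometric polynomials), and
  only their restriction to the box \<open>Omega k\<close> matters.\<close>

section \<open>Domain and differential operators\<close>

definition Omega :: "real^3 \<Rightarrow> (real^3) set" where
  "Omega k = cbox 0 (vector [2 * pi / k$1, 2 * pi / k$2, pi / k$3])"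

definition avg :: "real^3 \<Rightarrow> (real^3 \<Rightarrow> real) \<Rightarrow> real" where
  "avg k g = integral (Omega k) g"

definition e3 :: "real^3" where
  "e3 = axis 3 1"

definition pd :: "3 \<Rightarrow> (real^3 \<Rightarrow> real) \<Rightarrow> real^3 \<Rightarrow> real" where
  "pd i g x = deriv (\<lambda>h. g (x + h *\<^sub>R axis i 1)) 0"

definition laplace :: "(real^3 \<Rightarrow> real) \<Rightarrow> real^3 \<Rightarrow> real" where
  "laplace g x = (\<Sum>i\<in>UNIV. pd i (pd i g) x)"

definition vlaplace :: "(real^3 \<Rightarrow> real^3) \<Rightarrow> real^3 \<Rightarrow> real^3" where
  "vlaplace w x = (\<chi> i. laplace (\<lambda>y. w y $ i) x)"

definition advect :: "(real^3 \<Rightarrow> real^3) \<Rightarrow> (real^3 \<Rightarrow> real) \<Rightarrow> real^3 \<Rightarrow> real" where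
  "advect w g x = (\<Sum>j\<in>UNIV. w x $ j * pd j g x)"

definition vadvect :: "(real^3 \<Rightarrow> real^3) \<Rightarrow> (real^3 \<Rightarrow> real^3) \<Rightarrow> real^3 \<Rightarrow> real^3" where
  "vadvect w z x = (\<chi> i. advect w (\<lambda>y. z y $ i) x)"

section \<open>Modes\<close>

text \<open>An index is \<open>(m, p, c)\<close>. The phase is stored as a vector
  \<open>(p\<^sub>1, p\<^sub>2, p\<^sub>3)\<close> whose third entry is always 0; this is enforced by the index
  sets \<open>N_theta\<close> and \<open>N_u\<close>.\<close>

type_synonym mode = "(nat^3) \<times> (nat^3) \<times> nat"

text \<open>The phase argument counts modulo 2.\<close>

definition trig :: "nat \<Rightarrow> nat \<Rightarrow> real \<Rightarrow> real" where
  "trig m p x = (if even p then cos (real m * x) else sin (real m * x))"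

definition iota :: "nat \<Rightarrow> nat" where
  "iota m = (if m = 0 then 0 else 1)"

definition eta :: "nat^3 \<Rightarrow> real" where
  "eta m = (\<Prod>j\<in>UNIV. sqrt 2 ^ iota (m$j))"

definition V :: real where
  "V = sqrt (4 * pi ^ 3)"

definition kdelta :: "3 \<Rightarrow> 3 \<Rightarrow> nat" where
  "kdelta i j = (if i = j then 1 else 0)"

definition wavevec :: "real^3 \<Rightarrow> nat^3 \<Rightarrow> real^3" where
  "wavevec k m = (\<chi> i. k$i * real (m$i))"

subsection \<open>Temperature modes\<close>

definition phases :: "nat \<Rightarrow> nat set" where
  "phases m = (if m = 0 then {0} else {0, 1})"

definition N_theta :: "mode set" where
  "N_theta = {(m, p, c). m$3 > 0 \<and> p$1 \<in> phases (m$1) \<and> p$2 \<in> phases (m$2) \<and> p$3 = 0 \<and> c = 1}"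

definition N_theta_star :: "mode set" where
  "N_theta_star = {(m, p, c). (m, p, c) \<in> N_theta \<and> m$1 = 0 \<and> m$2 = 0}"

fun fmode :: "real^3 \<Rightarrow> mode \<Rightarrow> real^3 \<Rightarrow> real" where
  "fmode k (m, p, c) x =
     eta m / V * trig (m$1) (p$1) (k$1 * x$1) * trig (m$2) (p$2) (k$2 * x$2)
       * trig (m$3) 1 (k$3 * x$3)"

subsection \<open>Velocity modes\<close>

definition gam :: "real^3" where
  "gam = vector [1, 1, -1]"

text \<open>The diagonal of the (diagonal) matrix \<open>G\<close>.\<close>

fun gdiag :: "real^3 \<Rightarrow> mode \<Rightarrow> real^3" where
  "gdiag k (m, p, c) =
     (if c = 1 then cross3 gam (wavevec k m)
      else cross3 (wavevec k m) (cross3 gam (wavevec k m)))"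

fun nu :: "mode \<Rightarrow> real^3" where
  "nu (m, p, c) = (\<chi> i. \<Prod>j\<in>UNIV. real (iota (m$j)) ^ ((p$j + kdelta i j) mod 2))"

text \<open>The diagonal of the sign matrix; \<open>p$3 = 0\<close> makes its third entry 1.\<close>

definition sgnp :: "nat^3 \<Rightarrow> real^3" where
  "sgnp p = (\<chi> i. (-1) ^ (p$i))"

fun vmode :: "real^3 \<Rightarrow> mode \<Rightarrow> real^3 \<Rightarrow> real^3" where
  "vmode k (m, p, c) x =
     (\<chi> i. eta m / (norm (\<chi> i. gdiag k (m, p, c) $ i * nu (m, p, c) $ i) * V)
            * gdiag k (m, p, c) $ i * sgnp p $ i
            * (\<Prod>j\<in>UNIV. trig (m$j) (p$j + kdelta i j) (k$j * x$j)))"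

definition phases_u :: "nat^3 \<Rightarrow> (nat \<times> nat) set" where
  "phases_u m =
     (if m$1 > 0 \<and> m$2 = 0 \<and> m$3 = 0 then {0, 1} \<times> {1}
      else if m$2 > 0 \<and> m$1 = 0 \<and> m$3 = 0 then {1} \<times> {0, 1}
      else if m$3 > 0 \<and> m$1 = 0 \<and> m$2 = 0 then {(0, 1), (1, 0)}
      else {0, 1} \<times> {0, 1})"

definition comps_u :: "nat^3 \<Rightarrow> nat set" where
  "comps_u m = (if \<forall>i. m$i > 0 then {1, 2} else {1})"

definition N_u :: "mode set" where
  "N_u = {(m, p, c). m \<noteq> 0 \<and> (p$1, p$2) \<in> phases_u m \<and> p$3 = 0 \<and> c \<in> comps_u m}"

section \<open>The truncated model\<close>

text \<open>Coefficients of a truncated model are functions on all modes that vanish off the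
  selected finite sets, which identifies \<open>states Nu Nt\<close> with a Euclidean space of
  dimension \<open>card Nu + card Nt\<close>. The product topology on functions restricts to the
  Euclidean topology there, so \<open>compact\<close> has its usual meaning; \<open>state_dist\<close> is the
  Euclidean distance.\<close>

type_synonym state = "(mode \<Rightarrow> real) \<times> (mode \<Rightarrow> real)"

definition states :: "mode set \<Rightarrow> mode set \<Rightarrow> state set" where
  "states Nu Nt = {(u, \<theta>). (\<forall>n. n \<notin> Nu \<longrightarrow> u n = 0) \<and> (\<forall>n. n \<notin> Nt \<longrightarrow> \<theta> n = 0)}"

definition state_dist :: "mode set \<Rightarrow> mode set \<Rightarrow> state \<Rightarrow> state \<Rightarrow> real" where
  "state_dist Nu Nt X Y =
     sqrt ((\<Sum>n\<in>Nu. (fst X n - fst Y n)\<^sup>2) + (\<Sum>n\<in>Nt. (snd X n - snd Y n)\<^sup>2))"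

definition velocity :: "real^3 \<Rightarrow> mode set \<Rightarrow> state \<Rightarrow> real^3 \<Rightarrow> real^3" where
  "velocity k Nu X x = (\<Sum>n\<in>Nu. fst X n *\<^sub>R vmode k n x)"

definition temperature :: "real^3 \<Rightarrow> mode set \<Rightarrow> state \<Rightarrow> real^3 \<Rightarrow> real" where
  "temperature k Nt X x = (\<Sum>n\<in>Nt. snd X n * fmode k n x)"

definition proj_u :: "real^3 \<Rightarrow> mode set \<Rightarrow> (real^3 \<Rightarrow> real^3) \<Rightarrow> real^3 \<Rightarrow> real^3" where
  "proj_u k Nu w x = (\<Sum>n\<in>Nu. avg k (\<lambda>y. w y \<bullet> vmode k n y) *\<^sub>R vmode k n x)"

definition proj_theta :: "real^3 \<Rightarrow> mode set \<Rightarrow> (real^3 \<Rightarrow> real) \<Rightarrow> real^3 \<Rightarrow> real" where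
  "proj_theta k Nt g x = (\<Sum>n\<in>Nt. avg k (\<lambda>y. g y * fmode k n y) * fmode k n x)"

definition rhs_u ::
  "real^3 \<Rightarrow> real \<Rightarrow> real \<Rightarrow> real \<Rightarrow> mode set \<Rightarrow> mode set \<Rightarrow> state \<Rightarrow> real^3 \<Rightarrow> real^3" where
  "rhs_u k P R S Nu Nt X x =
     (let u = velocity k Nu X; \<theta> = temperature k Nt X in
        P *\<^sub>R vlaplace u x
        + (P * R) *\<^sub>R proj_u k Nu (\<lambda>y. \<theta> y *\<^sub>R e3) x
        - (P * S) *\<^sub>R proj_u k Nu (\<lambda>y. cross3 e3 (u y)) x
        - proj_u k Nu (vadvect u u) x)"

definition rhs_theta :: "real^3 \<Rightarrow> mode set \<Rightarrow> mode set \<Rightarrow> state \<Rightarrow> real^3 \<Rightarrow> real" where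
  "rhs_theta k Nu Nt X x =
     (let u = velocity k Nu X; \<theta> = temperature k Nt X in
        laplace \<theta> x + proj_theta k Nt (\<lambda>y. u y $ 3) x - proj_theta k Nt (advect u \<theta>) x)"

text \<open>Global forward solutions, with one-sided derivatives at time 0.\<close>

definition solution ::
  "real^3 \<Rightarrow> real \<Rightarrow> real \<Rightarrow> real \<Rightarrow> mode set \<Rightarrow> mode set \<Rightarrow> (real \<Rightarrow> state) \<Rightarrow> bool" where
  "solution k P R S Nu Nt X \<longleftrightarrow>
     (\<forall>t\<ge>0.
        X t \<in> states Nu Nt
      \<and> (\<forall>n\<in>Nu. (\<lambda>s. fst (X s) n) differentiable (at t within {0..}))
      \<and> (\<forall>n\<in>Nt. (\<lambda>s. snd (X s) n) differentiable (at t within {0..}))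
      \<and> (\<forall>x\<in>Omega k.
            ((\<lambda>s. velocity k Nu (X s) x) has_vector_derivative rhs_u k P R S Nu Nt (X t) x)
              (at t within {0..})
          \<and> ((\<lambda>s. temperature k Nt (X s) x) has_real_derivative rhs_theta k Nu Nt (X t) x)
              (at t within {0..})))"

text \<open>The solution semigroup, for \<open>t \<ge> 0\<close> and initial data in \<open>states Nu Nt\<close>.\<close>

definition flow ::
  "real^3 \<Rightarrow> real \<Rightarrow> real \<Rightarrow> real \<Rightarrow> mode set \<Rightarrow> mode set \<Rightarrow> real \<Rightarrow> state \<Rightarrow> state" where
  "flow k P R S Nu Nt t X0 =
     (THE Y. \<exists>X. solution k P R S Nu Nt X \<and> X 0 = X0 \<and> X t = Y)"

section \<open>Energy balance, criterion and attractors\<close>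

definition energy_balance :: "real^3 \<Rightarrow> mode set \<Rightarrow> mode set \<Rightarrow> (real \<Rightarrow> state) \<Rightarrow> bool" where
  "energy_balance k Nu Nt X \<longleftrightarrow>
     (\<forall>t\<ge>0.
        ((\<lambda>s. avg k (\<lambda>x. (1 - k$3 * x$3 / pi) * temperature k Nt (X s) x))
          has_real_derivative
            (avg k (\<lambda>x. (1 - k$3 * x$3 / pi) * pd 3 (pd 3 (temperature k Nt (X t))) x)
             - k$3 / pi * avg k (\<lambda>x. velocity k Nu (X t) x $ 3 * temperature k Nt (X t) x)))
        (at t within {0..}))"

definition strat :: "nat \<Rightarrow> mode" where
  "strat j = (vector [0, 0, j], 0, 1)"

definition energy_balance_criterion :: "real^3 \<Rightarrow> mode set \<Rightarrow> mode set \<Rightarrow> bool" where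
  "energy_balance_criterion k Nu Nt \<longleftrightarrow>
     (\<forall>m' p' c' m'' p'' c''.
        (m', p', c') \<in> Nu \<and> (m'', p'', c'') \<in> Nt
        \<and> (m'$1, m'$2) = (m''$1, m''$2) \<and> (m'$1, m'$2) \<noteq> (0, 0) \<and> p' = p''
        \<and> (k$1 * real (m'$1) \<noteq> k$2 * real (m'$2) \<or> c' = 2)
      \<longrightarrow>
        (let np = strat (m'$3 + m''$3); nm = strat (nat \<bar>int (m'$3) - int (m''$3)\<bar>) in
           (m'$3 = m''$3 \<longrightarrow> np \<in> Nt)
         \<and> (m'$3 \<noteq> m''$3 \<longrightarrow> (np \<in> Nt \<and> nm \<in> Nt) \<or> (np \<notin> Nt \<and> nm \<notin> Nt))))"

text \<open>The centre of the ellipsoid is displaced only along the vertically stratified modes: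
  these are exactly the temperature modes with \<open>avg k ((1 - k\<^sub>3 x\<^sub>3 / pi) f\<^sup>n) \<noteq> 0\<close>, and the
  displacement comes from completing the square with
  \<open>4 pi / k\<^sub>3 * avg k ((1 - k\<^sub>3 x\<^sub>3 / pi) \<theta>)\<close>.\<close>

fun ball_shift :: "real^3 \<Rightarrow> mode \<Rightarrow> real" where
  "ball_shift k (m, p, c) =
     (if (m, p, c) \<in> N_theta_star then 2 * (2 * pi) powr (3/2) / (k$3 * real (m$3)) else 0)"

text \<open>For \<open>R = 0\<close> the terms \<open>u\<^sup>2 / (P R)\<close> are read as infinite unless \<open>u = 0\<close>, that is, the
  ellipsoid degenerates to the hyperplane \<open>u = 0\<close> (HOL's \<open>u\<^sup>2 / 0 = 0\<close> would instead drop the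
  constraint on \<open>u\<close>).\<close>

definition ellipsoid :: "real^3 \<Rightarrow> real \<Rightarrow> real \<Rightarrow> mode set \<Rightarrow> mode set \<Rightarrow> state set" where
  "ellipsoid k P R Nu Nt =
     {(u, \<theta>). (u, \<theta>) \<in> states Nu Nt
        \<and> (R = 0 \<longrightarrow> (\<forall>n\<in>Nu. u n = 0))
        \<and> (\<Sum>n\<in>Nu. (u n)\<^sup>2 / (P * R)) + (\<Sum>n\<in>Nt. (\<theta> n + ball_shift k n)\<^sup>2)
            \<le> 16 * pi ^ 3 / (MIN i. (k$i)\<^sup>2)
                * (real (card (Nt \<inter> N_theta_star)) / min P 1 + pi ^ 3 / 6)}"

text \<open>Every solution approaches the set \<open>B\<close> exponentially, at a common rate.\<close>

definition exponentially_attracting ::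
  "real^3 \<Rightarrow> real \<Rightarrow> real \<Rightarrow> real \<Rightarrow> mode set \<Rightarrow> mode set \<Rightarrow> state set \<Rightarrow> bool" where
  "exponentially_attracting k P R S Nu Nt B \<longleftrightarrow>
     (\<exists>r>0. \<forall>X. solution k P R S Nu Nt X \<longrightarrow>
        (\<exists>C. \<forall>t\<ge>0. \<exists>b\<in>B. state_dist Nu Nt (X t) b \<le> C * exp (- r * t)))"

definition compact_global_attractor ::
  "real^3 \<Rightarrow> real \<Rightarrow> real \<Rightarrow> real \<Rightarrow> mode set \<Rightarrow> mode set \<Rightarrow> state set \<Rightarrow> bool" where
  "compact_global_attractor k P R S Nu Nt A \<longleftrightarrow>
     A \<subseteq> states Nu Nt \<and> A \<noteq> {} \<and> compact A
   \<and> (\<forall>t\<ge>0. flow k P R S Nu Nt t ` A = A)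
   \<and> (\<forall>D r. D \<subseteq> states Nu Nt
          \<and> (\<forall>X\<in>D. state_dist Nu Nt X (\<lambda>n. 0, \<lambda>n. 0) \<le> r) \<longrightarrow>
        (\<forall>\<epsilon>>0. \<exists>T\<ge>0. \<forall>t\<ge>T. \<forall>X\<in>D. \<exists>a\<in>A.
            state_dist Nu Nt (flow k P R S Nu Nt t X) a < \<epsilon>))"

end

theory Submission
  imports Defs "HOL-Probability.Discrete_Topology"
begin

text \<open>
  Testing the temperature equation with \<open>1 - k\<^sub>3 x\<^sub>3 / \<pi>\<close> only sees the stratified modes
  \<open>f = \<surd>2 sin(j k\<^sub>3 x\<^sub>3) / V\<close>, and the weights are such that
  \<open>\<langle>(1 - k\<^sub>3 x\<^sub>3 / \<pi>) f\<rangle> \<partial>\<^sub>3 f = (2 k\<^sub>3 / \<pi>) cos(j k\<^sub>3 x\<^sub>3)\<close>. Since \<open>u\<close> is divergence free, the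
  balance therefore holds iff \<open>u\<^sub>3 \<theta>\<close> is orthogonal to \<open>1 + 2 \<Sum> cos(j k\<^sub>3 x\<^sub>3)\<close>, the sum running over
  the selected stratified modes. This is a bilinear condition on the coefficients, and for a
  single pair of modes \<open>sin(m' y) sin(m'' y)\<close> only meets the frequencies \<open>\<bar>m' - m''\<bar>\<close> and
  \<open>m' + m''\<close>, which is the criterion.

  If the balance holds, the derivative of
  \<open>\<Sum> u\<^sup>2 / (P R) + \<Sum> \<theta>\<^sup>2 + (4 \<pi> / k\<^sub>3) \<langle>(1 - k\<^sub>3 x\<^sub>3 / \<pi>) \<theta>\<rangle>\<close> contains no exchange term
  \<open>\<langle>u\<^sub>3 \<theta>\<rangle>\<close>. Completing the square mode by mode yields \<open>Q' \<le> - \<lambda> (Q - q)\<close> with \<open>q\<close> strictly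
  smaller than the radius of the ellipsoid (\<open>\<pi>\<^sup>2/6\<close> in place of \<open>\<pi>\<^sup>3/6\<close>), so the ellipsoid is
  entered in finite time. For \<open>R = 0\<close> the weight of \<open>\<Sum> u\<^sup>2\<close> is instead chosen large, at the cost
  of an arbitrarily small part of that margin, and \<open>u\<close> decays by itself.
\<close>

section \<open>Polynomial differential equations\<close>

text \<open>With all stratified modes kept, \<open>1 + 2 \<Sum> cos (j z)\<close>,
  \<open>z = k$3 * x$3\<close>, would be the Dirichlet kernel concentrating at \<open>z = 0\<close>,
  where \<open>u\<^sub>3 \<theta>\<close> vanishes. The balance is thus an identity for the full
  equations, and the criterion controls the error made by cutting the kernel off. Necessity of the
  criterion is tested at time 0 on arbitrary coefficients, which presupposes a solution for every
  initial state. The coefficient field is quadratic, so existence for all times rests on an energy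
  estimate in which incompressibility cancels the nonlinear terms. The weight
  \<open>4 \<pi> / k\<^sub>3\<close> is forced: with velocity weight \<open>1 / (P R)\<close> each
  of the two squared sums produces \<open>2 \<langle>u\<^sub>3 \<theta>\<rangle>\<close>, while the
  balance returns \<open>- k\<^sub>3 / \<pi>\<close> times the flux per unit of potential energy.
  The value \<open>\<pi>\<^sup>2/6\<close> is a sum of inverse squares, since the j-th stratified
  mode is damped \<open>j\<^sup>2\<close> times as strongly as the first.\<close>

lemma norm_integral_exp_bound:
  fixes g :: "real \<Rightarrow> 'a::banach"
  assumes "a > 0" "0 \<le> \<tau>" "continuous_on {0..\<tau>} g" "0 \<le> c"
    and le: "\<And>s. s \<in> {0..\<tau>} \<Longrightarrow> norm (g s) \<le> c * exp (a * s)"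
  shows "norm (integral {0..\<tau>} g) \<le> c / a * exp (a * \<tau>)"
proof -
  have I: "((\<lambda>s. c * exp (a * s)) has_integral (c / a * exp (a * \<tau>) - c / a * exp (a * 0))) {0..\<tau>}"
    using assms by (intro fundamental_theorem_of_calculus)
      (auto intro!: derivative_eq_intros simp: has_real_derivative_iff_has_vector_derivative[symmetric])
  have "norm (integral {0..\<tau>} g) \<le> integral {0..\<tau>} (\<lambda>s. c * exp (a * s))"
    using assms I by (intro integral_norm_bound_integral integrable_continuous_real continuous_intros) auto
  also have "\<dots> = c / a * exp (a * \<tau>) - c / a * exp (a * 0)"
    using I by (rule integral_unique)
  also have "\<dots> \<le> c / a * exp (a * \<tau>)" using assms by simp
  finally show ?thesis .
qed

text \<open>The Picard map is a contraction for the norm weighted by \<open>exp (- 2 \<Lambda> t)\<close>, so no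
  restriction to short times is needed.\<close>

lemma lipschitz_ode_global_solution:
  fixes F :: "'a::banach \<Rightarrow> 'a"
  assumes L: "L-lipschitz_on UNIV F"
  shows "\<exists>X. X 0 = x0 \<and> (\<forall>t\<ge>0. (X has_vector_derivative F (X t)) (at t within {0..}))"
proof -
  \<comment> \<open>The added 1 keeps the rate positive when \<open>L = 0\<close>, so that dividing
    by \<open>2 * \<Lambda>\<close> is safe.\<close>
  define \<Lambda> where "\<Lambda> = L + 1"
  have \<Lambda>: "\<Lambda> > 0" using lipschitz_on_nonneg[OF L] by (simp add: \<Lambda>_def)
  have lip: "norm (F x - F y) \<le> \<Lambda> * norm (x - y)" for x y
  proof -
    have "norm (F x - F y) \<le> L * norm (x - y)"
      using lipschitz_onD[OF L, of x y] by (simp add: dist_norm)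
    also have "\<dots> \<le> \<Lambda> * norm (x - y)" by (intro mult_right_mono) (auto simp: \<Lambda>_def)
    finally show ?thesis .
  qed
  have contF: "continuous_on UNIV F" using L by (rule lipschitz_on_continuous_on)
  \<comment> \<open>The unknown is the rescaled solution
    \<open>Z s = exp (- 2 * \<Lambda> * s) *\<^sub>R X s\<close>, whose sup norm is the weighted
    norm of \<open>X\<close>; the field has to undo the scaling.\<close>
  define G where "G Z = (\<lambda>s. F (exp (2*\<Lambda> * s) *\<^sub>R apply_bcontfun Z s))" for Z :: "real \<Rightarrow>\<^sub>C 'a"
  have contG: "continuous_on S (G Z)" for Z S
    unfolding G_def
    by (intro continuous_on_compose2[OF contF] continuous_intros) auto
  \<comment> \<open>Negative times are frozen at time 0 by \<open>max 0 t\<close>, because members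
    of \<open>bcontfun\<close> live on the whole line.\<close>
  define \<Phi> where "\<Phi> Z = (\<lambda>t. exp (- (2*\<Lambda>) * max 0 t) *\<^sub>R (x0 + integral {0..max 0 t} (G Z)))" for Z
  have PhiB: "\<Phi> Z \<in> bcontfun" for Z
  proof (rule bcontfun_normI)
    have c: "continuous_on {0..N} (\<lambda>t. integral {0..t} (G Z))" for N
      by (intro indefinite_integral_continuous_1 integrable_continuous_real contG)
    have "continuous_on UNIV (\<lambda>t. integral {0..max 0 t} (G Z))"
      unfolding continuous_on_eq_continuous_within
    proof
      fix t :: real
      have "continuous_on {..\<bar>t\<bar>+1} (\<lambda>t. integral {0..max 0 t} (G Z))"
        by (rule continuous_on_compose2[OF c[of "\<bar>t\<bar>+1"]]) (auto intro!: continuous_intros)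
      then have "continuous_on {..<\<bar>t\<bar>+1} (\<lambda>t. integral {0..max 0 t} (G Z))"
        by (rule continuous_on_subset) auto
      then show "isCont (\<lambda>t. integral {0..max 0 t} (G Z)) t"
        by (simp add: continuous_on_eq_continuous_at)
    qed
    then show "continuous_on UNIV (\<Phi> Z)"
      unfolding \<Phi>_def by (intro continuous_intros)
    fix t :: real
    define \<tau> where "\<tau> = max 0 t"
    have "norm (G Z s) \<le> (norm (F 0) + \<Lambda> * norm Z) * exp (2*\<Lambda> * s)" if "s \<in> {0..\<tau>}" for s :: real
    proof -
      have "norm (G Z s) \<le> norm (F 0) + norm (G Z s - F 0)"
        by (metis add_diff_cancel_left' norm_triangle_ineq diff_add_cancel add.commute)
      also have "norm (G Z s - F 0) \<le> \<Lambda> * (exp (2*\<Lambda> * s) * norm (apply_bcontfun Z s))"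
        unfolding G_def using lip[of _ 0] by (metis diff_zero norm_scaleR abs_exp_cancel)
      also have "\<dots> \<le> \<Lambda> * (exp (2*\<Lambda> * s) * norm Z)"
        using \<Lambda> by (intro mult_left_mono norm_bounded) auto
      also have "norm (F 0) \<le> norm (F 0) * exp (2*\<Lambda> * s)"
        using that \<Lambda> mult_left_mono[of 1 "exp (2*\<Lambda> * s)" "norm (F 0)"] by simp
      finally show ?thesis by (simp add: algebra_simps)
    qed
    then have I: "norm (integral {0..\<tau>} (G Z)) \<le> (norm (F 0) + \<Lambda> * norm Z) / (2*\<Lambda>) * exp (2*\<Lambda>*\<tau>)"
      using \<Lambda> by (intro norm_integral_exp_bound contG) (auto simp: \<tau>_def)
    have "norm (\<Phi> Z t) = exp (- (2*\<Lambda>) * \<tau>) * norm (x0 + integral {0..\<tau>} (G Z))"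
      by (simp add: \<Phi>_def \<tau>_def)
    also have "\<dots> \<le> exp (- (2*\<Lambda>) * \<tau>) * (norm x0 + norm (integral {0..\<tau>} (G Z)))"
      by (intro mult_left_mono norm_triangle_ineq) auto
    also have "\<dots> \<le> exp (- (2*\<Lambda>) * \<tau>) * (norm x0 * exp (2*\<Lambda>*\<tau>) + (norm (F 0) + \<Lambda> * norm Z) / (2*\<Lambda>) * exp (2*\<Lambda>*\<tau>))"
      using \<Lambda> I mult_left_mono[of 1 "exp (2*\<Lambda> * \<tau>)" "norm x0"]
      by (intro mult_left_mono add_mono) (auto simp: \<tau>_def)
    also have "\<dots> = norm x0 + (norm (F 0) + \<Lambda> * norm Z) / (2*\<Lambda>)"
      by (simp add: exp_minus field_simps)
    finally show "norm (\<Phi> Z t) \<le> norm x0 + (norm (F 0) + \<Lambda> * norm Z) / (2*\<Lambda>)" .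
  qed
  have app: "apply_bcontfun (Bcontfun (\<Phi> Z)) = \<Phi> Z" for Z
    using PhiB by (rule Bcontfun_inverse)
  have "\<exists>!Z. Bcontfun (\<Phi> Z) = Z"
  proof (rule banach_fix_type[of "1/2"], goal_cases)
    case 3
    show ?case
    proof (intro allI dist_bound)
      fix Z Z' and t :: real
      define \<tau> where "\<tau> = max 0 t"
      \<comment> \<open>Integrating an exponential of rate \<open>2 * \<Lambda>\<close> divides by
        that rate, so the Lipschitz constant \<Lambda> becomes the contraction factor 1/2.\<close>
      have "norm (integral {0..\<tau>} (\<lambda>s. G Z s - G Z' s)) \<le> (\<Lambda> * dist Z Z') / (2*\<Lambda>) * exp (2*\<Lambda>*\<tau>)"
      proof (intro norm_integral_exp_bound continuous_intros contG)
        fix s :: real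
        have "norm (G Z s - G Z' s) \<le> \<Lambda> * norm (exp (2*\<Lambda> * s) *\<^sub>R (apply_bcontfun Z s - apply_bcontfun Z' s))"
          unfolding G_def using lip[of "exp (2*\<Lambda> * s) *\<^sub>R apply_bcontfun Z s" "exp (2*\<Lambda> * s) *\<^sub>R apply_bcontfun Z' s"]
          by (simp add: scaleR_diff_right)
        also have "\<dots> \<le> \<Lambda> * (exp (2*\<Lambda> * s) * dist Z Z')"
          using \<Lambda> dist_bounded[of Z s Z'] by (intro mult_left_mono) (auto simp: dist_norm)
        finally show "norm (G Z s - G Z' s) \<le> \<Lambda> * dist Z Z' * exp (2*\<Lambda> * s)" by (simp add: mult_ac)
      qed (use \<Lambda> in \<open>auto simp: \<tau>_def\<close>)
      moreover have "dist (\<Phi> Z t) (\<Phi> Z' t) = exp (- (2*\<Lambda>) * \<tau>) * norm (integral {0..\<tau>} (\<lambda>s. G Z s - G Z' s))"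
        by (subst integral_diff) (auto intro!: integrable_continuous_real contG
             simp: \<Phi>_def \<tau>_def dist_norm scaleR_diff_right[symmetric])
      ultimately have "dist (\<Phi> Z t) (\<Phi> Z' t) \<le> exp (- (2*\<Lambda>) * \<tau>) * ((\<Lambda> * dist Z Z') / (2*\<Lambda>) * exp (2*\<Lambda>*\<tau>))"
        by (simp add: mult_left_mono)
      also have "\<dots> = 1/2 * dist Z Z'" using \<Lambda> by (simp add: exp_minus field_simps)
      finally show "dist (apply_bcontfun (Bcontfun (\<Phi> Z)) t) (apply_bcontfun (Bcontfun (\<Phi> Z')) t) \<le> 1/2 * dist Z Z'"
        by (simp add: app)
    qed
  qed auto
  then obtain Z where Z: "apply_bcontfun Z = \<Phi> Z" by (metis app)
  define X where "X t = exp (2*\<Lambda>*t) *\<^sub>R apply_bcontfun Z t" for t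
  have GX: "G Z = (\<lambda>s. F (X s))" by (simp add: G_def X_def)
  have X: "X t = x0 + integral {0..t} (\<lambda>s. F (X s))" if "t \<ge> 0" for t
    using that unfolding X_def[of t] by (subst Z) (simp add: \<Phi>_def GX flip: exp_add)
  show ?thesis
  proof (intro exI[of _ X] conjI allI impI)
    show "X 0 = x0" using X[of 0] by simp
    fix t :: real assume t: "t \<ge> 0"
    have "((\<lambda>t. integral {0..t} (\<lambda>s. F (X s))) has_vector_derivative F (X t)) (at t within {0..t+1})"
      using contG[of "{0..t+1}" Z] t by (intro integral_has_vector_derivative) (auto simp: GX)
    then have "((\<lambda>t. x0 + integral {0..t} (\<lambda>s. F (X s))) has_vector_derivative F (X t)) (at t within {0..t+1})"
      by (auto intro!: derivative_eq_intros)
    moreover have "at t within {0..t+1} = at t within {0..}"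
      by (rule at_within_nhd[of t "{..<t+1}"]) auto
    ultimately have "((\<lambda>t. x0 + integral {0..t} (\<lambda>s. F (X s))) has_vector_derivative F (X t)) (at t within {0..})"
      by simp
    then show "(X has_vector_derivative F (X t)) (at t within {0..})"
      by (rule has_vector_derivative_transform[rotated 2]) (use t X in auto)
  qed
qed

text \<open>The product \<open>g t * exp (- c * t)\<close> is nonincreasing, whatever the signs of
  \<open>c\<close> and \<open>g\<close>. The inequality is asked for at interior times only, so
  two-sided derivatives suffice although solutions are one-sided at time 0.\<close>

lemma gronwall:
  fixes g :: "real \<Rightarrow> real"
  assumes "0 \<le> T" and cont: "continuous_on {0..T} g"
    and der: "\<And>t. 0 < t \<Longrightarrow> t < T \<Longrightarrow> \<exists>g'. (g has_real_derivative g') (at t) \<and> g' \<le> c * g t"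
  shows "g T \<le> g 0 * exp (c * T)"
proof -
  have "g T * exp (- c * T) \<le> g 0 * exp (- c * 0)"
  proof (rule DERIV_nonpos_imp_decreasing_open[OF \<open>0 \<le> T\<close>, where f = "\<lambda>t. g t * exp (- c * t)"])
    fix t assume t: "0 < t" "t < T"
    then obtain g' where g': "(g has_real_derivative g') (at t)" "g' \<le> c * g t" using der by blast
    then have "((\<lambda>t. g t * exp (- c * t)) has_real_derivative (g' - c * g t) * exp (- c * t)) (at t)"
      by (auto intro!: derivative_eq_intros simp: algebra_simps)
    with g'(2) show "\<exists>y. ((\<lambda>t. g t * exp (- c * t)) has_real_derivative y) (at t) \<and> y \<le> 0"
      by (auto simp: mult_le_0_iff)
  qed (intro continuous_intros cont)
  then show ?thesis by (simp add: exp_minus field_simps)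
qed

section \<open>Polynomial vector fields: Lipschitz bounds, continuous dependence, uniqueness\<close>

inductive polyfun :: "'i set \<Rightarrow> (('i \<Rightarrow> real) \<Rightarrow> real) \<Rightarrow> bool" for I where
  const: "polyfun I (\<lambda>x. c)"
| coord: "i \<in> I \<Longrightarrow> polyfun I (\<lambda>x. x i)"
| add: "polyfun I f \<Longrightarrow> polyfun I g \<Longrightarrow> polyfun I (\<lambda>x. f x + g x)"
| mult: "polyfun I f \<Longrightarrow> polyfun I g \<Longrightarrow> polyfun I (\<lambda>x. f x * g x)"

lemma polyfun_diff: "polyfun I f \<Longrightarrow> polyfun I g \<Longrightarrow> polyfun I (\<lambda>x. f x - g x)"
  using polyfun.add[of I f "\<lambda>x. (-1) * g x"] polyfun.mult[OF polyfun.const[of I "-1"], of g] by simp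

lemma polyfun_sum: "(\<And>a. a \<in> A \<Longrightarrow> polyfun I (f a)) \<Longrightarrow> polyfun I (\<lambda>x. \<Sum>a\<in>A. f a x)"
  by (induction A rule: infinite_finite_induct) (auto intro: polyfun.intros)

text \<open>The bound \<open>M\<close> has to be carried through the induction, because the
  Lipschitz constant of a product involves the sizes of both factors.\<close>

lemma polyfun_lipschitz_on_box:
  assumes "finite I" "polyfun I f"
  shows "\<exists>L\<ge>0. \<exists>M\<ge>0. \<forall>x y. (\<forall>i\<in>I. \<bar>x i\<bar> \<le> \<rho> \<and> \<bar>y i\<bar> \<le> \<rho>) \<longrightarrow>
     \<bar>f x - f y\<bar> \<le> L * (\<Sum>i\<in>I. \<bar>x i - y i\<bar>) \<and> \<bar>f x\<bar> \<le> M"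
  using assms(2)
proof induction
  case (const c)
  then show ?case by (intro exI[of _ 0] conjI exI[of _ "\<bar>c\<bar>"]) auto
next
  case (coord i)
  have "\<bar>x i - y i\<bar> \<le> (\<Sum>i\<in>I. \<bar>x i - y i\<bar>)" for x y :: "'a \<Rightarrow> real"
    using coord assms(1) by (intro member_le_sum) auto
  then show ?case using coord by (intro exI[of _ 1] conjI exI[of _ "\<bar>\<rho>\<bar>"]) force+
next
  case (add f g)
  obtain L M where f: "L \<ge> 0" "M \<ge> 0" "\<And>x y. (\<forall>i\<in>I. \<bar>x i\<bar> \<le> \<rho> \<and> \<bar>y i\<bar> \<le> \<rho>) \<Longrightarrow>
     \<bar>f x - f y\<bar> \<le> L * (\<Sum>i\<in>I. \<bar>x i - y i\<bar>) \<and> \<bar>f x\<bar> \<le> M" using add.IH(1) by blast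
  obtain L' M' where g: "L' \<ge> 0" "M' \<ge> 0" "\<And>x y. (\<forall>i\<in>I. \<bar>x i\<bar> \<le> \<rho> \<and> \<bar>y i\<bar> \<le> \<rho>) \<Longrightarrow>
     \<bar>g x - g y\<bar> \<le> L' * (\<Sum>i\<in>I. \<bar>x i - y i\<bar>) \<and> \<bar>g x\<bar> \<le> M'" using add.IH(2) by blast
  show ?case
  proof (rule exI[of _ "L + L'"], rule conjI[OF _ exI[of _ "M + M'"]], safe)
    fix x y :: "'a \<Rightarrow> real" assume xy: "\<forall>i\<in>I. \<bar>x i\<bar> \<le> \<rho> \<and> \<bar>y i\<bar> \<le> \<rho>"
    show "\<bar>f x + g x - (f y + g y)\<bar> \<le> (L + L') * (\<Sum>i\<in>I. \<bar>x i - y i\<bar>)"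
      using f(3)[OF xy] g(3)[OF xy] unfolding distrib_right by linarith
    show "\<bar>f x + g x\<bar> \<le> M + M'" using f(3)[OF xy] g(3)[OF xy] by linarith
  qed (use f g in auto)
next
  case (mult f g)
  obtain L M where f: "L \<ge> 0" "M \<ge> 0" "\<And>x y. (\<forall>i\<in>I. \<bar>x i\<bar> \<le> \<rho> \<and> \<bar>y i\<bar> \<le> \<rho>) \<Longrightarrow>
     \<bar>f x - f y\<bar> \<le> L * (\<Sum>i\<in>I. \<bar>x i - y i\<bar>) \<and> \<bar>f x\<bar> \<le> M" using mult.IH(1) by blast
  obtain L' M' where g: "L' \<ge> 0" "M' \<ge> 0" "\<And>x y. (\<forall>i\<in>I. \<bar>x i\<bar> \<le> \<rho> \<and> \<bar>y i\<bar> \<le> \<rho>) \<Longrightarrow>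
     \<bar>g x - g y\<bar> \<le> L' * (\<Sum>i\<in>I. \<bar>x i - y i\<bar>) \<and> \<bar>g x\<bar> \<le> M'" using mult.IH(2) by blast
  show ?case
  proof (rule exI[of _ "M * L' + L * M'"], rule conjI[OF _ exI[of _ "M * M'"]], safe)
    fix x y :: "'a \<Rightarrow> real" assume xy: "\<forall>i\<in>I. \<bar>x i\<bar> \<le> \<rho> \<and> \<bar>y i\<bar> \<le> \<rho>"
    let ?S = "\<Sum>i\<in>I. \<bar>x i - y i\<bar>"
    have "\<bar>f x * g x - f y * g y\<bar> = \<bar>f x * (g x - g y) + (f x - f y) * g y\<bar>" by (simp add: algebra_simps)
    also have "\<dots> \<le> \<bar>f x\<bar> * \<bar>g x - g y\<bar> + \<bar>f x - f y\<bar> * \<bar>g y\<bar>"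
      by (metis abs_mult abs_triangle_ineq)
    also have "\<dots> \<le> M * (L' * ?S) + (L * ?S) * M'"
      using f(3)[OF xy] g(3)[OF xy] g(3)[of y x] xy f(1) f(2) g(2)
      by (intro add_mono mult_mono) (auto intro!: sum_nonneg mult_nonneg_nonneg)
    finally show "\<bar>f x * g x - f y * g y\<bar> \<le> (M * L' + L * M') * ?S" by (simp add: algebra_simps)
    show "\<bar>f x * g x\<bar> \<le> M * M'" using f(3)[OF xy] g(3)[OF xy] f(2) by (auto simp: abs_mult intro: mult_mono)
  qed (use f g in auto)
qed

definition solves :: "'i set \<Rightarrow> (('i \<Rightarrow> real) \<Rightarrow> 'i \<Rightarrow> real) \<Rightarrow> real set \<Rightarrow> (real \<Rightarrow> 'i \<Rightarrow> real) \<Rightarrow> bool" where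
  "solves I F S x \<longleftrightarrow> (\<forall>t\<in>S. \<forall>i\<in>I. ((\<lambda>s. x s i) has_real_derivative F (x t) i) (at t within S))"

lemma solves_subset: "solves I F S x \<Longrightarrow> S' \<subseteq> S \<Longrightarrow> solves I F S' x"
  unfolding solves_def by (meson DERIV_subset subset_iff)

lemma solves_interior:
  assumes "solves I F {0..T} x" "0 < t" "t < T" "i \<in> I"
  shows "((\<lambda>s. x s i) has_real_derivative F (x t) i) (at t)"
proof -
  have "at t within {0..T} = at t" using assms by (intro at_within_interior) auto
  moreover have "((\<lambda>s. x s i) has_real_derivative F (x t) i) (at t within {0..T})"
    using assms unfolding solves_def by auto
  ultimately show ?thesis by simp
qed

lemma solves_continuous_on: "solves I F S x \<Longrightarrow> i \<in> I \<Longrightarrow> continuous_on S (\<lambda>s. x s i)"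
  unfolding solves_def by (auto simp: continuous_on_eq_continuous_within intro: DERIV_continuous)

locale poly_vf =
  fixes I :: "'i set" and F :: "('i \<Rightarrow> real) \<Rightarrow> 'i \<Rightarrow> real"
  assumes fin: "finite I" and poly: "\<And>i. i \<in> I \<Longrightarrow> polyfun I (\<lambda>x. F x i)"
begin

lemma lipschitz_on_box:
  obtains L where "L \<ge> 0" "\<And>x y i. \<forall>i\<in>I. \<bar>x i\<bar> \<le> \<rho> \<and> \<bar>y i\<bar> \<le> \<rho> \<Longrightarrow> i \<in> I \<Longrightarrow>
     \<bar>F x i - F y i\<bar> \<le> L * (\<Sum>i\<in>I. \<bar>x i - y i\<bar>)"
proof -
  have "\<forall>i\<in>I. \<exists>L\<ge>0. \<forall>x y. (\<forall>i\<in>I. \<bar>x i\<bar> \<le> \<rho> \<and> \<bar>y i\<bar> \<le> \<rho>) \<longrightarrow>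
     \<bar>F x i - F y i\<bar> \<le> L * (\<Sum>i\<in>I. \<bar>x i - y i\<bar>)"
    using polyfun_lipschitz_on_box[OF fin poly] by meson
  then obtain L where L: "\<And>i. i \<in> I \<Longrightarrow> L i \<ge> 0"
    "\<And>i x y. i \<in> I \<Longrightarrow> (\<forall>i\<in>I. \<bar>x i\<bar> \<le> \<rho> \<and> \<bar>y i\<bar> \<le> \<rho>) \<Longrightarrow>
     \<bar>F x i - F y i\<bar> \<le> L i * (\<Sum>i\<in>I. \<bar>x i - y i\<bar>)" by metis
  show ?thesis
  proof (rule that[of "sum L I"])
    show "sum L I \<ge> 0" using L(1) by (rule sum_nonneg)
    fix x y i assume xy: "\<forall>i\<in>I. \<bar>x i\<bar> \<le> \<rho> \<and> \<bar>y i\<bar> \<le> \<rho>" and i: "i \<in> I"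
    have "\<bar>F x i - F y i\<bar> \<le> L i * (\<Sum>i\<in>I. \<bar>x i - y i\<bar>)" using L(2) i xy by blast
    also have "\<dots> \<le> sum L I * (\<Sum>i\<in>I. \<bar>x i - y i\<bar>)"
      using i L(1) fin by (intro mult_right_mono member_le_sum sum_nonneg) auto
    finally show "\<bar>F x i - F y i\<bar> \<le> sum L I * (\<Sum>i\<in>I. \<bar>x i - y i\<bar>)" .
  qed
qed

text \<open>The constant depends on the box only: it is fixed before the time and the two
  trajectories, so the estimate is uniform over all trajectories that stay in the box. This later
  yields continuity of the time maps.\<close>

lemma continuous_dependence:
  obtains c where "\<And>T x y. 0 \<le> T \<Longrightarrow> solves I F {0..T} x \<Longrightarrow> solves I F {0..T} y \<Longrightarrow>
    (\<And>t i. t \<in> {0..T} \<Longrightarrow> i \<in> I \<Longrightarrow> \<bar>x t i\<bar> \<le> \<rho> \<and> \<bar>y t i\<bar> \<le> \<rho>) \<Longrightarrow>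
    (\<Sum>i\<in>I. (x T i - y T i)\<^sup>2) \<le> (\<Sum>i\<in>I. (x 0 i - y 0 i)\<^sup>2) * exp (c * T)"
proof -
  obtain L where L: "L \<ge> 0" "\<And>x y i. \<forall>i\<in>I. \<bar>x i\<bar> \<le> \<rho> \<and> \<bar>y i\<bar> \<le> \<rho> \<Longrightarrow> i \<in> I \<Longrightarrow>
     \<bar>F x i - F y i\<bar> \<le> L * (\<Sum>i\<in>I. \<bar>x i - y i\<bar>)" using lipschitz_on_box by blast
  show ?thesis
  \<comment> \<open>Differentiating the squares gives the factor 2, and Cauchy-Schwarz turns the
    squared l1 distance into \<open>card I\<close> times the sum of squares.\<close>
  proof (rule that[of "2 * L * card I"])
    fix T :: real and x y
    assume T: "0 \<le> T" and x: "solves I F {0..T} x" and y: "solves I F {0..T} y"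
      and b: "\<And>t i. t \<in> {0..T} \<Longrightarrow> i \<in> I \<Longrightarrow> \<bar>x t i\<bar> \<le> \<rho> \<and> \<bar>y t i\<bar> \<le> \<rho>"
    show "(\<Sum>i\<in>I. (x T i - y T i)\<^sup>2) \<le> (\<Sum>i\<in>I. (x 0 i - y 0 i)\<^sup>2) * exp (2 * L * card I * T)"
    proof (rule gronwall[OF T, where g = "\<lambda>t. \<Sum>i\<in>I. (x t i - y t i)\<^sup>2"])
      show "continuous_on {0..T} (\<lambda>t. \<Sum>i\<in>I. (x t i - y t i)\<^sup>2)"
        by (intro continuous_intros solves_continuous_on[OF x] solves_continuous_on[OF y])
      fix t assume t: "0 < t" "t < T"
      let ?S = "\<Sum>i\<in>I. \<bar>x t i - y t i\<bar>"
      have "((\<lambda>t. \<Sum>i\<in>I. (x t i - y t i)\<^sup>2) has_real_derivative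
          (\<Sum>i\<in>I. 2 * (x t i - y t i) * (F (x t) i - F (y t) i))) (at t)"
        using solves_interior[OF x t] solves_interior[OF y t]
        by (auto intro!: derivative_eq_intros sum.cong)
      moreover have "(\<Sum>i\<in>I. 2 * (x t i - y t i) * (F (x t) i - F (y t) i)) \<le> (\<Sum>i\<in>I. 2 * (\<bar>x t i - y t i\<bar> * (L * ?S)))"
      proof (rule sum_mono)
        fix i assume i: "i \<in> I"
        have "(x t i - y t i) * (F (x t) i - F (y t) i) \<le> \<bar>x t i - y t i\<bar> * \<bar>F (x t) i - F (y t) i\<bar>"
          by (metis abs_ge_self abs_mult)
        also have "\<dots> \<le> \<bar>x t i - y t i\<bar> * (L * ?S)"
          using t i b by (intro mult_left_mono L(2)) auto
        finally show "2 * (x t i - y t i) * (F (x t) i - F (y t) i) \<le> 2 * (\<bar>x t i - y t i\<bar> * (L * ?S))"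
          unfolding mult.assoc by (rule mult_left_mono) simp
      qed
      moreover have "(\<Sum>i\<in>I. 2 * (\<bar>x t i - y t i\<bar> * (L * ?S))) = 2 * L * ?S\<^sup>2"
        by (simp add: sum_distrib_right[symmetric] sum_distrib_left[symmetric] power2_eq_square)
      moreover have "2 * L * ?S\<^sup>2 \<le> 2 * L * card I * (\<Sum>i\<in>I. (x t i - y t i)\<^sup>2)"
        using L(1) sum_squared_le_sum_of_squares[of "\<lambda>i. \<bar>x t i - y t i\<bar>" I] fin
          mult_left_mono[of "?S\<^sup>2" "card I * (\<Sum>i\<in>I. (x t i - y t i)\<^sup>2)" "2 * L"]
        by (simp add: mult_ac)
      ultimately show "\<exists>g'. ((\<lambda>t. \<Sum>i\<in>I. (x t i - y t i)\<^sup>2) has_real_derivative g') (at t) \<and>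
              g' \<le> 2 * L * card I * (\<Sum>i\<in>I. (x t i - y t i)\<^sup>2)"
        by (smt (verit))
    qed
  qed
qed

lemma solves_bounded:
  assumes "solves I F {0..T} x"
  shows "\<exists>\<rho>. \<forall>t\<in>{0..T}. \<forall>i\<in>I. \<bar>x t i\<bar> \<le> \<rho>"
proof -
  have "continuous_on {0..T} (\<lambda>t. \<Sum>i\<in>I. \<bar>x t i\<bar>)"
    by (intro continuous_intros solves_continuous_on[OF assms])
  then have "bounded ((\<lambda>t. \<Sum>i\<in>I. \<bar>x t i\<bar>) ` {0..T})"
    by (intro compact_imp_bounded compact_continuous_image) auto
  then obtain \<rho> where "\<forall>y\<in>(\<lambda>t. \<Sum>i\<in>I. \<bar>x t i\<bar>) ` {0..T}. norm y \<le> \<rho>"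
    unfolding bounded_iff by blast
  then have r: "\<And>t. t \<in> {0..T} \<Longrightarrow> \<bar>\<Sum>i\<in>I. \<bar>x t i\<bar>\<bar> \<le> \<rho>" by simp
  have "\<bar>x t i\<bar> \<le> \<rho>" if "t \<in> {0..T}" "i \<in> I" for t i
  proof -
    have "\<bar>x t i\<bar> \<le> (\<Sum>i\<in>I. \<bar>x t i\<bar>)" using that fin by (intro member_le_sum) auto
    with r[OF that(1)] show ?thesis by linarith
  qed
  then show ?thesis by blast
qed

lemma uniqueness:
  assumes "solves I F {0..T} x" "solves I F {0..T} y" "\<And>i. i \<in> I \<Longrightarrow> x 0 i = y 0 i"
    "t \<in> {0..T}" "i \<in> I"
  shows "x t i = y t i"
proof -
  have st: "{0..t} \<subseteq> {0..T}" using assms(4) by auto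
  obtain r1 where r1: "\<forall>t\<in>{0..T}. \<forall>i\<in>I. \<bar>x t i\<bar> \<le> r1" using solves_bounded assms(1) by blast
  obtain r2 where r2: "\<forall>t\<in>{0..T}. \<forall>i\<in>I. \<bar>y t i\<bar> \<le> r2" using solves_bounded assms(2) by blast
  obtain c where c: "\<And>T x y. 0 \<le> T \<Longrightarrow> solves I F {0..T} x \<Longrightarrow> solves I F {0..T} y \<Longrightarrow>
    (\<And>t i. t \<in> {0..T} \<Longrightarrow> i \<in> I \<Longrightarrow> \<bar>x t i\<bar> \<le> max r1 r2 \<and> \<bar>y t i\<bar> \<le> max r1 r2) \<Longrightarrow>
    (\<Sum>i\<in>I. (x T i - y T i)\<^sup>2) \<le> (\<Sum>i\<in>I. (x 0 i - y 0 i)\<^sup>2) * exp (c * T)"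
    using continuous_dependence by blast
  have "(\<Sum>i\<in>I. (x t i - y t i)\<^sup>2) \<le> (\<Sum>i\<in>I. (x 0 i - y 0 i)\<^sup>2) * exp (c * t)"
    using assms(4) r1 r2 by (intro c solves_subset[OF assms(1) st] solves_subset[OF assms(2) st]) force+
  also have "\<dots> = 0" using assms(3) by simp
  finally have "(\<Sum>i\<in>I. (x t i - y t i)\<^sup>2) = 0" by (simp add: sum_nonneg order_antisym)
  then show ?thesis using fin assms(5) by (simp add: sum_nonneg_eq_0_iff)
qed

end

instance bcontfun :: (metric_space, banach) banach ..

lemma abs_clamp_diff_le: "\<bar>max (- r) (min r a) - max (- r) (min r b)\<bar> \<le> \<bar>a - b\<bar>" for a b r :: real
  by (auto simp: max_def min_def)

context poly_vf
begin

text \<open>The finitely many coordinates live in the Banach space \<open>'i discrete \<Rightarrow>\<^sub>C real\<close>, which avoids a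
  type depending on \<open>card I\<close>.\<close>

lemma clamped_solution:
  assumes "\<rho> \<ge> 0"
  shows "\<exists>x. (\<forall>i\<in>I. x 0 i = x0 i) \<and> solves I (\<lambda>x. F (\<lambda>i. max (- \<rho>) (min \<rho> (x i)))) {0..} x"
proof -
  \<comment> \<open>Projecting onto the box before applying the polynomial field makes it globally
    Lipschitz and leaves it unchanged inside the box.\<close>
  define K where "K z = (\<lambda>i. max (- \<rho>) (min \<rho> (z i)))" for z :: "'i \<Rightarrow> real"
  define E :: "('i \<Rightarrow> real) \<Rightarrow> 'i discrete \<Rightarrow>\<^sub>C real"
    where "E c = Bcontfun (\<lambda>d. if of_discrete d \<in> I then c (of_discrete d) else 0)" for c
  have E': "apply_bcontfun (E c) = (\<lambda>d. if of_discrete d \<in> I then c (of_discrete d) else 0)" for c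
    unfolding E_def
  proof (rule Bcontfun_inverse)
    have "range (\<lambda>d. if of_discrete d \<in> I then c (of_discrete d) else 0) \<subseteq> insert 0 (c ` I)" by auto
    then have "bounded (range (\<lambda>d. if of_discrete d \<in> I then c (of_discrete d) else 0))"
      by (rule bounded_subset[rotated]) (use fin in \<open>auto intro: finite_imp_bounded\<close>)
    then show "(\<lambda>d. if of_discrete d \<in> I then c (of_discrete d) else 0) \<in> bcontfun"
      unfolding bcontfun_def by (simp add: continuous_on_open_vimage open_discrete)
  qed
  then have E: "apply_bcontfun (E c) (discrete i) = c i" if "i \<in> I" for c i
    using that by (simp add: discrete_inverse)
  define R where "R z = (\<lambda>i. apply_bcontfun z (discrete i))" for z :: "'i discrete \<Rightarrow>\<^sub>C real"
  define F' where "F' z = E (F (K (R z)))" for z :: "'i discrete \<Rightarrow>\<^sub>C real"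
  obtain L where L: "L \<ge> 0" "\<And>x y i. \<forall>i\<in>I. \<bar>x i\<bar> \<le> \<rho> \<and> \<bar>y i\<bar> \<le> \<rho> \<Longrightarrow> i \<in> I \<Longrightarrow>
     \<bar>F x i - F y i\<bar> \<le> L * (\<Sum>i\<in>I. \<bar>x i - y i\<bar>)" using lipschitz_on_box by blast
  have "(L * card I)-lipschitz_on UNIV F'"
  proof (rule lipschitz_onI)
    fix z z' :: "'i discrete \<Rightarrow>\<^sub>C real"
    show "dist (F' z) (F' z') \<le> L * card I * dist z z'"
    proof (rule dist_bound)
      fix n
      show "dist (apply_bcontfun (F' z) n) (apply_bcontfun (F' z') n) \<le> L * card I * dist z z'"
      proof (cases "of_discrete n \<in> I")
        case True
        then obtain i where i: "i \<in> I" "n = discrete i" by (metis of_discrete_inverse)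
        have "dist (apply_bcontfun (F' z) n) (apply_bcontfun (F' z') n) = \<bar>F (K (R z)) i - F (K (R z')) i\<bar>"
          using i by (simp add: F'_def E dist_real_def)
        also have "\<dots> \<le> L * (\<Sum>i\<in>I. \<bar>K (R z) i - K (R z') i\<bar>)"
          using i assms by (intro L(2)) (auto simp: K_def)
        also have "\<dots> \<le> L * (\<Sum>i\<in>I. dist z z')"
          using L(1) unfolding K_def R_def
          by (intro mult_left_mono sum_mono order_trans[OF abs_clamp_diff_le])
            (auto simp: dist_real_def[symmetric] dist_bounded)
        finally show ?thesis by (simp add: mult_ac)
      next
        case False
        then show ?thesis using L(1) by (simp add: F'_def E')
      qed
    qed
  qed (use L in auto)
  then obtain Z where Z: "Z 0 = E x0"
    "\<And>t. t \<ge> 0 \<Longrightarrow> (Z has_vector_derivative F' (Z t)) (at t within {0..})"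
    using lipschitz_ode_global_solution[of "L * card I" F' "E x0"] by blast
  have bl: "bounded_linear (\<lambda>z :: 'i discrete \<Rightarrow>\<^sub>C real. apply_bcontfun z n)" for n
    by (rule bounded_linear_intro[of _ 1]) (auto simp: norm_bounded simp del: real_norm_def)
  show ?thesis
  proof (intro exI[of _ "\<lambda>t. R (Z t)"] conjI ballI)
    show "R (Z 0) i = x0 i" if "i \<in> I" for i using that by (simp add: Z R_def E)
    show "solves I (\<lambda>x. F (\<lambda>i. max (- \<rho>) (min \<rho> (x i)))) {0..} (\<lambda>t. R (Z t))"
      unfolding solves_def
    proof (intro ballI)
      fix t :: real and i assume "t \<in> {0..}" and i: "i \<in> I"
      then have "((\<lambda>s. apply_bcontfun (Z s) (discrete i)) has_vector_derivative apply_bcontfun (F' (Z t)) (discrete i)) (at t within {0..})"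
        by (intro bounded_linear.has_vector_derivative[OF bl] Z) auto
      then show "((\<lambda>s. R (Z s) i) has_real_derivative F (\<lambda>i. max (- \<rho>) (min \<rho> (R (Z t) i))) i) (at t within {0..})"
        by (simp add: has_real_derivative_iff_has_vector_derivative R_def F'_def E[OF i] K_def)
    qed
  qed
qed

end

section \<open>Global existence when the radial part of the field is bounded by the energy\<close>

locale poly_vf_energy = poly_vf +
  fixes C :: real
  assumes energy: "\<And>x. (\<Sum>i\<in>I. x i * F x i) \<le> C * (\<Sum>i\<in>I. (x i)\<^sup>2)"
begin

text \<open>The box is chosen larger than the energy can grow up to time \<open>T\<close>, so the
  solution of the clamped equation never feels the clamp and solves the original one.\<close>

lemma solution_upto:
  assumes "0 \<le> T"
  shows "\<exists>x. (\<forall>i\<in>I. x 0 i = x0 i) \<and> solves I F {0..T} x"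
proof -
  define r where "r = (\<Sum>i\<in>I. (x0 i)\<^sup>2)"
  have r: "r \<ge> 0" unfolding r_def by (intro sum_nonneg) auto
  \<comment> \<open>The extra 1 makes the energy bound strict, and it ensures
    \<open>\<rho> \<le> \<rho>\<^sup>2\<close>, so that energy at most \<rho> bounds each coordinate
    by \<rho>. The absolute value covers negative \<open>C\<close>.\<close>
  define \<rho> where "\<rho> = r * exp (2 * \<bar>C\<bar> * T) + 1"
  have \<rho>: "\<rho> \<ge> 1" using r by (simp add: \<rho>_def)
  obtain x where x0: "\<And>i. i \<in> I \<Longrightarrow> x 0 i = x0 i"
    and x: "solves I (\<lambda>x. F (\<lambda>i. max (- \<rho>) (min \<rho> (x i)))) {0..} x"
    using clamped_solution[of \<rho>] \<rho> by force
  define e where "e t = (\<Sum>i\<in>I. (x t i)\<^sup>2)" for t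
  have conte: "continuous_on {0..} e"
    unfolding e_def by (intro continuous_intros solves_continuous_on[OF x])
  have e0: "e 0 = r" by (simp add: e_def r_def x0)
  have box: "\<bar>x t i\<bar> \<le> \<rho>" if "e t \<le> \<rho>" "i \<in> I" for t i
  proof -
    have "(x t i)\<^sup>2 \<le> e t" unfolding e_def using that fin by (intro member_le_sum) auto
    also have "\<dots> \<le> \<rho>\<^sup>2" using that \<rho> power_increasing[of 1 2 \<rho>] by simp
    finally show ?thesis using \<rho> by (simp flip: abs_le_square_iff)
  qed
  have clamp: "F (\<lambda>i. max (- \<rho>) (min \<rho> (x t i))) i = F (x t) i" if "e t \<le> \<rho>" "i \<in> I" for t i
  proof -
    obtain L where L: "L \<ge> 0" "\<And>x y i. \<forall>i\<in>I. \<bar>x i\<bar> \<le> \<rho> \<and> \<bar>y i\<bar> \<le> \<rho> \<Longrightarrow> i \<in> I \<Longrightarrow>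
      \<bar>F x i - F y i\<bar> \<le> L * (\<Sum>i\<in>I. \<bar>x i - y i\<bar>)" using lipschitz_on_box by blast
    have cl: "max (- \<rho>) (min \<rho> (x t i)) = x t i" if "i \<in> I" for i
      using box[OF \<open>e t \<le> \<rho>\<close> that] by auto
    \<comment> \<open>The clamped state may differ from \<open>x t\<close> off \<open>I\<close>.
      That \<open>F\<close> only sees coordinates in \<open>I\<close> is expressed by the Lipschitz
      bound with distance zero.\<close>
    have "\<bar>F (\<lambda>i. max (- \<rho>) (min \<rho> (x t i))) i - F (x t) i\<bar> \<le> L * (\<Sum>i\<in>I. \<bar>max (- \<rho>) (min \<rho> (x t i)) - x t i\<bar>)"
      using that box[OF that(1)] cl by (intro L(2)) auto
    also have "\<dots> = 0" using cl by simp
    finally show ?thesis by simp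
  qed
  have bound: "e t < \<rho>" if "t \<in> {0..T}" for t
  proof (rule ccontr)
    assume "\<not> e t < \<rho>"
    \<comment> \<open>The first time in \<open>A\<close> is the first exit time. Before it the clamp
      is inactive, so the energy inequality applies and keeps the energy strictly below \<rho>, a
      contradiction.\<close>
    define A where "A = {s \<in> {0..t}. e s \<in> {\<rho>..}}"
    have "closed A" unfolding A_def
      using continuous_on_closed_Collect_le[of "{0..t}" "\<lambda>_. \<rho>" e] continuous_on_subset[OF conte, of "{0..t}"]
      by simp
    moreover have "bounded A" by (rule bounded_subset[OF bounded_closed_interval[of 0 t]]) (auto simp: A_def)
    ultimately have "compact A" by (simp add: compact_eq_bounded_closed)
    moreover have "t \<in> A" using that \<open>\<not> e t < \<rho>\<close> by (auto simp: A_def)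
    ultimately obtain s where s: "s \<in> A" "\<And>s'. s' \<in> A \<Longrightarrow> s \<le> s'"
      using compact_attains_inf[of A] by blast
    have s': "0 \<le> s" "s \<le> T" "e s \<ge> \<rho>" using s(1) that by (auto simp: A_def)
    have "e s \<le> e 0 * exp (2 * C * s)"
    proof (rule gronwall)
      show "continuous_on {0..s} e" using conte by (rule continuous_on_subset) auto
      fix \<tau> assume \<tau>: "0 < \<tau>" "\<tau> < s"
      then have "\<tau> \<notin> A" using s(2)[of \<tau>] by auto
      then have le: "e \<tau> \<le> \<rho>" using \<tau> s(1) by (auto simp: A_def)
      have "((\<lambda>t. x t i) has_real_derivative F (x \<tau>) i) (at \<tau>)" if "i \<in> I" for i
        using solves_interior[OF solves_subset[OF x], of s \<tau> i] \<tau> that clamp[OF le that] by simp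
      then have "(e has_real_derivative (\<Sum>i\<in>I. 2 * (x \<tau> i * F (x \<tau>) i))) (at \<tau>)"
        unfolding e_def by (auto intro!: derivative_eq_intros sum.cong)
      moreover have "(\<Sum>i\<in>I. 2 * (x \<tau> i * F (x \<tau>) i)) \<le> 2 * C * e \<tau>"
        using energy[of "x \<tau>"] by (simp add: e_def sum_distrib_left[symmetric])
      ultimately show "\<exists>g'. (e has_real_derivative g') (at \<tau>) \<and> g' \<le> 2 * C * e \<tau>" by blast
    qed (use s' in auto)
    also have "\<dots> \<le> r * exp (2 * \<bar>C\<bar> * T)"
      unfolding e0 using s' r by (intro mult_left_mono) (auto intro!: mult_mono)
    also have "\<dots> < \<rho>" by (simp add: \<rho>_def)
    finally show False using s' by simp
  qed
  have "solves I F {0..T} x"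
    using solves_subset[OF x, of "{0..T}"] clamp bound unfolding solves_def
    by (metis atLeastatMost_subset_iff atLeast_iff atLeastAtMost_iff less_imp_le subsetI)
  with x0 show ?thesis by blast
qed

theorem global_solution: "\<exists>x. (\<forall>i\<in>I. x 0 i = x0 i) \<and> solves I F {0..} x"
proof -
  have "\<forall>N. \<exists>x. (\<forall>i\<in>I. x 0 i = x0 i) \<and> solves I F {0..real N} x"
    using solution_upto by simp
  then obtain X where X0: "\<And>N i. i \<in> I \<Longrightarrow> X N 0 i = x0 i" and X: "\<And>N. solves I F {0..real N} (X N)"
    by metis
  \<comment> \<open>Taking the solution on an interval that reaches beyond \<open>t\<close> makes
    the glued function agree with a single solution near \<open>t\<close>, up to the boundary at
    time 0.\<close>
  define x where "x t = X (Suc (nat \<lceil>t\<rceil>)) t" for t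
  have eq: "x s i = X N s i" if "0 \<le> s" "s \<le> real N" "i \<in> I" for s N i
  proof -
    define M where "M = Suc (nat \<lceil>s\<rceil>)"
    have "s \<le> real M" unfolding M_def using real_nat_ceiling_ge[of s] by simp
    then have "solves I F {0..s} (X M)" "solves I F {0..s} (X N)"
      using that by (auto intro!: solves_subset[OF X])
    then have "X M s i = X N s i"
      using that X0 uniqueness[of s "X M" "X N" s i] by simp
    then show ?thesis by (simp add: x_def M_def)
  qed
  have "solves I F {0..} x"
    unfolding solves_def
  proof (intro ballI)
    fix t :: real and i assume t: "t \<in> {0..}" and i: "i \<in> I"
    define N where "N = Suc (nat \<lceil>t\<rceil>)"
    have N: "t < real N" unfolding N_def using real_nat_ceiling_ge[of t] by simp
    have w: "at t within {0..} = at t within {0..real N}"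
      by (rule at_within_nhd[of t "{..<real N}"]) (use N in auto)
    have "((\<lambda>s. X N s i) has_real_derivative F (X N t) i) (at t within {0..real N})"
      using X[of N] t N i unfolding solves_def by auto
    then have "((\<lambda>s. x s i) has_real_derivative F (X N t) i) (at t within {0..real N})"
      by (rule has_field_derivative_transform_within[where d = 1]) (use t N eq i in auto)
    moreover have "X N t = x t" unfolding x_def N_def by simp
    ultimately show "((\<lambda>s. x s i) has_real_derivative F (x t) i) (at t within {0..})" by (simp add: w)
  qed
  moreover have "x 0 i = x0 i" if "i \<in> I" for i using that X0 by (simp add: x_def)
  ultimately show ?thesis by blast
qed

end

section \<open>Attractors of compact semiflows\<close>

text \<open>The finite intersection property for nested families. It is applied to the images of the
  absorbing set, to preimages of a point inside them, and to their parts outside an open set; these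
  give nonemptiness, invariance and attraction.\<close>

lemma decreasing_compact_Inter_nonempty:
  fixes C :: "real \<Rightarrow> 'a::t2_space set"
  assumes comp: "\<And>t. t \<ge> 0 \<Longrightarrow> compact (C t)" and ne: "\<And>t. t \<ge> 0 \<Longrightarrow> C t \<noteq> {}"
    and dec: "\<And>s t. 0 \<le> s \<Longrightarrow> s \<le> t \<Longrightarrow> C t \<subseteq> C s"
  shows "(\<Inter>t\<in>{0..}. C t) \<noteq> {}"
proof -
  have "C 0 \<inter> \<Inter>(C ` {0..}) \<noteq> {}"
  proof (rule compact_imp_fip)
    show "compact (C 0)" using comp by simp
    show "closed T" if "T \<in> C ` {0..}" for T using that comp by (auto intro: compact_imp_closed)
    fix F' assume "finite F'" "F' \<subseteq> C ` {0..}"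
    then obtain J where J: "finite J" "J \<subseteq> {0..}" "F' = C ` J" by (meson finite_subset_image)
    define m where "m = Max (insert 0 J)"
    have m: "0 \<le> m" "\<And>j. j \<in> J \<Longrightarrow> j \<le> m" using J by (auto simp: m_def)
    have "C m \<subseteq> C j" if "j \<in> insert 0 J" for j
      using dec[of j m] J(2) m that by auto
    then have "C m \<subseteq> C 0 \<inter> \<Inter>F'" using J(3) by blast
    then show "C 0 \<inter> \<Inter>F' \<noteq> {}" using ne m(1) by blast
  qed
  then show ?thesis by auto
qed

locale compact_semiflow =
  fixes \<phi> :: "real \<Rightarrow> 'a::t2_space \<Rightarrow> 'a" and K :: "'a set"
  assumes K: "compact K" "K \<noteq> {}"
    and maps: "\<And>t. t \<ge> 0 \<Longrightarrow> \<phi> t ` K \<subseteq> K"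
    and cont: "\<And>t. t \<ge> 0 \<Longrightarrow> continuous_on K (\<phi> t)"
    and zero: "\<And>x. x \<in> K \<Longrightarrow> \<phi> 0 x = x"
    and add: "\<And>s t x. s \<ge> 0 \<Longrightarrow> t \<ge> 0 \<Longrightarrow> x \<in> K \<Longrightarrow> \<phi> (s + t) x = \<phi> s (\<phi> t x)"
begin

text \<open>The omega-limit set of \<open>K\<close>; as \<open>K\<close> is forward invariant, its
  images decrease and their intersection is already the limit.\<close>

definition attractor :: "'a set" where "attractor = (\<Inter>t\<in>{0..}. \<phi> t ` K)"

lemma image_compact: "t \<ge> 0 \<Longrightarrow> compact (\<phi> t ` K)"
  by (intro compact_continuous_image cont K)

lemma image_add: "s \<ge> 0 \<Longrightarrow> t \<ge> 0 \<Longrightarrow> \<phi> (s + t) ` K = \<phi> s ` \<phi> t ` K"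
  by (auto simp: add image_image)

lemma image_antimono:
  assumes "0 \<le> s" "s \<le> t"
  shows "\<phi> t ` K \<subseteq> \<phi> s ` K"
  using image_add[of s "t - s"] image_mono[OF maps[of "t - s"], of "\<phi> s"] assms by simp

lemma attractor_nonempty: "attractor \<noteq> {}"
  unfolding attractor_def
  by (rule decreasing_compact_Inter_nonempty) (use image_compact image_antimono K in simp_all)

lemma attractor_subset: "attractor \<subseteq> K"
proof -
  have "attractor \<subseteq> \<phi> 0 ` K" unfolding attractor_def by blast
  also have "\<phi> 0 ` K = K" using zero by simp
  finally show ?thesis .
qed

lemma attractor_compact: "compact attractor"
proof -
  have "closed attractor" unfolding attractor_def
    by (intro closed_INT ballI compact_imp_closed image_compact) auto
  then show ?thesis using K(1) attractor_subset
    by (metis compact_Int_closed inf.absorb_iff2)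
qed

text \<open>For the inclusion into the image, a preimage of \<open>y\<close> must lie in all images
  of \<open>K\<close> at once. At each time the preimages there form a nonempty compact set, and
  these sets are nested.\<close>

lemma attractor_invariant:
  assumes s: "s \<ge> 0"
  shows "\<phi> s ` attractor = attractor"
proof
  show "\<phi> s ` attractor \<subseteq> attractor"
  proof
    fix y assume "y \<in> \<phi> s ` attractor"
    then obtain x where x: "x \<in> attractor" "y = \<phi> s x" by blast
    show "y \<in> attractor" unfolding attractor_def
    proof
      fix t :: real assume t: "t \<in> {0..}"
      have "y \<in> \<phi> (s + t) ` K" using x s t image_add[of s t] by (auto simp: attractor_def)
      also have "\<dots> \<subseteq> \<phi> t ` K" using s t by (intro image_antimono) auto
      finally show "y \<in> \<phi> t ` K" .
    qed
  qed
  show "attractor \<subseteq> \<phi> s ` attractor"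
  proof
    fix y assume y: "y \<in> attractor"
    define C where "C t = {x \<in> \<phi> t ` K. \<phi> s x = y}" for t
    have "(\<Inter>t\<in>{0..}. C t) \<noteq> {}"
    proof (rule decreasing_compact_Inter_nonempty)
      fix t :: real assume t: "t \<ge> 0"
      have "continuous_on (\<phi> t ` K) (\<phi> s)"
        using cont[OF s] maps[OF t] by (rule continuous_on_subset)
      then have "closed (\<phi> t ` K \<inter> \<phi> s -` {y})"
        using t by (intro continuous_closed_preimage compact_imp_closed image_compact) auto
      then have "compact (\<phi> t ` K \<inter> (\<phi> t ` K \<inter> \<phi> s -` {y}))"
        using image_compact[OF t] by (rule compact_Int_closed[rotated])
      moreover have "C t = \<phi> t ` K \<inter> (\<phi> t ` K \<inter> \<phi> s -` {y})" by (auto simp: C_def)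
      ultimately show "compact (C t)" by simp
      have "y \<in> \<phi> s ` \<phi> t ` K" 
        using y s t unfolding attractor_def image_add[OF s t, symmetric] by (meson INT_E add_nonneg_nonneg atLeast_iff)
      then show "C t \<noteq> {}" by (auto simp: C_def)
    next
      fix t u :: real assume "0 \<le> t" "t \<le> u"
      then show "C u \<subseteq> C t" using image_antimono[of t u] unfolding C_def by blast
    qed
    then obtain x where "\<And>t. t \<ge> 0 \<Longrightarrow> x \<in> C t" by auto
    then have "x \<in> attractor" "\<phi> s x = y" by (auto simp: C_def attractor_def)
    then show "y \<in> \<phi> s ` attractor" by blast
  qed
qed

text \<open>If the images never entered \<open>U\<close>, their nested compact remainders outside
  \<open>U\<close> would have a common point, which would belong to the attractor. Open sets in
  place of distances keep the argument purely topological.\<close>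

lemma attractor_attracts:
  assumes U: "open U" "attractor \<subseteq> U"
  shows "\<exists>T\<ge>0. \<forall>t\<ge>T. \<phi> t ` K \<subseteq> U"
proof (rule ccontr)
  assume "\<not> ?thesis"
  then have no: "\<not> \<phi> t ` K \<subseteq> U" if "t \<ge> 0" for t
    using that image_antimono by (meson order_trans)
  have "(\<Inter>t\<in>{0..}. \<phi> t ` K - U) \<noteq> {}"
  proof (rule decreasing_compact_Inter_nonempty)
    show "\<phi> t ` K - U \<subseteq> \<phi> s ` K - U" if "0 \<le> s" "s \<le> t" for s t
      using image_antimono[OF that] by blast
  qed (use no U in \<open>auto intro!: compact_diff image_compact\<close>)
  then show False using U by (auto simp: attractor_def)
qed

end

section \<open>Integration and differentiation of trigonometric products\<close>

text \<open>By \<open>lborel_eq\<close>, Lebesgue measure on \<open>real^'n\<close> is an image of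
  the product measure over \<open>Basis\<close>. Once the indicator of the box is split into its
  factors, the integral of a product of one-variable functions factorises.\<close>

lemma integral_cbox_prod:
  fixes g :: "'n::finite \<Rightarrow> real \<Rightarrow> real" and a b :: "real^'n"
  assumes cont: "\<And>i. continuous_on UNIV (g i)"
  shows "integral (cbox a b) (\<lambda>x. \<Prod>i\<in>UNIV. g i (x $ i)) = (\<Prod>i\<in>UNIV. integral {a$i..b$i} (g i))"
proof -
  define h where "h i y = indicator {a$i..b$i} y * g i y" for i y
  have inth: "integrable lborel (h i)" for i
    using borel_integrable_atLeastAtMost'[OF continuous_on_subset[OF cont[of i]], of "a$i" "b$i"]
    by (simp add: set_integrable_def h_def[abs_def])
  have mh[measurable]: "h i \<in> borel_measurable borel" for i
    using inth by (auto dest: borel_measurable_integrable)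
  have 1: "integral\<^sup>L lborel (h i) = integral {a$i..b$i} (g i)" for i
    using set_borel_integral_eq_integral(2)[OF borel_integrable_atLeastAtMost'[OF continuous_on_subset[OF cont[of i]], of "a$i" "b$i"]]
    by (simp add: set_lebesgue_integral_def h_def[abs_def])
  have contp: "continuous_on (cbox a b) (\<lambda>x. \<Prod>i\<in>UNIV. g i (x $ i))"
    by (intro continuous_on_prod continuous_on_compose2[OF cont] continuous_intros) auto
  have "set_integrable lborel (cbox a b) (\<lambda>x. \<Prod>i\<in>UNIV. g i (x $ i))"
    unfolding set_integrable_def using borel_integrable_compact[OF compact_cbox contp]
    by (simp add: indicator_def if_distrib[of "\<lambda>c. c * _"] cong: if_cong)
  then have "integral (cbox a b) (\<lambda>x. \<Prod>i\<in>UNIV. g i (x $ i)) =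
      (LINT x|lborel. indicator (cbox a b) x * (\<Prod>i\<in>UNIV. g i (x $ i)))"
    using set_borel_integral_eq_integral(2) by (force simp: set_lebesgue_integral_def)
  also have "\<dots> = (LINT x|lborel. (\<Prod>i\<in>UNIV. h i ((x::real^'n) $ i)))"
  proof (rule Bochner_Integration.integral_cong)
    fix x :: "real^'n"
    have "indicator (cbox a b) x = (\<Prod>i\<in>UNIV. indicator {a$i..b$i} (x$i) :: real)"
      by (auto simp: indicator_def mem_box_cart prod_eq_1_iff intro!: prod.neutral)
    then show "indicator (cbox a b) x * (\<Prod>i\<in>UNIV. g i (x $ i)) = (\<Prod>i\<in>UNIV. h i (x $ i))"
      by (simp add: h_def prod.distrib)
  qed simp
  also have "\<dots> = (LINT f|Pi\<^sub>M Basis (\<lambda>_. lborel). (\<Prod>i\<in>UNIV. h i ((\<Sum>b\<in>Basis. f b *\<^sub>R b) $ i :: real)))"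
    unfolding lborel_eq[where 'a="real^'n"]
  proof (rule integral_distr)
    show "(\<lambda>x. \<Prod>i\<in>UNIV. h i ((x::real^'n) $ i)) \<in> borel_measurable borel"
      by (intro borel_measurable_prod measurable_compose[OF _ mh] borel_measurable_continuous_onI continuous_intros)
  qed measurable
  also have "\<dots> = (LINT f|Pi\<^sub>M Basis (\<lambda>_. lborel). (\<Prod>b\<in>(Basis::(real^'n) set). h (axis_index b) (f b)))"
  proof (rule Bochner_Integration.integral_cong)
    fix f :: "real^'n \<Rightarrow> real"
    have B: "Basis = range (\<lambda>i::'n. axis i (1::real))" by (auto simp: Basis_vec_def)
    have inj: "inj (\<lambda>i::'n. axis i (1::real))" by (auto simp: inj_on_def axis_eq_axis)
    have "(\<Sum>b\<in>Basis. f b *\<^sub>R b) $ i = f (axis i 1)" for i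
      unfolding B by (subst sum.reindex[OF inj]) (simp add: axis_def if_distrib[of "\<lambda>c. _ * c"] cong: if_cong)
    moreover have "(\<Prod>b\<in>(Basis::(real^'n) set). h (axis_index b) (f b)) = (\<Prod>i\<in>UNIV. h i (f (axis i 1)))"
      unfolding B by (subst prod.reindex[OF inj]) (simp add: axis_index_axis)
    ultimately show "(\<Prod>i\<in>UNIV. h i ((\<Sum>b\<in>Basis. f b *\<^sub>R b) $ i)) = (\<Prod>b\<in>(Basis::(real^'n) set). h (axis_index b) (f b))"
      by simp
  qed simp
  also have "\<dots> = (\<Prod>b\<in>(Basis::(real^'n) set). integral\<^sup>L lborel (h (axis_index b)))"
  proof -
    interpret product_sigma_finite "\<lambda>_::real^'n. lborel :: real measure" ..
    show ?thesis by (rule product_integral_prod) (auto intro: inth)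
  qed
  also have "\<dots> = (\<Prod>i\<in>UNIV. integral\<^sup>L lborel (h i))"
  proof -
    have B: "Basis = range (\<lambda>i::'n. axis i (1::real))" by (auto simp: Basis_vec_def)
    have inj: "inj (\<lambda>i::'n. axis i (1::real))" by (auto simp: inj_on_def axis_eq_axis)
    show ?thesis unfolding B by (subst prod.reindex[OF inj]) (simp add: axis_index_axis)
  qed
  finally show ?thesis by (simp add: 1)
qed

section \<open>Products of sines and cosines on one interval\<close>

lemma trig_has_derivative:
  "((\<lambda>y. trig m p (c * y)) has_real_derivative c * real m * (-1) ^ Suc p * trig m (Suc p) (c * y)) (at y)"
  by (cases "even p") (auto simp: trig_def intro!: derivative_eq_intros)

lemma continuous_on_trig [continuous_intros]:
  fixes f :: "'a::t2_space \<Rightarrow> real"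
  shows "continuous_on S f \<Longrightarrow> continuous_on S (\<lambda>x. trig m p (f x))"
  by (cases "even p") (simp_all add: trig_def continuous_on_cos continuous_on_sin continuous_on_mult_left)

lemma trig_parity: "even p = even q \<Longrightarrow> trig m p = trig m q"
  by (auto simp: trig_def)

text \<open>Half periods suffice for cosines: \<open>N = 1\<close> serves the vertical direction and
  \<open>N = 2\<close> the horizontal ones.\<close>

lemma integral_cos_multiple:
  fixes j :: int
  assumes "c > 0" "c * L = pi * real N" "N > 0"
  shows "((\<lambda>y. cos (of_int j * (c * y))) has_integral (if j = 0 then L else 0)) {0..L}"
proof -
  have "c * L \<ge> 0" using assms(2) by simp
  then have L: "L \<ge> 0" using assms(1) by (simp add: zero_le_mult_iff)
  show ?thesis
  proof (cases "j = 0")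
    case True
    then show ?thesis using has_integral_const_real[of "1::real" 0 L] L by simp
  next
    case False
    have "((\<lambda>y. cos (of_int j * (c * y))) has_integral
       (sin (of_int j * (c * L)) / (of_int j * c) - sin (of_int j * (c * 0)) / (of_int j * c))) {0..L}"
      using L False assms(1) by (intro fundamental_theorem_of_calculus)
        (auto intro!: derivative_eq_intros simp: has_real_derivative_iff_has_vector_derivative[symmetric])
    moreover have "sin (of_int j * (c * L)) = 0"
      using sin_integer_2pi sin_zero_iff_int2 assms(2)
      by (metis mult.commute mult.left_commute of_int_mult of_int_of_nat_eq)
    ultimately show ?thesis using False by simp
  qed
qed

text \<open>Sines of odd frequency do not integrate to zero over half a period, hence the full
  period here and the restriction to horizontal directions.\<close>

lemma integral_sin_multiple:
  fixes j :: int
  assumes "c > 0" "c * L = 2 * pi"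
  shows "((\<lambda>y. sin (of_int j * (c * y))) has_integral 0) {0..L}"
proof (cases "j = 0")
  case False
  have "c * L \<ge> 0" using assms(2) by simp
  then have L: "L \<ge> 0" using assms(1) by (simp add: zero_le_mult_iff)
  have "((\<lambda>y. sin (of_int j * (c * y))) has_integral
     (- cos (of_int j * (c * L)) / (of_int j * c) - - cos (of_int j * (c * 0)) / (of_int j * c))) {0..L}"
    using L False assms(1) by (intro fundamental_theorem_of_calculus)
      (auto intro!: derivative_eq_intros simp: has_real_derivative_iff_has_vector_derivative[symmetric])
  moreover have "cos (of_int j * (c * L)) = 1"
    unfolding assms using cos_integer_2pi[of "of_int j"] by (simp add: mult_ac)
  ultimately show ?thesis by simp
qed simp

lemma trig_mult_same_phase:
  assumes "even p = even q"
  shows "trig m p x * trig n q x =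
     1/2 * (cos (of_int (int m - int n) * x) + (-1) ^ p * cos (of_int (int m + int n) * x))"
proof -
  have "of_int (int m - int n) * x = real m * x - real n * x" "of_int (int m + int n) * x = real m * x + real n * x"
    by (simp_all add: algebra_simps)
  with assms show ?thesis
    by (cases "even p") (simp_all only: trig_def cos_diff cos_add, simp_all)
qed

lemma trig_mult_opposite_phase:
  assumes "even p \<noteq> even q"
  shows "trig m p x * trig n q x =
     1/2 * (sin (of_int (int m + int n) * x) - (-1) ^ p * sin (of_int (int m - int n) * x))"
proof -
  have "of_int (int m - int n) * x = real m * x - real n * x" "of_int (int m + int n) * x = real m * x + real n * x"
    by (simp_all add: algebra_simps)
  with assms show ?thesis
    by (cases "even p") (simp_all only: trig_def sin_diff sin_add, simp_all)
qed

text \<open>The second indicator corrects frequency zero, where the square of the cosine has mean 1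
  in place of 1/2 and the sine vanishes.\<close>

lemma integral_trig_mult:
  assumes "c > 0" "c * L = pi * real N" "N > 0" "even p = even q"
  shows "integral {0..L} (\<lambda>y. trig m p (c * y) * trig n q (c * y)) =
     L / 2 * (of_bool (m = n) + (-1) ^ p * of_bool (m = 0 \<and> n = 0))"
proof -
  have "((\<lambda>y. trig m p (c * y) * trig n q (c * y)) has_integral
     (1/2 * ((if int m - int n = 0 then L else 0) + (-1) ^ p * (if int m + int n = 0 then L else 0)))) {0..L}"
    unfolding trig_mult_same_phase[OF assms(4)]
    by (intro has_integral_mult_right has_integral_add integral_cos_multiple[OF assms(1-3)])
  then show ?thesis by (simp add: integral_unique algebra_simps of_bool_def)
qed

lemma integral_trig_mult_opposite:
  assumes "c > 0" "c * L = 2 * pi" "even p \<noteq> even q"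
  shows "integral {0..L} (\<lambda>y. trig m p (c * y) * trig n q (c * y)) = 0"
proof -
  have "((\<lambda>y. trig m p (c * y) * trig n q (c * y)) has_integral (1/2 * (0 - (-1) ^ p * 0))) {0..L}"
    unfolding trig_mult_opposite_phase[OF assms(3)]
    by (intro has_integral_mult_right has_integral_diff integral_sin_multiple[OF assms(1,2)])
  then show ?thesis by (simp add: integral_unique)
qed

section \<open>Integrals over the box and separable functions\<close>

lemma integrable_on_Omega: "continuous_on UNIV (f :: real^3 \<Rightarrow> real) \<Longrightarrow> f integrable_on Omega k"
  unfolding Omega_def by (rule integrable_continuous) (rule continuous_on_subset, auto)

lemma avg_add:
  assumes "continuous_on UNIV f" "continuous_on UNIV g"
  shows "avg k (\<lambda>x. f x + g x) = avg k f + avg k g"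
  unfolding avg_def using assms
  by (intro Henstock_Kurzweil_Integration.integral_add integrable_on_Omega)

lemma avg_cmult: "avg k (\<lambda>x. c * f x) = c * avg k f"
  unfolding avg_def by simp

lemma avg_sum:
  assumes "\<And>a. a \<in> A \<Longrightarrow> continuous_on UNIV (f a)"
  shows "avg k (\<lambda>x. \<Sum>a\<in>A. f a x) = (\<Sum>a\<in>A. avg k (f a))"
  using assms
proof (induction A rule: infinite_finite_induct)
  case (insert a A)
  then have "avg k (\<lambda>x. f a x + (\<Sum>a\<in>A. f a x)) = avg k (f a) + (\<Sum>a\<in>A. avg k (f a))"
    by (subst avg_add) (auto intro!: continuous_on_sum)
  with insert show ?case by simp
qed (simp_all add: avg_def)

lemma avg_nonneg: "continuous_on UNIV f \<Longrightarrow> (\<And>x. f x \<ge> 0) \<Longrightarrow> avg k f \<ge> 0"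
  unfolding avg_def
  by (intro Henstock_Kurzweil_Integration.integral_nonneg integrable_on_Omega)

lemma prod_3: "prod f (UNIV::3 set) = f 1 * f 2 * f 3"
  unfolding UNIV_3 by (simp add: mult.assoc)

definition side :: "real^3 \<Rightarrow> 3 \<Rightarrow> real" where
  "side k j = (if j = 3 then pi else 2 * pi) / k$j"

lemma Omega_side: "Omega k = cbox 0 (\<chi> j. side k j)"
  unfolding Omega_def by (rule arg_cong[of _ _ "cbox 0"]) (simp add: vec_eq_iff forall_3 side_def)

lemma avg_prod:
  assumes "\<And>i. continuous_on UNIV (g i)"
  shows "avg k (\<lambda>x. \<Prod>i\<in>UNIV. g i (x$i)) = (\<Prod>i\<in>UNIV. integral {0..side k i} (g i))"
  unfolding avg_def Omega_side by (subst integral_cbox_prod[OF assms]) simp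

text \<open>No periodicity is imposed in direction 3: there the boundary terms of an integration by
  parts vanish because the vertical velocity is a sine.\<close>

definition periodic_C1 :: "real^3 \<Rightarrow> 3 \<Rightarrow> (real \<Rightarrow> real) \<Rightarrow> bool" where
  "periodic_C1 k j a \<longleftrightarrow>
     (\<exists>a'. (\<forall>y. (a has_real_derivative a' y) (at y)) \<and> continuous_on UNIV a') \<and> (j \<noteq> 3 \<longrightarrow> a (side k j) = a 0)"

lemma periodic_C1_mult:
  assumes "periodic_C1 k j a" "periodic_C1 k j b"
  shows "periodic_C1 k j (\<lambda>y. a y * b y)"
proof -
  obtain a' b' where d: "\<And>y. (a has_real_derivative a' y) (at y)" "\<And>y. (b has_real_derivative b' y) (at y)"
    and c: "continuous_on UNIV a'" "continuous_on UNIV b'"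
    using assms unfolding periodic_C1_def by blast
  have "continuous_on UNIV a" "continuous_on UNIV b"
    using d by (auto intro!: continuous_at_imp_continuous_on DERIV_isCont)
  then have "continuous_on UNIV (\<lambda>y. a' y * b y + b' y * a y)"
    using c by (intro continuous_intros)
  with DERIV_mult[OF d(1) d(2)] assms show ?thesis
    unfolding periodic_C1_def by (intro conjI exI[of _ "\<lambda>y. a' y * b y + b' y * a y"]) auto
qed

lemma periodic_C1_const: "periodic_C1 k j (\<lambda>y. c)"
  unfolding periodic_C1_def by (auto intro!: exI[of _ "\<lambda>_. 0"])

text \<open>Finite sums of products \<open>a\<^sub>1(x\<^sub>1) a\<^sub>2(x\<^sub>2) a\<^sub>3(x\<^sub>3)\<close>, for which integration over the box
  and integration by parts reduce to one variable.\<close>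

inductive sep_sum :: "real^3 \<Rightarrow> (real^3 \<Rightarrow> real) \<Rightarrow> bool" for k where
  sep: "(\<And>j. periodic_C1 k j (a j)) \<Longrightarrow> sep_sum k (\<lambda>x. \<Prod>j\<in>UNIV. a j (x$j))"
| add: "sep_sum k q \<Longrightarrow> sep_sum k r \<Longrightarrow> sep_sum k (\<lambda>x. q x + r x)"

lemma sep_sum_mult_sep:
  assumes "\<And>j. periodic_C1 k j (a j)" "sep_sum k r"
  shows "sep_sum k (\<lambda>x. (\<Prod>j\<in>UNIV. a j (x$j)) * r x)"
  using assms(2)
proof induction
  case (sep b)
  have "sep_sum k (\<lambda>x. \<Prod>j\<in>UNIV. (\<lambda>y. a j y * b j y) (x$j))"
    by (rule sep_sum.sep) (intro periodic_C1_mult assms sep)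
  then show ?case by (simp add: prod.distrib)
next
  case (add q r)
  then show ?case by (simp add: distrib_left sep_sum.add)
qed

lemma sep_sum_mult: "sep_sum k q \<Longrightarrow> sep_sum k r \<Longrightarrow> sep_sum k (\<lambda>x. q x * r x)"
  by (induction rule: sep_sum.induct) (auto simp: distrib_right intro: sep_sum_mult_sep sep_sum.add)

lemma sep_sum_const: "sep_sum k (\<lambda>x. c)"
proof -
  have "sep_sum k (\<lambda>x. \<Prod>j\<in>UNIV. (\<lambda>y. if j = 1 then c else 1) (x$j))"
    by (rule sep_sum.sep) (rule periodic_C1_const)
  then show ?thesis by simp
qed

lemma sep_sum_cmult: "sep_sum k q \<Longrightarrow> sep_sum k (\<lambda>x. c * q x)"
  by (rule sep_sum_mult[OF sep_sum_const])

lemma sep_sum_sum: "(\<And>a. a \<in> A \<Longrightarrow> sep_sum k (f a)) \<Longrightarrow> sep_sum k (\<lambda>x. \<Sum>a\<in>A. f a x)"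
  by (induction A rule: infinite_finite_induct) (auto intro: sep_sum_const sep_sum.add)

lemma sep_has_partial:
  fixes x :: "real^3"
  assumes "(a i has_real_derivative d) (at (x $ i))"
  shows "((\<lambda>h. \<Prod>j\<in>UNIV. a j ((x + h *\<^sub>R axis i 1) $ j)) has_real_derivative
           d * (\<Prod>j\<in>UNIV - {i}. a j (x$j))) (at 0)"
proof -
  have "(\<lambda>h. \<Prod>j\<in>UNIV. a j ((x + h *\<^sub>R axis i 1) $ j)) = (\<lambda>h. a i (x$i + h) * (\<Prod>j\<in>UNIV - {i}. a j (x$j)))"
    by (subst prod.remove[of UNIV i]) (auto simp: axis_def intro!: ext prod.cong)
  moreover have "((\<lambda>h. a i (x$i + h)) has_real_derivative d) (at 0)"
    using assms DERIV_shift[of "a i" d 0 "x$i"] by (simp add: add.commute)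
  ultimately show ?thesis by (auto intro!: derivative_eq_intros)
qed

lemma sep_sum_C1:
  assumes "sep_sum k q"
  shows "continuous_on UNIV q \<and> (\<exists>D. (\<forall>x. ((\<lambda>h. q (x + h *\<^sub>R axis i 1)) has_real_derivative D x) (at 0)) \<and> continuous_on UNIV D)"
  using assms
proof induction
  case (sep a)
  then obtain a' where d: "\<And>j y. (a j has_real_derivative a' j y) (at y)" and c: "\<And>j. continuous_on UNIV (a' j)"
    unfolding periodic_C1_def by metis
  have ca: "continuous_on UNIV (a j)" for j
    using d by (auto intro!: continuous_at_imp_continuous_on DERIV_isCont)
  have 1: "continuous_on UNIV (\<lambda>x::real^3. a j (x$j))" "continuous_on UNIV (\<lambda>x::real^3. a' j (x$j))" for j
    by (rule continuous_on_compose2[OF ca] continuous_on_compose2[OF c]; auto intro: continuous_intros)+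
  show ?case
    by (intro conjI exI[of _ "\<lambda>x. a' i (x$i) * (\<Prod>j\<in>UNIV - {i}. a j (x$j))"] allI sep_has_partial d continuous_intros 1)
next
  case (add q r)
  then obtain D E where "\<And>x. ((\<lambda>h. q (x + h *\<^sub>R axis i 1)) has_real_derivative D x) (at 0)"
    "\<And>x. ((\<lambda>h. r (x + h *\<^sub>R axis i 1)) has_real_derivative E x) (at 0)"
    "continuous_on UNIV D" "continuous_on UNIV E" by blast
  with add.IH show ?case
    by (intro conjI exI[of _ "\<lambda>x. D x + E x"] allI DERIV_add continuous_on_add) auto
qed

lemma sep_sum_continuous: "sep_sum k q \<Longrightarrow> continuous_on UNIV q"
  using sep_sum_C1 by blast

lemma sep_sum_has_pd:
  assumes "sep_sum k q"
  shows "((\<lambda>h. q (x + h *\<^sub>R axis i 1)) has_real_derivative pd i q x) (at 0)"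
proof -
  obtain d where "((\<lambda>h. q (x + h *\<^sub>R axis i 1)) has_real_derivative d) (at 0)"
    using sep_sum_C1[OF assms, of i] by blast
  then show ?thesis unfolding pd_def by (simp add: DERIV_imp_deriv)
qed

lemma sep_sum_pd_continuous:
  assumes "sep_sum k q"
  shows "continuous_on UNIV (pd i q)"
proof -
  obtain D where "\<And>x. ((\<lambda>h. q (x + h *\<^sub>R axis i 1)) has_real_derivative D x) (at 0)" "continuous_on UNIV D"
    using sep_sum_C1[OF assms, of i] by blast
  moreover from this have "pd i q = D" unfolding pd_def by (auto intro: DERIV_imp_deriv)
  ultimately show ?thesis by simp
qed

lemma pd_add: "sep_sum k q \<Longrightarrow> sep_sum k r \<Longrightarrow> pd i (\<lambda>x. q x + r x) x = pd i q x + pd i r x"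
  unfolding pd_def[of i "\<lambda>x. q x + r x"]
  by (intro DERIV_imp_deriv DERIV_add sep_sum_has_pd)

lemma pd_mult: "sep_sum k q \<Longrightarrow> sep_sum k r \<Longrightarrow> pd i (\<lambda>x. q x * r x) x = pd i q x * r x + pd i r x * q x"
  unfolding pd_def[of i "\<lambda>x. q x * r x"]
  using DERIV_mult[OF sep_sum_has_pd[of k q x i] sep_sum_has_pd[of k r x i]]
  by (intro DERIV_imp_deriv) simp

lemma pd_const: "pd i (\<lambda>x. c) x = 0"
  unfolding pd_def by simp

lemma pd_cmult: "sep_sum k q \<Longrightarrow> pd i (\<lambda>x. c * q x) x = c * pd i q x"
  using pd_mult[OF sep_sum_const, of k q i c x] by (simp add: pd_const)

lemma pd_sum: "(\<And>a. a \<in> A \<Longrightarrow> sep_sum k (f a)) \<Longrightarrow> pd i (\<lambda>x. \<Sum>a\<in>A. f a x) x = (\<Sum>a\<in>A. pd i (f a) x)"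
proof (induction A rule: infinite_finite_induct)
  case (insert a A)
  then have "pd i (\<lambda>x. f a x + (\<Sum>a\<in>A. f a x)) x = pd i (f a) x + pd i (\<lambda>x. \<Sum>a\<in>A. f a x) x"
    by (intro pd_add[of k] sep_sum_sum) auto
  with insert show ?case by simp
qed (simp_all add: pd_const)

definition trig_prod :: "real^3 \<Rightarrow> nat^3 \<Rightarrow> (3 \<Rightarrow> nat) \<Rightarrow> real^3 \<Rightarrow> real" where
  "trig_prod k m q x = (\<Prod>j\<in>UNIV. trig (m$j) (q j) (k$j * x$j))"

lemma trig_prod_parity: "(\<And>j. even (q j) = even (q' j)) \<Longrightarrow> trig_prod k m q = trig_prod k m q'"
  unfolding trig_prod_def by (intro ext prod.cong refl) (simp add: trig_parity[of "q _" "q' _"])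

lemma pd_trig_prod:
  "pd i (trig_prod k m q) x = k$i * real (m$i) * (-1) ^ Suc (q i) * trig_prod k m (q(i := Suc (q i))) x"
proof -
  have "pd i (trig_prod k m q) x =
      k$i * real (m$i) * (-1) ^ Suc (q i) * trig (m$i) (Suc (q i)) (k$i * x$i) * (\<Prod>j\<in>UNIV - {i}. trig (m$j) (q j) (k$j * x$j))"
    unfolding pd_def trig_prod_def
    using sep_has_partial[of "\<lambda>j y. trig (m$j) (q j) (k$j * y)", OF trig_has_derivative]
    by (intro DERIV_imp_deriv) simp
  also have "\<dots> = k$i * real (m$i) * (-1) ^ Suc (q i) * trig_prod k m (q(i := Suc (q i))) x"
    unfolding trig_prod_def by (subst prod.remove[of UNIV i]) (auto intro!: prod.cong)
  finally show ?thesis .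
qed

section \<open>Trigonometric products on the normalised box\<close>

locale wavenumbers =
  fixes k :: "real^3"
  assumes k1: "k$1 > 0" and k2: "k$2 > 0" and k3: "k$3 = inverse (k$1 * k$2)"
begin

lemma k_pos: "k$j > 0"
  using k1 k2 k3 exhaust_3[of j] by auto

lemma k_nz [simp]: "k$j \<noteq> 0"
  using k_pos[of j] by simp

lemma side_pos: "side k j > 0"
  using k_pos by (simp add: side_def)

lemma k_side: "k$j * side k j = (if j = 3 then pi else 2 * pi)"
  by (simp add: side_def)

text \<open>The relation between \<open>k$3\<close> and the horizontal wave numbers fixes the volume
  of the box at \<open>V\<^sup>2\<close>, whatever its aspect ratio; this is why \<open>V\<close>
  normalises the modes.\<close>

lemma prod_side: "(\<Prod>j\<in>UNIV. side k j) = 4 * pi ^ 3"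
proof -
  have "(\<Prod>j\<in>UNIV. side k j) = (2 * pi / k$1) * (2 * pi / k$2) * (pi / k$3)"
    by (simp add: prod_3 side_def)
  also have "\<dots> = 4 * pi ^ 3 / (k$1 * k$2 * k$3)"
    by (simp add: power3_eq_cube)
  also have "k$1 * k$2 * k$3 = 1" using k1 k2 unfolding k3 by (intro right_inverse) simp
  finally show ?thesis by simp
qed

lemma periodic_C1_trig: "periodic_C1 k j (\<lambda>y. trig m p (k$j * y))"
  unfolding periodic_C1_def
proof (intro conjI impI)
  show "\<exists>a'. (\<forall>y. ((\<lambda>y. trig m p (k $ j * y)) has_real_derivative a' y) (at y)) \<and> continuous_on UNIV a'"
    using trig_has_derivative[of m p "k$j"]
    by (intro exI[of _ "\<lambda>y. k$j * real m * (-1) ^ Suc p * trig m (Suc p) (k$j * y)"] conjI allI continuous_intros)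
  assume "j \<noteq> 3"
  then have s: "k$j * side k j = 2 * pi" by (simp add: k_side)
  show "trig m p (k $ j * side k j) = trig m p (k $ j * 0)"
    unfolding s using cos_integer_2pi[of "real m"] sin_integer_2pi[of "real m"]
    by (simp add: trig_def mult.commute[of "real m" "2 * pi"])
qed

lemma sep_sum_trig_prod: "sep_sum k (trig_prod k m q)"
  unfolding trig_prod_def[abs_def]
  by (rule sep_sum.sep[of k "\<lambda>j y. trig (m$j) (q j) (k$j * y)"]) (rule periodic_C1_trig)

text \<open>Vertical phases must agree, since sine and cosine are not orthogonal on half a period;
  horizontally a full period takes care of opposite phases.\<close>

lemma avg_trig_prod_mult:
  assumes "even (q 3) = even (q' 3)"
  shows "avg k (\<lambda>x. trig_prod k m q x * trig_prod k m' q' x) = 4 * pi ^ 3 *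
     (\<Prod>j\<in>UNIV. of_bool (even (q j) = even (q' j)) *
        (of_bool (m$j = m'$j) + (-1) ^ q j * of_bool (m$j = 0 \<and> m'$j = 0)) / 2)"
proof -
  have "avg k (\<lambda>x. trig_prod k m q x * trig_prod k m' q' x) =
     avg k (\<lambda>x. \<Prod>j\<in>UNIV. (\<lambda>y. trig (m$j) (q j) (k$j * y) * trig (m'$j) (q' j) (k$j * y)) (x$j))"
    by (simp add: trig_prod_def prod.distrib)
  also have "\<dots> = (\<Prod>j\<in>UNIV. integral {0..side k j} (\<lambda>y. trig (m$j) (q j) (k$j * y) * trig (m'$j) (q' j) (k$j * y)))"
    by (rule avg_prod) (intro continuous_intros)
  also have "\<dots> = (\<Prod>j\<in>UNIV. side k j * (of_bool (even (q j) = even (q' j)) *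
        (of_bool (m$j = m'$j) + (-1) ^ q j * of_bool (m$j = 0 \<and> m'$j = 0)) / 2))"
  proof (rule prod.cong)
    fix j :: 3
    show "integral {0..side k j} (\<lambda>y. trig (m$j) (q j) (k$j * y) * trig (m'$j) (q' j) (k$j * y)) =
       side k j * (of_bool (even (q j) = even (q' j)) *
        (of_bool (m$j = m'$j) + (-1) ^ q j * of_bool (m$j = 0 \<and> m'$j = 0)) / 2)"
    proof (cases "even (q j) = even (q' j)")
      case True
      have "k$j * side k j = pi * real (if j = 3 then 1 else 2)" by (simp add: k_side)
      from integral_trig_mult[OF k_pos this _ True] True show ?thesis by simp
    next
      case False
      then have "j \<noteq> 3" using assms by auto
      then have "k$j * side k j = 2 * pi" by (simp add: k_side)
      from integral_trig_mult_opposite[OF k_pos this False] False show ?thesis by simp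
    qed
  qed simp
  also have "\<dots> = 4 * pi ^ 3 * (\<Prod>j\<in>UNIV. of_bool (even (q j) = even (q' j)) *
        (of_bool (m$j = m'$j) + (-1) ^ q j * of_bool (m$j = 0 \<and> m'$j = 0)) / 2)"
    by (simp only: prod.distrib prod_side)
  finally show ?thesis .
qed

text \<open>Integration by parts moves the derivative of a separable function onto the trigonometric
  factor and leaves the same product of the \<open>T j\<close> in all three terms, multiplied by the
  Fourier symbol of the divergence. Boundary terms cancel horizontally by periodicity and vertically
  because \<open>p 3\<close> is even, which makes the third component a sine in height.\<close>

lemma avg_div_free:
  fixes m :: "nat^3" and p :: "3 \<Rightarrow> nat" and c :: "3 \<Rightarrow> real"
  assumes q: "sep_sum k q" and p3: "even (p 3)"
    and div: "(\<Sum>i\<in>UNIV. c i * (-1) ^ p i * (k$i * real (m$i))) = 0"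
  shows "avg k (\<lambda>x. \<Sum>i\<in>UNIV. c i * trig_prod k m (\<lambda>j. p j + kdelta i j) x * pd i q x) = 0"
  using q
proof induction
  case (sep a)
  then obtain a' where d: "\<And>j y. (a j has_real_derivative a' j y) (at y)" and c: "\<And>j. continuous_on UNIV (a' j)"
    and per: "\<And>j. j \<noteq> 3 \<Longrightarrow> a j (side k j) = a j 0"
    unfolding periodic_C1_def by metis
  have ca: "continuous_on UNIV (a j)" for j
    using d by (auto intro!: continuous_at_imp_continuous_on DERIV_isCont)
  have pd: "pd i (\<lambda>x. \<Prod>j\<in>UNIV. a j (x$j)) x = a' i (x$i) * (\<Prod>j\<in>UNIV - {i}. a j (x$j))" for i x
    unfolding pd_def by (intro DERIV_imp_deriv sep_has_partial d)
  define g where "g i j y = trig (m$j) (p j + kdelta i j) (k$j * y) * (if j = i then a' j y else a j y)" for i j y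
  define T where "T j = integral {0..side k j} (\<lambda>y. trig (m$j) (p j) (k$j * y) * a j y)" for j
  have cg: "continuous_on UNIV (g i j)" for i j
    unfolding g_def by (cases "j = i") (auto intro!: continuous_intros c ca)
  have eq: "c i * trig_prod k m (\<lambda>j. p j + kdelta i j) x * pd i (\<lambda>x. \<Prod>j\<in>UNIV. a j (x$j)) x = c i * (\<Prod>j\<in>UNIV. g i j (x$j))" for i x
  proof -
    have "a' i (x$i) * (\<Prod>j\<in>UNIV - {i}. a j (x$j)) = (\<Prod>j\<in>UNIV. if j = i then a' j (x$j) else a j (x$j))"
      by (subst prod.remove[of UNIV i]) (auto intro!: prod.cong)
    then show ?thesis by (simp add: pd g_def trig_prod_def prod.distrib)
  qed
  have gi: "integral {0..side k i} (g i i) = - ((-1) ^ p i * (k$i * real (m$i)) * T i)" for i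
  proof -
    let ?t = "\<lambda>y. trig (m$i) (Suc (p i)) (k$i * y)"
    let ?t' = "\<lambda>y. k$i * real (m$i) * (-1) ^ p i * trig (m$i) (p i) (k$i * y)"
    have t': "(?t has_real_derivative ?t' y) (at y)" for y
      using trig_has_derivative[of "m$i" "Suc (p i)" "k$i" y] trig_parity[of "Suc (Suc (p i))" "p i"] by simp
    have tt: "((\<lambda>y. ?t y * a i y) has_real_derivative ?t y * a' i y + ?t' y * a i y) (at y within S)" for y S
      using DERIV_subset[OF DERIV_mult[OF t'[of y] d[of i y]], of S] by (simp add: algebra_simps)
    have "((\<lambda>y. ?t y * a' i y + ?t' y * a i y) has_integral (?t (side k i) * a i (side k i) - ?t 0 * a i 0)) {0..side k i}"
      using side_pos[of i]
      by (intro fundamental_theorem_of_calculus)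
        (use tt in \<open>auto simp: has_real_derivative_iff_has_vector_derivative[symmetric]\<close>)
    moreover have "?t (side k i) * a i (side k i) - ?t 0 * a i 0 = 0"
    proof (cases "i = 3")
      case True
      then show ?thesis using p3 by (simp add: trig_def k_side)
    next
      case False
      have "?t (side k i) = ?t 0"
        using periodic_C1_trig[of i "m$i" "Suc (p i)"] False unfolding periodic_C1_def by blast
      then show ?thesis using per[OF False] by simp
    qed
    ultimately have I: "integral {0..side k i} (\<lambda>y. ?t y * a' i y + ?t' y * a i y) = 0"
      by (simp add: integral_unique)
    have "integral {0..side k i} (\<lambda>y. ?t y * a' i y + ?t' y * a i y) =
        integral {0..side k i} (\<lambda>y. ?t y * a' i y) + integral {0..side k i} (\<lambda>y. (k$i * real (m$i) * (-1) ^ p i) * (trig (m$i) (p i) (k$i * y) * a i y))"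
      unfolding mult.assoc[of _ _ "a i _"]
      by (intro Henstock_Kurzweil_Integration.integral_add integrable_continuous_real continuous_intros
           continuous_on_subset[OF c] continuous_on_subset[OF ca]) auto
    also have "integral {0..side k i} (\<lambda>y. (k$i * real (m$i) * (-1) ^ p i) * (trig (m$i) (p i) (k$i * y) * a i y)) =
        k$i * real (m$i) * (-1) ^ p i * T i"
      unfolding T_def by (rule Henstock_Kurzweil_Integration.integral_mult_right)
    also have "integral {0..side k i} (\<lambda>y. ?t y * a' i y) = integral {0..side k i} (g i i)"
      by (simp add: g_def[abs_def] kdelta_def)
    finally have "integral {0..side k i} (g i i) = - (k$i * real (m$i) * (-1) ^ p i * T i)" using I by linarith
    then show ?thesis by (simp add: mult_ac)
  qed
  have "avg k (\<lambda>x. \<Sum>i\<in>UNIV. c i * (\<Prod>j\<in>UNIV. g i j (x$j))) = (\<Sum>i\<in>UNIV. c i * avg k (\<lambda>x. \<Prod>j\<in>UNIV. g i j (x$j)))"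
    unfolding avg_cmult[symmetric]
    by (rule avg_sum) (intro continuous_intros continuous_on_compose2[OF cg]; simp)
  also have "\<dots> = (\<Sum>i\<in>UNIV. c i * (\<Prod>j\<in>UNIV. integral {0..side k j} (g i j)))"
    by (simp add: avg_prod[OF cg])
  also have "\<dots> = (\<Sum>i\<in>UNIV. - (c i * (-1) ^ p i * (k$i * real (m$i)) * (\<Prod>j\<in>UNIV. T j)))"
  proof (rule sum.cong)
    fix i :: 3
    have "(\<Prod>j\<in>UNIV. integral {0..side k j} (g i j)) = integral {0..side k i} (g i i) * (\<Prod>j\<in>UNIV - {i}. T j)"
      by (subst prod.remove[of UNIV i]) (auto intro!: prod.cong simp: T_def g_def[abs_def] kdelta_def)
    also have "\<dots> = - ((-1) ^ p i * (k$i * real (m$i)) * (\<Prod>j\<in>UNIV. T j))"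
      by (simp add: gi prod.remove[of UNIV i])
    finally show "c i * (\<Prod>j\<in>UNIV. integral {0..side k j} (g i j)) = - (c i * (-1) ^ p i * (k$i * real (m$i)) * (\<Prod>j\<in>UNIV. T j))"
      by simp
  qed simp
  also have "\<dots> = - ((\<Sum>i\<in>UNIV. c i * (-1) ^ p i * (k$i * real (m$i))) * (\<Prod>j\<in>UNIV. T j))"
    by (simp add: sum_negf sum_distrib_right)
  finally show ?case using div by (simp add: eq)
next
  case (add q r)
  have "avg k (\<lambda>x. (\<Sum>i\<in>UNIV. c i * trig_prod k m (\<lambda>j. p j + kdelta i j) x * pd i q x) +
      (\<Sum>i\<in>UNIV. c i * trig_prod k m (\<lambda>j. p j + kdelta i j) x * pd i r x)) =
    avg k (\<lambda>x. \<Sum>i\<in>UNIV. c i * trig_prod k m (\<lambda>j. p j + kdelta i j) x * pd i q x) +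
    avg k (\<lambda>x. \<Sum>i\<in>UNIV. c i * trig_prod k m (\<lambda>j. p j + kdelta i j) x * pd i r x)"
    by (intro avg_add continuous_intros sep_sum_continuous[OF sep_sum_trig_prod]
        sep_sum_pd_continuous[OF add.hyps(1)] sep_sum_pd_continuous[OF add.hyps(2)])
  then show ?case by (simp add: pd_add[OF add.hyps] distrib_left sum.distrib add.IH)
qed

end

section \<open>Orthonormality of the modes\<close>

declare nu.simps [simp del] gdiag.simps [simp del] vmode.simps [simp del] fmode.simps [simp del]

text \<open>The eigenvalue of minus the Laplacian belonging to the mode.\<close>

definition ksq :: "real^3 \<Rightarrow> mode \<Rightarrow> real" where
  "ksq k n = (\<Sum>i\<in>UNIV. (k$i * real (fst n $ i))\<^sup>2)"

definition vcoeff :: "real^3 \<Rightarrow> mode \<Rightarrow> 3 \<Rightarrow> real" where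
  "vcoeff k n i = eta (fst n) / (norm (\<chi> i. gdiag k n $ i * nu n $ i) * V) * gdiag k n $ i * sgnp (fst (snd n)) $ i"

lemma vmode_component:
  "vmode k (m, p, c) x $ i = vcoeff k (m, p, c) i * trig_prod k m (\<lambda>j. p$j + kdelta i j) x"
  by (simp add: vmode.simps vcoeff_def trig_prod_def)

lemma fmode_eq:
  assumes "p$3 = 0"
  shows "fmode k (m, p, c) x = eta m / V * trig_prod k m (\<lambda>j. p$j + kdelta 3 j) x"
  using assms by (simp add: fmode.simps trig_prod_def prod_3 kdelta_def)

lemma N_theta_D:
  assumes "(m, p, c) \<in> N_theta"
  shows "p$3 = 0" "c = 1" "m$3 > 0" "p$1 \<le> 1" "p$2 \<le> 1" "m$1 = 0 \<longrightarrow> p$1 = 0" "m$2 = 0 \<longrightarrow> p$2 = 0"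
  using assms by (auto simp: N_theta_def phases_def split: if_splits)

lemma N_u_D:
  assumes "(m, p, c) \<in> N_u"
  shows "p$3 = 0" "p$1 \<le> 1" "p$2 \<le> 1" "c = 1 \<or> (c = 2 \<and> (\<forall>i. m$i > 0))" "m \<noteq> 0"
proof -
  have n: "m \<noteq> 0" "(p$1, p$2) \<in> phases_u m" "p$3 = 0" "c \<in> comps_u m"
    using assms by (simp_all add: N_u_def)
  have "phases_u m \<subseteq> {0, 1} \<times> {0, 1}" unfolding phases_u_def by simp
  with n(2) have "p$1 \<in> {0, 1}" "p$2 \<in> {0, 1}" by blast+
  then show "p$1 \<le> 1" "p$2 \<le> 1" by auto
  show "c = 1 \<or> (c = 2 \<and> (\<forall>i. m$i > 0))"
    using n(4) unfolding comps_u_def by (cases "\<forall>i. m$i > 0") auto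
qed (use assms in \<open>simp_all add: N_u_def\<close>)

lemma phase_eqI:
  fixes p p' :: "nat^3"
  assumes "p$3 = 0" "p$1 \<le> 1" "p$2 \<le> 1" "p'$3 = 0" "p'$1 \<le> 1" "p'$2 \<le> 1"
    and "\<And>j. even (p$j) = even (p'$j)"
  shows "p = p'"
proof -
  have "a = b" if "a \<le> 1" "b \<le> 1" "even a = even b" for a b :: nat
    using that by (cases "a = 0"; cases "b = 0") (auto simp: le_Suc_eq)
  with assms show ?thesis by (auto simp: vec_eq_iff forall_3)
qed

text \<open>A factor of the product vanishes exactly at a sine of frequency zero. Thus
  \<open>nu\<close> records which components are not killed by such a factor.\<close>

lemma nu_eq: "nu (m, p, c) $ i = of_bool (\<forall>j. m$j = 0 \<longrightarrow> even (p$j + kdelta i j))"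
proof -
  have "real (iota (m$j)) ^ ((p$j + kdelta i j) mod 2) = of_bool (m$j = 0 \<longrightarrow> even (p$j + kdelta i j))" for j
    by (cases "even (p$j + kdelta i j)") (auto simp: iota_def odd_iff_mod_2_eq_one even_iff_mod_2_eq_zero)
  then have "nu (m, p, c) $ i = (\<Prod>j\<in>UNIV. of_bool (m$j = 0 \<longrightarrow> even (p$j + kdelta i j)))"
    by (simp add: nu.simps)
  also have "\<dots> = of_bool (\<forall>j. m$j = 0 \<longrightarrow> even (p$j + kdelta i j))"
    unfolding prod_3 forall_3 by (simp add: of_bool_conj mult.assoc)
  finally show ?thesis .
qed

lemma gdiag_1:
  assumes "c = 1"
  shows "gdiag k (m, p, c) $ 1 = k$3 * real (m$3) + k$2 * real (m$2)"
    "gdiag k (m, p, c) $ 2 = - (k$1 * real (m$1)) - k$3 * real (m$3)"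
    "gdiag k (m, p, c) $ 3 = k$2 * real (m$2) - k$1 * real (m$1)"
  using assms by (simp_all add: gdiag.simps cross3_def gam_def wavevec_def)

lemma gdiag_2:
  assumes "c = 2"
  shows "gdiag k (m, p, c) $ 3 = - ((k$1 * real (m$1))\<^sup>2 + (k$2 * real (m$2))\<^sup>2 + k$3 * real (m$3) * (k$1 * real (m$1) + k$2 * real (m$2)))"
  using assms by (simp add: gdiag.simps cross3_def gam_def wavevec_def power2_eq_square algebra_simps)

text \<open>Both choices of \<open>c\<close> are cross products with \<open>wavevec k m\<close> as
  one factor, hence orthogonal to it. This is incompressibility in Fourier space.\<close>

lemma gdiag_dot_wavevec: "(\<Sum>i\<in>UNIV. gdiag k (m, p, c) $ i * (k$i * real (m$i))) = 0"
  by (simp add: gdiag.simps sum_3 cross3_def gam_def wavevec_def algebra_simps)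

lemma gdiag_1_2_orthogonal: "(\<Sum>i\<in>UNIV. gdiag k (m, p, 1) $ i * gdiag k (m, p', 2) $ i) = 0"
  by (simp add: gdiag.simps sum_3 cross3_def gam_def wavevec_def algebra_simps)

text \<open>The sign \<open>(-1) ^ (p$i)\<close> that appears when component \<open>i\<close> is
  differentiated is cancelled by \<open>sgnp\<close>.\<close>

lemma vcoeff_div_free: "(\<Sum>i\<in>UNIV. vcoeff k (m, p, c) i * (-1) ^ (p$i) * (k$i * real (m$i))) = 0"
proof -
  have "(\<Sum>i\<in>UNIV. vcoeff k (m, p, c) i * (-1) ^ (p$i) * (k$i * real (m$i))) =
     (\<Sum>i\<in>UNIV. eta m / (norm (\<chi> i. gdiag k (m, p, c) $ i * nu (m, p, c) $ i) * V) * (gdiag k (m, p, c) $ i * (k$i * real (m$i))))"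
    by (rule sum.cong) (auto simp: vcoeff_def sgnp_def simp flip: power_add mult_2)
  also have "\<dots> = 0" unfolding sum_distrib_left[symmetric] gdiag_dot_wavevec by simp
  finally show ?thesis .
qed

lemma V_pos: "V > 0" and V_sq: "V\<^sup>2 = 4 * pi ^ 3"
  by (simp_all add: V_def)

context wavenumbers
begin

text \<open>It justifies the normalising division in \<open>vmode\<close>. Some component must
  survive both \<open>gdiag\<close> and \<open>nu\<close>: for \<open>c = 2\<close> the third one
  does. For \<open>c = 1\<close> it is a horizontal one, unless exactly one horizontal frequency
  vanishes and its phase is even; then it is the third, and \<open>phases_u\<close> guarantees a
  positive vertical frequency.\<close>

lemma mode_amplitude_nonzero:
  assumes n: "(m, p, c) \<in> N_u"
  shows "(\<chi> i. gdiag k (m, p, c) $ i * nu (m, p, c) $ i) \<noteq> (0 :: real^3)"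
proof
  assume "(\<chi> i. gdiag k (m, p, c) $ i * nu (m, p, c) $ i) = (0 :: real^3)"
  then have z: "gdiag k (m, p, c) $ i = 0 \<or> nu (m, p, c) $ i = 0" for i
    by (simp add: vec_eq_iff)
  note D = N_u_D[OF n]
  have ph: "(p$1, p$2) \<in> phases_u m" using n by (simp add: N_u_def)
  have nz: "m$1 > 0 \<or> m$2 > 0 \<or> m$3 > 0" using D(5) by (auto simp: vec_eq_iff forall_3)
  have pos: "k$j * real (m$j) > 0" if "m$j > 0" for j using that k_pos[of j] by simp
  have nn: "k$j * real (m$j) \<ge> 0" for j using k_pos[of j] by simp
  show False
  proof (cases "c = 2")
    case True
    then have m: "m$i > 0" for i using D(4) by auto
    then have "nu (m, p, c) $ 3 \<noteq> 0" by (simp add: nu_eq)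
    then have "gdiag k (m, p, c) $ 3 = 0" using z by blast
    then show False using pos[OF m[of 1]] pos[OF m[of 2]] pos[OF m[of 3]]
      unfolding gdiag_2[OF True] by (metis add_pos_pos mult_pos_pos neg_equal_0_iff_equal zero_less_power less_irrefl)
  next
    case False
    then have c: "c = 1" using D by auto
    note g = gdiag_1[OF c, of k m p]
    have nu1: "nu (m, p, c) $ 1 \<noteq> 0 \<longleftrightarrow> (m$1 = 0 \<longrightarrow> odd (p$1)) \<and> (m$2 = 0 \<longrightarrow> even (p$2))"
      and nu2: "nu (m, p, c) $ 2 \<noteq> 0 \<longleftrightarrow> (m$1 = 0 \<longrightarrow> even (p$1)) \<and> (m$2 = 0 \<longrightarrow> odd (p$2))"
      unfolding nu_eq using D(1) by (auto simp: forall_3 kdelta_def)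
    have g1: "gdiag k (m, p, c) $ 1 \<noteq> 0" if "m$2 > 0 \<or> m$3 > 0"
      unfolding g using that pos[of 2] pos[of 3] nn[of 2] nn[of 3] by linarith
    have g2: "gdiag k (m, p, c) $ 2 \<noteq> 0" if "m$1 > 0 \<or> m$3 > 0"
      unfolding g using that pos[of 1] pos[of 3] nn[of 1] nn[of 3] by linarith
    have nu3: "nu (m, p, c) $ 3 \<noteq> 0 \<longleftrightarrow> (m$1 = 0 \<longrightarrow> even (p$1)) \<and> (m$2 = 0 \<longrightarrow> even (p$2)) \<and> m$3 \<noteq> 0"
      unfolding nu_eq using D(1) by (auto simp: forall_3 kdelta_def)
    have g3: "gdiag k (m, p, c) $ 3 \<noteq> 0" if "(m$1 = 0) \<noteq> (m$2 = 0)"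
      unfolding g using that pos[of 1] pos[of 2] by auto
    have ph1: "m$1 \<noteq> 0 \<longrightarrow> m$2 = 0 \<longrightarrow> m$3 = 0 \<longrightarrow> odd (p$2)"
      and ph2: "m$2 \<noteq> 0 \<longrightarrow> m$1 = 0 \<longrightarrow> m$3 = 0 \<longrightarrow> odd (p$1)"
      and ph3: "m$3 \<noteq> 0 \<longrightarrow> m$1 = 0 \<longrightarrow> m$2 = 0 \<longrightarrow> odd (p$1) \<noteq> odd (p$2)"
      using ph by (auto simp: phases_u_def)
    show False
    proof (cases "m$1 = 0")
      case A: True
      show False
      proof (cases "m$2 = 0")
        case B: True
        then have "m$3 > 0" using nz A by simp
        then show False using A B z[of 1] z[of 2] nu1 nu2 ph3 g1 g2 by (cases "odd (p$1)") auto
      next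
        case B: False
        show False
        proof (cases "odd (p$1)")
          case True
          then show False using A B z[of 1] nu1 g1 by auto
        next
          case False
          then show False using A B z[of 3] nu3 g3 ph2 by auto
        qed
      qed
    next
      case A: False
      show False
      proof (cases "m$2 = 0")
        case B: True
        show False
        proof (cases "odd (p$2)")
          case True
          then show False using A B z[of 2] nu2 g2 by auto
        next
          case False
          then show False using A B z[of 3] nu3 g3 ph1 by auto
        qed
      next
        case B: False
        then show False using A z[of 1] nu1 g1 by auto
      qed
    qed
  qed
qed

text \<open>The square of \<open>eta\<close> supplies a factor 2 for each positive frequency,
  offsetting the mean 1/2 of a squared sine or cosine; at frequency zero the cosine has mean 1 and
  the sine contributes 0.\<close>

lemma avg_trig_prod_same:
  assumes "even (q 3) = even (q' 3)"
  shows "(eta m / V)\<^sup>2 * avg k (\<lambda>x. trig_prod k m q x * trig_prod k m q' x) =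
     of_bool (\<forall>j. even (q j) = even (q' j) \<and> (m$j = 0 \<longrightarrow> even (q j)))"
proof -
  have "(sqrt 2 ^ iota (m$j))\<^sup>2 * (of_bool (even (q j) = even (q' j)) *
        (of_bool (m$j = m$j) + (-1) ^ q j * of_bool (m$j = 0 \<and> m$j = 0)) / 2) =
     of_bool (even (q j) = even (q' j) \<and> (m$j = 0 \<longrightarrow> even (q j)))" for j
    by (cases "even (q j)") (auto simp: iota_def)
  note e = this
  have "(eta m / V)\<^sup>2 * avg k (\<lambda>x. trig_prod k m q x * trig_prod k m q' x) =
    (eta m)\<^sup>2 * (\<Prod>j\<in>UNIV. of_bool (even (q j) = even (q' j)) *
        (of_bool (m$j = m$j) + (-1) ^ q j * of_bool (m$j = 0 \<and> m$j = 0)) / 2)"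
    unfolding avg_trig_prod_mult[of q q' m m, OF assms] using V_sq by (simp add: power_divide)
  also have "\<dots> = (\<Prod>j\<in>UNIV. (sqrt 2 ^ iota (m$j))\<^sup>2 * (of_bool (even (q j) = even (q' j)) *
        (of_bool (m$j = m$j) + (-1) ^ q j * of_bool (m$j = 0 \<and> m$j = 0)) / 2))"
    unfolding eta_def prod_power_distrib prod.distrib ..
  also have "\<dots> = of_bool (\<forall>j. even (q j) = even (q' j) \<and> (m$j = 0 \<longrightarrow> even (q j)))"
    unfolding e unfolding prod_3 forall_3 by (simp only: of_bool_conj mult.assoc)
  finally show ?thesis .
qed

lemma avg_trig_prod_different:
  assumes "even (q 3) = even (q' 3)" "m \<noteq> m'"
  shows "avg k (\<lambda>x. trig_prod k m q x * trig_prod k m' q' x) = 0"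
proof -
  obtain j where "m$j \<noteq> m'$j" using assms(2) by (auto simp: vec_eq_iff)
  then show ?thesis unfolding avg_trig_prod_mult[of q q' m m', OF assms(1)] by (auto intro!: exI[of _ j])
qed

lemma fmode_orthonormal:
  assumes "n \<in> N_theta" "n' \<in> N_theta"
  shows "avg k (\<lambda>x. fmode k n x * fmode k n' x) = of_bool (n = n')"
proof -
  obtain m p c m' p' c' where n: "n = (m, p, c)" "n' = (m', p', c')" by (metis prod_cases3)
  note D = N_theta_D[OF assms(1)[unfolded n]] and D' = N_theta_D[OF assms(2)[unfolded n]]
  have "avg k (\<lambda>x. fmode k n x * fmode k n' x) = eta m / V * (eta m' / V) *
     avg k (\<lambda>x. trig_prod k m (\<lambda>j. p$j + kdelta 3 j) x * trig_prod k m' (\<lambda>j. p'$j + kdelta 3 j) x)"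
    unfolding n fmode_eq[OF D(1)] fmode_eq[OF D'(1)] avg_cmult[symmetric] by (simp add: mult_ac)
  also have "\<dots> = of_bool (n = n')"
  proof (cases "m = m'")
    case True
    have "eta m / V * (eta m' / V) *
      avg k (\<lambda>x. trig_prod k m (\<lambda>j. p$j + kdelta 3 j) x * trig_prod k m' (\<lambda>j. p'$j + kdelta 3 j) x) =
      of_bool (\<forall>j. even (p$j + kdelta 3 j) = even (p'$j + kdelta 3 j) \<and> (m$j = 0 \<longrightarrow> even (p$j + kdelta 3 j)))"
      unfolding True[symmetric] power2_eq_square[symmetric] using D D' by (intro avg_trig_prod_same) (simp add: kdelta_def)
    also have "(\<forall>j. even (p$j + kdelta 3 j) = even (p'$j + kdelta 3 j) \<and> (m$j = 0 \<longrightarrow> even (p$j + kdelta 3 j))) \<longleftrightarrow> p = p'"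
    proof
      assume *: "\<forall>j. even (p$j + kdelta 3 j) = even (p'$j + kdelta 3 j) \<and> (m$j = 0 \<longrightarrow> even (p$j + kdelta 3 j))"
      have "even (p$j) = even (p'$j)" for j using *[rule_format, of j] by (simp add: even_add) argo
      then show "p = p'" using D D' by (intro phase_eqI)
    next
      assume "p = p'"
      then show "\<forall>j. even (p$j + kdelta 3 j) = even (p'$j + kdelta 3 j) \<and> (m$j = 0 \<longrightarrow> even (p$j + kdelta 3 j))"
        using D unfolding forall_3 by (simp add: kdelta_def)
    qed
    finally show ?thesis using True D D' by (simp add: n)
  next
    case False
    then show ?thesis using D D' by (subst avg_trig_prod_different) (auto simp: n kdelta_def)
  qed
  finally show ?thesis .
qed

lemma continuous_on_trig_prod [continuous_intros]: "continuous_on S (trig_prod k m q)"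
  using sep_sum_continuous[OF sep_sum_trig_prod] continuous_on_subset by blast

lemma vmode_orthonormal:
  assumes "n \<in> N_u" "n' \<in> N_u"
  shows "avg k (\<lambda>x. vmode k n x \<bullet> vmode k n' x) = of_bool (n = n')"
proof -
  obtain m p c m' p' c' where n: "n = (m, p, c)" "n' = (m', p', c')" by (metis prod_cases3)
  note D = N_u_D[OF assms(1)[unfolded n]] and D' = N_u_D[OF assms(2)[unfolded n]]
  define A where "A i = avg k (\<lambda>x. trig_prod k m (\<lambda>j. p$j + kdelta i j) x * trig_prod k m' (\<lambda>j. p'$j + kdelta i j) x)" for i
  have "avg k (\<lambda>x. vmode k n x \<bullet> vmode k n' x) = avg k (\<lambda>x. \<Sum>i\<in>UNIV. vcoeff k n i * vcoeff k n' i *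
     (trig_prod k m (\<lambda>j. p$j + kdelta i j) x * trig_prod k m' (\<lambda>j. p'$j + kdelta i j) x))"
    by (simp only: n inner_vec_def vmode_component inner_real_def mult_ac)
  also have "\<dots> = (\<Sum>i\<in>UNIV. vcoeff k n i * vcoeff k n' i * A i)"
    unfolding A_def avg_cmult[symmetric] by (intro avg_sum continuous_intros)
  also have "\<dots> = of_bool (n = n')"
  proof (cases "m = m'")
    case m: True
    define N where "N = norm (\<chi> i. gdiag k n $ i * nu n $ i)"
    define N' where "N' = norm (\<chi> i. gdiag k n' $ i * nu n' $ i)"
    have N: "N > 0" unfolding N_def using mode_amplitude_nonzero assms(1) by (simp add: n)
    have A: "(eta m / V)\<^sup>2 * A i = of_bool (p = p') * nu n $ i" for i
    proof -
      have "(eta m / V)\<^sup>2 * A i = of_bool (\<forall>j. even (p$j + kdelta i j) = even (p'$j + kdelta i j) \<and> (m$j = 0 \<longrightarrow> even (p$j + kdelta i j)))"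
        unfolding A_def m[symmetric] using D D' by (intro avg_trig_prod_same) (simp add: kdelta_def)
      also have "\<dots> = of_bool (p = p') * nu n $ i"
      proof (cases "p = p'")
        case True
        then show ?thesis by (simp add: n nu_eq)
      next
        case False
        then have "\<not> (\<forall>j. even (p$j) = even (p'$j))" using D D' phase_eqI[of p p'] by blast
        then obtain j where "even (p$j) \<noteq> even (p'$j)" by blast
        then have "even (p$j + kdelta i j) \<noteq> even (p'$j + kdelta i j)" unfolding even_add by argo
        then show ?thesis using False by auto
      qed
      finally show ?thesis .
    qed
    have "(\<Sum>i\<in>UNIV. vcoeff k n i * vcoeff k n' i * A i) =
      (\<Sum>i\<in>UNIV. (gdiag k n $ i * gdiag k n' $ i * (sgnp p $ i * sgnp p' $ i)) / (N * N') * ((eta m / V)\<^sup>2 * A i))"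
      by (rule sum.cong) (simp_all add: vcoeff_def N_def N'_def n m power2_eq_square mult_ac)
    also have "\<dots> = of_bool (n = n')"
    proof (cases "p = p'")
      case p: True
      have s: "sgnp p $ i * sgnp p $ i = 1" for i by (simp add: sgnp_def flip: power_add mult_2)
      have "(\<Sum>i\<in>UNIV. (gdiag k n $ i * gdiag k n' $ i * (sgnp p $ i * sgnp p' $ i)) / (N * N') * ((eta m / V)\<^sup>2 * A i)) =
        (\<Sum>i\<in>UNIV. gdiag k n $ i * gdiag k n' $ i * nu n $ i) / (N * N')"
        unfolding A p[symmetric] s by (simp add: sum_divide_distrib)
      also have "\<dots> = of_bool (n = n')"
      proof (cases "c = c'")
        case c: True
        have nn: "n' = n" by (simp add: n m p c)
        have nu2: "nu n $ i * nu n $ i = nu n $ i" for i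
          unfolding n nu_eq by (simp only: of_bool_conj[symmetric] conj_absorb)
        have "gdiag k n $ i * gdiag k n $ i * (nu n $ i * nu n $ i) = (gdiag k n $ i * nu n $ i)\<^sup>2" for i
          by (simp only: power2_eq_square mult_ac)
        then have "gdiag k n $ i * gdiag k n $ i * nu n $ i = (gdiag k n $ i * nu n $ i)\<^sup>2" for i
          unfolding nu2 .
        then have "(\<Sum>i\<in>UNIV. gdiag k n $ i * gdiag k n $ i * nu n $ i) = N\<^sup>2"
          by (simp add: N_def norm_vec_def L2_set_def sum_nonneg)
        moreover have "N' = N" by (simp add: N'_def N_def nn)
        ultimately show ?thesis using N by (simp add: nn power2_eq_square)
      next
        case c: False
        \<comment> \<open>Both components occur for the same \<open>m\<close> only when all
          frequencies are positive. Then every \<open>nu\<close> is 1 and the inner product is that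
          of the two cross products, of which the second has the first as a factor.\<close>
        then have mpos: "\<forall>i. m$i > 0" and cc: "c = 1 \<and> c' = 2 \<or> c = 2 \<and> c' = 1"
          using D(4) D'(4) m by auto
        have nz: "m$j \<noteq> 0" for j using mpos by (metis less_numeral_extra(3))
        have "nu n $ i = 1" for i unfolding n nu_eq by (simp only: nz simp_thms of_bool_eq)
        then have "(\<Sum>i\<in>UNIV. gdiag k n $ i * gdiag k n' $ i * nu n $ i) = 0"
          using cc gdiag_1_2_orthogonal[of k m p p] unfolding n m[symmetric] p[symmetric]
          by (auto simp: mult.commute)
        then show ?thesis using c by (simp add: n)
      qed
      finally show ?thesis .
    qed (simp add: A n)
    finally show ?thesis .
  next
    case False
    then have "A i = 0" for i using D D' unfolding A_def by (intro avg_trig_prod_different) (auto simp: kdelta_def)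
    then show ?thesis using False by (simp add: n)
  qed
  finally show ?thesis .
qed

end

section \<open>The coefficient equations\<close>

text \<open>This makes derivatives within \<open>{0..}\<close> unique, including the one-sided
  derivative at time 0.\<close>

lemma at_ge_nontrivial: "(t::real) \<ge> 0 \<Longrightarrow> at t within {0..} \<noteq> bot"
proof -
  assume "t \<ge> 0"
  then have "at t within {t..t+1} \<le> at t within {0..}" by (intro at_le) auto
  moreover have "at t within {t..t+1} \<noteq> bot" by (simp add: at_within_Icc_at_right)
  ultimately show ?thesis by (metis bot.extremum_uniqueI)
qed

locale truncation = wavenumbers k for k :: "real^3" +
  fixes P R S :: real and Nu Nt :: "mode set"
  assumes R: "R \<ge> 0" and S: "S \<ge> 0" and P: "P > 0"
    and fin_u: "finite Nu" and Nu: "Nu \<subseteq> N_u" and fin_t: "finite Nt" and Nt: "Nt \<subseteq> N_theta"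
begin

abbreviation "vel \<equiv> velocity k Nu"
abbreviation "temp \<equiv> temperature k Nt"
abbreviation "is_sol \<equiv> solution k P R S Nu Nt"
abbreviation "semiflow \<equiv> flow k P R S Nu Nt"
abbreviation "sdist \<equiv> state_dist Nu Nt"

lemma sep_sum_vmode: "sep_sum k (\<lambda>x. vmode k n x $ i)"
  by (cases n) (simp add: vmode_component sep_sum_cmult sep_sum_trig_prod)

lemma sep_sum_fmode:
  assumes "n \<in> N_theta"
  shows "sep_sum k (fmode k n)"
proof -
  obtain m p c where n: "n = (m, p, c)" by (metis prod_cases3)
  have "fmode k n = (\<lambda>x. eta m / V * trig_prod k m (\<lambda>j. p$j + kdelta 3 j) x)"
    unfolding n using N_theta_D(1)[OF assms[unfolded n]] by (intro ext fmode_eq)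
  then show ?thesis by (simp only: sep_sum_cmult sep_sum_trig_prod)
qed

lemma velocity_component: "vel X x $ i = (\<Sum>n\<in>Nu. fst X n * vmode k n x $ i)"
  by (simp add: velocity_def)

lemma sep_sum_velocity: "sep_sum k (\<lambda>x. vel X x $ i)"
  unfolding velocity_component by (intro sep_sum_sum sep_sum_cmult sep_sum_vmode)

lemma sep_sum_temperature: "sep_sum k (temp X)"
  unfolding temperature_def[abs_def] using Nt by (intro sep_sum_sum sep_sum_cmult sep_sum_fmode) auto

lemmas cont_vmode = sep_sum_continuous[OF sep_sum_vmode]
  and cont_fmode = sep_sum_continuous[OF sep_sum_fmode]
  and cont_velocity = sep_sum_continuous[OF sep_sum_velocity]
  and cont_temperature = sep_sum_continuous[OF sep_sum_temperature]
  and cont_pd_velocity = sep_sum_pd_continuous[OF sep_sum_velocity]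
  and cont_pd_temperature = sep_sum_pd_continuous[OF sep_sum_temperature]

text \<open>The weak form of incompressibility together with the absence of flow through top and
  bottom. Every cancellation of a nonlinear term below goes back to it.\<close>

lemma avg_advect_velocity:
  assumes q: "sep_sum k q"
  shows "avg k (advect (vel X) q) = 0"
proof -
  note cq = sep_sum_pd_continuous[OF q]
  have "avg k (advect (vmode k n) q) = 0" if "n \<in> Nu" for n
  proof -
    obtain m p c where n: "n = (m, p, c)" by (metis prod_cases3)
    then have "p$3 = 0" using that Nu N_u_D(1) by blast
    then show ?thesis
      using avg_div_free[OF q, of "\<lambda>j. p$j" "vcoeff k (m, p, c)" m] vcoeff_div_free[of k m p c]
      unfolding advect_def[abs_def] n vmode_component by simp
  qed
  moreover have "advect (vel X) q = (\<lambda>x. \<Sum>n\<in>Nu. fst X n * advect (vmode k n) q x)"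
  proof
    fix x
    have "advect (vel X) q x = (\<Sum>j\<in>UNIV. \<Sum>n\<in>Nu. fst X n * (vmode k n x $ j * pd j q x))"
      by (simp add: advect_def velocity_component sum_distrib_right mult.assoc)
    then show "advect (vel X) q x = (\<Sum>n\<in>Nu. fst X n * advect (vmode k n) q x)"
      by (subst (asm) sum.swap) (simp add: advect_def sum_distrib_left)
  qed
  moreover have "avg k (\<lambda>x. \<Sum>n\<in>Nu. fst X n * advect (vmode k n) q x) = (\<Sum>n\<in>Nu. fst X n * avg k (advect (vmode k n) q))"
    unfolding avg_cmult[symmetric] advect_def
    by (intro avg_sum continuous_intros cont_vmode cq)
  ultimately show ?thesis by simp
qed

lemma pd_pd_trig_prod_sum:
  "pd i (pd i (\<lambda>x. \<Sum>a\<in>A. c a * trig_prod k (m a) (q a) x)) x =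
     (\<Sum>a\<in>A. - (k$i * real (m a $ i))\<^sup>2 * (c a * trig_prod k (m a) (q a) x))"
proof -
  define s where "s i a = c a * (k$i * real (m a $ i) * (-1) ^ Suc (q a i))" for i a
  have 1: "pd i (\<lambda>x. \<Sum>a\<in>A. c a * trig_prod k (m a) (q a) x) =
      (\<lambda>x. \<Sum>a\<in>A. s i a * trig_prod k (m a) ((q a)(i := Suc (q a i))) x)" for i
  proof
    fix x
    show "pd i (\<lambda>x. \<Sum>a\<in>A. c a * trig_prod k (m a) (q a) x) x =
      (\<Sum>a\<in>A. s i a * trig_prod k (m a) ((q a)(i := Suc (q a i))) x)"
      by (subst pd_sum[of A k]) (simp_all add: sep_sum_cmult sep_sum_trig_prod pd_cmult[OF sep_sum_trig_prod] pd_trig_prod s_def mult.assoc)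
  qed
  have par: "trig_prod k m' ((q')(i := Suc (Suc (q' i)))) = trig_prod k m' q'" for m' q' and i :: 3
    by (rule trig_prod_parity) simp
  have 2: "pd i (\<lambda>x. \<Sum>a\<in>A. s i a * trig_prod k (m a) ((q a)(i := Suc (q a i))) x) x =
      (\<Sum>a\<in>A. - (k$i * real (m a $ i))\<^sup>2 * (c a * trig_prod k (m a) (q a) x))" for i
  proof -
    have "pd i (\<lambda>x. \<Sum>a\<in>A. s i a * trig_prod k (m a) ((q a)(i := Suc (q a i))) x) x =
       (\<Sum>a\<in>A. s i a * (k$i * real (m a $ i) * (-1) ^ Suc (Suc (q a i)) * trig_prod k (m a) (q a) x))"
      by (subst pd_sum[of A k])
        (simp_all add: sep_sum_cmult sep_sum_trig_prod pd_cmult[OF sep_sum_trig_prod] pd_trig_prod par)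
    also have "\<dots> = (\<Sum>a\<in>A. - (k$i * real (m a $ i))\<^sup>2 * (c a * trig_prod k (m a) (q a) x))"
    proof (rule sum.cong)
      fix a
      have alg: "(z * (w * A)) * (w * B * T) = - (w * w) * (z * T)" if "A * B = -1" for z w A B T :: real
        using that by algebra
      \<comment> \<open>Two successive phase shifts in one direction carry opposite signs, whence
        the minus sign of the eigenvalue.\<close>
      have "(-1) ^ Suc (q a i) * (-1) ^ Suc (Suc (q a i)) = (-1 :: real)"
        by (cases "even (q a i)") auto
      then show "s i a * (k$i * real (m a $ i) * (-1) ^ Suc (Suc (q a i)) * trig_prod k (m a) (q a) x) =
          - (k$i * real (m a $ i))\<^sup>2 * (c a * trig_prod k (m a) (q a) x)"
        unfolding s_def power2_eq_square by (rule alg)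
    qed simp
    finally show ?thesis .
  qed
  show ?thesis unfolding 1 2 ..
qed

lemma laplace_trig_prod_sum:
  "laplace (\<lambda>x. \<Sum>a\<in>A. c a * trig_prod k (m a) (q a) x) x =
     (\<Sum>a\<in>A. - (\<Sum>i\<in>UNIV. (k$i * real (m a $ i))\<^sup>2) * (c a * trig_prod k (m a) (q a) x))"
  unfolding laplace_def pd_pd_trig_prod_sum by (subst sum.swap) (simp add: sum_distrib_right sum_negf)

lemma fmode_Nt_eq:
  assumes "n \<in> Nt"
  shows "c * fmode k n x = (c * (eta (fst n) / V)) * trig_prod k (fst n) (\<lambda>j. fst (snd n) $ j + kdelta 3 j) x"
  using assms Nt N_theta_D(1) fmode_eq by (cases n) auto

lemma temperature_trig_prod:
  "temp X = (\<lambda>x. \<Sum>n\<in>Nt. (snd X n * (eta (fst n) / V)) * trig_prod k (fst n) (\<lambda>j. fst (snd n) $ j + kdelta 3 j) x)"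
  unfolding temperature_def[abs_def] by (intro ext sum.cong refl fmode_Nt_eq)

lemma laplace_temperature: "laplace (temp X) x = (\<Sum>n\<in>Nt. - ksq k n * (snd X n * fmode k n x))"
  unfolding temperature_trig_prod laplace_trig_prod_sum ksq_def
  by (intro sum.cong refl) (simp only: fmode_Nt_eq)

lemma pd_pd_temperature:
  "pd i (pd i (temp X)) x = (\<Sum>n\<in>Nt. - (k$i * real (fst n $ i))\<^sup>2 * (snd X n * fmode k n x))"
  unfolding temperature_trig_prod pd_pd_trig_prod_sum
  by (intro sum.cong refl) (simp only: fmode_Nt_eq)

lemma vlaplace_velocity: "vlaplace (vel X) x = (\<Sum>n\<in>Nu. (- ksq k n * fst X n) *\<^sub>R vmode k n x)"
proof -
  have v: "fst X n * vmode k n x $ i = (fst X n * vcoeff k n i) * trig_prod k (fst n) (\<lambda>j. fst (snd n) $ j + kdelta i j) x"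
    for n x i
    using vmode_component by (cases n) auto
  have "laplace (\<lambda>x. vel X x $ i) x = (\<Sum>n\<in>Nu. - ksq k n * (fst X n * vmode k n x $ i))" for i
    unfolding velocity_component v laplace_trig_prod_sum ksq_def ..
  then show ?thesis by (simp add: vlaplace_def vec_eq_iff mult.assoc)
qed

definition Fu :: "state \<Rightarrow> mode \<Rightarrow> real" where
  "Fu X n = - P * ksq k n * fst X n
     + P * R * avg k (\<lambda>x. temp X x * vmode k n x $ 3)
     - P * S * avg k (\<lambda>x. cross3 e3 (vel X x) \<bullet> vmode k n x)
     - avg k (\<lambda>x. vadvect (vel X) (vel X) x \<bullet> vmode k n x)"

definition Ft :: "state \<Rightarrow> mode \<Rightarrow> real" where
  "Ft X n = - ksq k n * snd X n
     + avg k (\<lambda>x. vel X x $ 3 * fmode k n x)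
     - avg k (\<lambda>x. advect (vel X) (temp X) x * fmode k n x)"

lemma rhs_u_eq: "rhs_u k P R S Nu Nt X x = (\<Sum>n\<in>Nu. Fu X n *\<^sub>R vmode k n x)"
proof -
  have e3: "(c *\<^sub>R e3) \<bullet> v = c * v $ 3" for c and v :: "real^3"
    by (simp add: e3_def inner_axis')
  show ?thesis
    unfolding rhs_u_def Let_def vlaplace_velocity proj_u_def e3 Fu_def
    by (simp add: scaleR_sum_right scaleR_add_left scaleR_diff_left sum.distrib sum_subtractf sum_negf mult.assoc)
qed

lemma rhs_theta_eq: "rhs_theta k Nu Nt X x = (\<Sum>n\<in>Nt. Ft X n * fmode k n x)"
  unfolding rhs_theta_def Let_def laplace_temperature proj_theta_def Ft_def
  by (simp add: algebra_simps sum.distrib sum_subtractf sum_negf)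

lemma cont_inner_vmode: "continuous_on UNIV (\<lambda>x. vmode k n x \<bullet> vmode k m x)"
  unfolding inner_vec_def inner_real_def by (intro continuous_intros cont_vmode)

lemma avg_vmode_sum:
  assumes "m \<in> Nu"
  shows "avg k (\<lambda>x. (\<Sum>n\<in>Nu. d n *\<^sub>R vmode k n x) \<bullet> vmode k m x) = d m"
proof -
  have "avg k (\<lambda>x. (\<Sum>n\<in>Nu. d n *\<^sub>R vmode k n x) \<bullet> vmode k m x) = (\<Sum>n\<in>Nu. d n * avg k (\<lambda>x. vmode k n x \<bullet> vmode k m x))"
    unfolding avg_cmult[symmetric] inner_sum_left inner_scaleR_left
    by (intro avg_sum continuous_on_mult_left cont_inner_vmode)
  also have "\<dots> = (\<Sum>n\<in>Nu. d n * of_bool (n = m))"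
    using Nu assms by (intro sum.cong refl arg_cong2[of _ _ _ _ "(*)"] vmode_orthonormal) auto
  also have "\<dots> = d m" using fin_u assms by simp
  finally show ?thesis .
qed

lemma avg_fmode_sum:
  assumes "m \<in> Nt"
  shows "avg k (\<lambda>x. (\<Sum>n\<in>Nt. d n * fmode k n x) * fmode k m x) = d m"
proof -
  have "avg k (\<lambda>x. (\<Sum>n\<in>Nt. d n * fmode k n x) * fmode k m x) = (\<Sum>n\<in>Nt. d n * avg k (\<lambda>x. fmode k n x * fmode k m x))"
    unfolding avg_cmult[symmetric] sum_distrib_right mult.assoc using Nt assms
    by (intro avg_sum continuous_intros cont_fmode) auto
  also have "\<dots> = (\<Sum>n\<in>Nt. d n * of_bool (n = m))"
    using Nt assms by (intro sum.cong refl arg_cong2[of _ _ _ _ "(*)"] fmode_orthonormal) auto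
  also have "\<dots> = d m" using fin_t assms by simp
  finally show ?thesis .
qed

text \<open>Coefficients are recovered by integrals over \<open>Omega k\<close>, so agreement on the
  box is enough.\<close>

lemma vmode_independent:
  assumes "\<And>x. x \<in> Omega k \<Longrightarrow> (\<Sum>n\<in>Nu. d n *\<^sub>R vmode k n x) = (\<Sum>n\<in>Nu. e n *\<^sub>R vmode k n x)" "m \<in> Nu"
  shows "d m = e m"
proof -
  have "avg k (\<lambda>x. (\<Sum>n\<in>Nu. d n *\<^sub>R vmode k n x) \<bullet> vmode k m x) = avg k (\<lambda>x. (\<Sum>n\<in>Nu. e n *\<^sub>R vmode k n x) \<bullet> vmode k m x)"
    unfolding avg_def using assms(1) by (intro integral_cong) simp
  then show ?thesis unfolding avg_vmode_sum[OF assms(2)] .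
qed

lemma fmode_independent:
  assumes "\<And>x. x \<in> Omega k \<Longrightarrow> (\<Sum>n\<in>Nt. d n * fmode k n x) = (\<Sum>n\<in>Nt. e n * fmode k n x)" "m \<in> Nt"
  shows "d m = e m"
proof -
  have "avg k (\<lambda>x. (\<Sum>n\<in>Nt. d n * fmode k n x) * fmode k m x) = avg k (\<lambda>x. (\<Sum>n\<in>Nt. e n * fmode k n x) * fmode k m x)"
    unfolding avg_def using assms(1) by (intro integral_cong) simp
  then show ?thesis unfolding avg_fmode_sum[OF assms(2)] .
qed

text \<open>The differentiability demanded in \<open>solution\<close> supplies candidate derivatives
  of the coefficients, and independence of the modes identifies them with \<open>Fu\<close> and
  \<open>Ft\<close>. From here on the field equations are an ordinary differential equation for the
  coefficients.\<close>

theorem solution_iff: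
  "is_sol X \<longleftrightarrow> (\<forall>t\<ge>0. X t \<in> states Nu Nt
      \<and> (\<forall>n\<in>Nu. ((\<lambda>s. fst (X s) n) has_real_derivative Fu (X t) n) (at t within {0..}))
      \<and> (\<forall>n\<in>Nt. ((\<lambda>s. snd (X s) n) has_real_derivative Ft (X t) n) (at t within {0..})))"
    (is "_ \<longleftrightarrow> ?R")
proof
  assume sol: "is_sol X"
  show ?R
  proof (intro allI impI)
    fix t :: real assume t: "t \<ge> 0"
    note nb = at_ge_nontrivial[OF t]
    have s: "X t \<in> states Nu Nt"
      "\<And>n. n \<in> Nu \<Longrightarrow> (\<lambda>s. fst (X s) n) differentiable (at t within {0..})"
      "\<And>n. n \<in> Nt \<Longrightarrow> (\<lambda>s. snd (X s) n) differentiable (at t within {0..})"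
      "\<And>x. x \<in> Omega k \<Longrightarrow> ((\<lambda>s. vel (X s) x) has_vector_derivative rhs_u k P R S Nu Nt (X t) x) (at t within {0..})"
      "\<And>x. x \<in> Omega k \<Longrightarrow> ((\<lambda>s. temp (X s) x) has_real_derivative rhs_theta k Nu Nt (X t) x) (at t within {0..})"
      using sol t unfolding solution_def by blast+
    have "\<forall>n. \<exists>d. n \<in> Nu \<longrightarrow> ((\<lambda>s. fst (X s) n) has_real_derivative d) (at t within {0..})"
      using s(2) unfolding real_differentiable_def by blast
    from choice[OF this] obtain du where
      du: "\<And>n. n \<in> Nu \<Longrightarrow> ((\<lambda>s. fst (X s) n) has_real_derivative du n) (at t within {0..})"
      by blast
    have "\<forall>n. \<exists>d. n \<in> Nt \<longrightarrow> ((\<lambda>s. snd (X s) n) has_real_derivative d) (at t within {0..})"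
      using s(3) unfolding real_differentiable_def by blast
    from choice[OF this] obtain dt where
      dt: "\<And>n. n \<in> Nt \<Longrightarrow> ((\<lambda>s. snd (X s) n) has_real_derivative dt n) (at t within {0..})"
      by blast
    have "du n = Fu (X t) n" if "n \<in> Nu" for n
    proof (rule vmode_independent[OF _ that])
      fix x assume "x \<in> Omega k"
      have "((\<lambda>s. \<Sum>n\<in>Nu. fst (X s) n *\<^sub>R vmode k n x) has_vector_derivative (\<Sum>n\<in>Nu. du n *\<^sub>R vmode k n x)) (at t within {0..})"
        by (intro has_vector_derivative_sum) (auto intro!: derivative_eq_intros du)
      from vector_derivative_unique_within[OF nb this s(4)[OF \<open>x \<in> Omega k\<close>, unfolded velocity_def rhs_u_eq]]
      show "(\<Sum>n\<in>Nu. du n *\<^sub>R vmode k n x) = (\<Sum>n\<in>Nu. Fu (X t) n *\<^sub>R vmode k n x)" .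
    qed
    moreover have "dt n = Ft (X t) n" if "n \<in> Nt" for n
    proof (rule fmode_independent[OF _ that])
      fix x assume "x \<in> Omega k"
      have "((\<lambda>s. \<Sum>n\<in>Nt. snd (X s) n * fmode k n x) has_real_derivative (\<Sum>n\<in>Nt. dt n * fmode k n x)) (at t within {0..})"
        by (intro DERIV_sum) (auto intro!: derivative_eq_intros dt)
      from vector_derivative_unique_within[OF nb this[unfolded has_real_derivative_iff_has_vector_derivative]
          s(5)[OF \<open>x \<in> Omega k\<close>, unfolded temperature_def rhs_theta_eq has_real_derivative_iff_has_vector_derivative]]
      show "(\<Sum>n\<in>Nt. dt n * fmode k n x) = (\<Sum>n\<in>Nt. Ft (X t) n * fmode k n x)" .
    qed
    ultimately show "X t \<in> states Nu Nt
      \<and> (\<forall>n\<in>Nu. ((\<lambda>s. fst (X s) n) has_real_derivative Fu (X t) n) (at t within {0..}))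
      \<and> (\<forall>n\<in>Nt. ((\<lambda>s. snd (X s) n) has_real_derivative Ft (X t) n) (at t within {0..}))"
      using s(1) du dt by auto
  qed
next
  assume R: ?R
  show "is_sol X"
    unfolding solution_def
  proof (intro allI impI conjI ballI)
    fix t :: real assume t: "t \<ge> 0"
    show "X t \<in> states Nu Nt" using R t by blast
    have du: "((\<lambda>s. fst (X s) n) has_real_derivative Fu (X t) n) (at t within {0..})" if "n \<in> Nu" for n
      using R t that by blast
    have dt: "((\<lambda>s. snd (X s) n) has_real_derivative Ft (X t) n) (at t within {0..})" if "n \<in> Nt" for n
      using R t that by blast
    show "(\<lambda>s. fst (X s) n) differentiable (at t within {0..})" if "n \<in> Nu" for n
      using du[OF that] real_differentiable_def by blast
    show "(\<lambda>s. snd (X s) n) differentiable (at t within {0..})" if "n \<in> Nt" for n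
      using dt[OF that] real_differentiable_def by blast
    fix x
    show "((\<lambda>s. vel (X s) x) has_vector_derivative rhs_u k P R S Nu Nt (X t) x) (at t within {0..})"
      unfolding velocity_def rhs_u_eq
      by (intro has_vector_derivative_sum) (auto intro!: derivative_eq_intros du)
    show "((\<lambda>s. temp (X s) x) has_real_derivative rhs_theta k Nu Nt (X t) x) (at t within {0..})"
      unfolding temperature_def rhs_theta_eq
      by (intro DERIV_sum) (auto intro!: derivative_eq_intros dt)
  qed
qed

end

lemma continuous_on_vecI:
  fixes f :: "'a::topological_space \<Rightarrow> real^'n"
  assumes "\<And>i. continuous_on S (\<lambda>x. f x $ i)"
  shows "continuous_on S f"
  using continuous_on_vec_lambda[of S "\<lambda>i x. f x $ i"] assms by simp

section \<open>Energy identities\<close>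

context truncation
begin

lemma cont_vmode': "continuous_on UNIV (vmode k n)"
  by (rule continuous_on_vecI) (rule cont_vmode)

lemma cont_velocity': "continuous_on UNIV (vel X)"
  by (rule continuous_on_vecI) (rule cont_velocity)

lemma cont_advect_temperature: "continuous_on UNIV (advect (vel X) (temp X))"
  unfolding advect_def by (intro continuous_intros cont_velocity cont_pd_temperature)

lemma cont_vadvect: "continuous_on UNIV (vadvect (vel X) (vel X))"
  by (rule continuous_on_vecI) (simp add: vadvect_def advect_def, intro continuous_intros cont_velocity cont_pd_velocity)

lemma cont_fmode_Nt: "n \<in> Nt \<Longrightarrow> continuous_on UNIV (fmode k n)"
  using cont_fmode Nt by blast

lemma avg_inner_velocity:
  assumes "continuous_on UNIV w"
  shows "(\<Sum>n\<in>Nu. fst X n * avg k (\<lambda>x. w x \<bullet> vmode k n x)) = avg k (\<lambda>x. w x \<bullet> vel X x)"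
  unfolding velocity_def inner_sum_right inner_scaleR_right avg_cmult[symmetric]
  by (rule avg_sum[symmetric]) (intro continuous_on_mult_left continuous_on_inner assms cont_vmode')

lemma avg_mult_velocity_3:
  assumes "continuous_on UNIV w"
  shows "(\<Sum>n\<in>Nu. fst X n * avg k (\<lambda>x. w x * vmode k n x $ 3)) = avg k (\<lambda>x. w x * vel X x $ 3)"
  unfolding velocity_component sum_distrib_left avg_cmult[symmetric] mult.left_commute[of "w _"]
  by (rule avg_sum[symmetric]) (intro continuous_on_mult_left continuous_on_mult assms cont_vmode)

lemma avg_mult_temperature:
  assumes "continuous_on UNIV w"
  shows "(\<Sum>n\<in>Nt. snd X n * avg k (\<lambda>x. w x * fmode k n x)) = avg k (\<lambda>x. w x * temp X x)"
  unfolding temperature_def sum_distrib_left avg_cmult[symmetric] mult.left_commute[of "w _"]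
  by (rule avg_sum[symmetric]) (intro continuous_on_mult_left continuous_on_mult assms cont_fmode_Nt)

lemma avg_velocity_sq: "avg k (\<lambda>x. vel X x \<bullet> vel X x) = (\<Sum>n\<in>Nu. (fst X n)\<^sup>2)"
  unfolding avg_inner_velocity[OF cont_velocity', symmetric]
  by (simp add: velocity_def avg_vmode_sum power2_eq_square)

lemma avg_temperature_sq: "avg k (\<lambda>x. temp X x * temp X x) = (\<Sum>n\<in>Nt. (snd X n)\<^sup>2)"
  unfolding avg_mult_temperature[OF cont_temperature, symmetric]
  by (simp add: temperature_def avg_fmode_sum power2_eq_square)

text \<open>Pointwise, the product of the inertial term with the velocity is half the advection of
  the squared speed, which integrates to zero.\<close>

lemma inertial_energy_zero:
  "avg k (\<lambda>x. vadvect (vel X) (vel X) x \<bullet> vel X x) = 0"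
proof -
  let ?u = "vel X"
  define q where "q = (\<lambda>x. \<Sum>i\<in>UNIV. ?u x $ i * ?u x $ i)"
  have q: "sep_sum k q" unfolding q_def by (intro sep_sum_sum sep_sum_mult sep_sum_velocity)
  have pdq: "pd j q x = 2 * (\<Sum>i\<in>UNIV. pd j (\<lambda>y. ?u y $ i) x * ?u x $ i)" for j x
  proof -
    have "pd j q x = (\<Sum>i\<in>UNIV. pd j (\<lambda>x. ?u x $ i * ?u x $ i) x)"
      unfolding q_def by (rule pd_sum[of UNIV k]) (intro sep_sum_mult sep_sum_velocity)
    also have "\<dots> = (\<Sum>i\<in>UNIV. 2 * (pd j (\<lambda>y. ?u y $ i) x * ?u x $ i))"
      by (intro sum.cong refl) (simp add: pd_mult[OF sep_sum_velocity sep_sum_velocity])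
    finally show ?thesis by (simp add: sum_distrib_left)
  qed
  have "vadvect ?u ?u x \<bullet> ?u x = 1/2 * advect ?u q x" for x
  proof -
    have "vadvect ?u ?u x \<bullet> ?u x = (\<Sum>i\<in>UNIV. \<Sum>j\<in>UNIV. ?u x $ j * (pd j (\<lambda>y. ?u y $ i) x * ?u x $ i))"
      by (simp add: inner_vec_def vadvect_def advect_def sum_distrib_right mult.assoc)
    also have "\<dots> = (\<Sum>j\<in>UNIV. ?u x $ j * (\<Sum>i\<in>UNIV. pd j (\<lambda>y. ?u y $ i) x * ?u x $ i))"
      by (subst sum.swap) (simp add: sum_distrib_left)
    also have "\<dots> = 1/2 * advect ?u q x" by (simp add: advect_def pdq sum_distrib_left)
    finally show ?thesis .
  qed
  then have "avg k (\<lambda>x. vadvect ?u ?u x \<bullet> ?u x) = 1/2 * avg k (advect ?u q)"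
    by (simp only: avg_cmult)
  then show ?thesis by (simp add: avg_advect_velocity[OF q])
qed

lemma convective_energy_zero:
  "avg k (\<lambda>x. advect (vel X) (temp X) x * temp X x) = 0"
proof -
  let ?u = "vel X" and ?t = "temp X"
  have "advect ?u ?t x * ?t x = 1/2 * advect ?u (\<lambda>x. ?t x * ?t x) x" for x
    by (simp add: advect_def pd_mult[OF sep_sum_temperature sep_sum_temperature] sum_distrib_left sum_distrib_right mult_ac)
  then have "avg k (\<lambda>x. advect ?u ?t x * ?t x) = 1/2 * avg k (advect ?u (\<lambda>x. ?t x * ?t x))"
    by (simp only: avg_cmult)
  then show ?thesis
    by (simp add: avg_advect_velocity sep_sum_mult sep_sum_temperature)
qed

definition flux :: "state \<Rightarrow> real" where
  "flux X = avg k (\<lambda>x. vel X x $ 3 * temp X x)"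

text \<open>Testing with the velocity itself removes the projections. The Coriolis term is pointwise
  orthogonal to the velocity and the inertial term integrates to zero, so viscosity and buoyancy
  remain.\<close>

lemma velocity_energy:
  "(\<Sum>n\<in>Nu. fst X n * Fu X n) = - P * (\<Sum>n\<in>Nu. ksq k n * (fst X n)\<^sup>2) + P * R * flux X"
proof -
  have cc: "continuous_on UNIV (\<lambda>x. cross3 e3 (vel X x))"
    by (intro continuous_on_cross continuous_on_const cont_velocity')
  have z: "(\<Sum>n\<in>Nu. fst X n * avg k (\<lambda>x. cross3 e3 (vel X x) \<bullet> vmode k n x)) = 0"
    by (subst avg_inner_velocity[OF cc]) (simp add: dot_cross_self avg_def)
  have "(\<Sum>n\<in>Nu. fst X n * Fu X n) = - P * (\<Sum>n\<in>Nu. ksq k n * (fst X n)\<^sup>2)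
     + P * R * (\<Sum>n\<in>Nu. fst X n * avg k (\<lambda>x. temp X x * vmode k n x $ 3))
     - P * S * (\<Sum>n\<in>Nu. fst X n * avg k (\<lambda>x. cross3 e3 (vel X x) \<bullet> vmode k n x))
     - (\<Sum>n\<in>Nu. fst X n * avg k (\<lambda>x. vadvect (vel X) (vel X) x \<bullet> vmode k n x))"
    by (simp add: Fu_def algebra_simps sum.distrib sum_subtractf sum_distrib_left sum_negf power2_eq_square)
  then show ?thesis
    by (simp add: z avg_mult_velocity_3[OF cont_temperature] avg_inner_velocity[OF cont_vadvect] inertial_energy_zero flux_def mult.commute)
qed

lemma temperature_energy:
  "(\<Sum>n\<in>Nt. snd X n * Ft X n) = - (\<Sum>n\<in>Nt. ksq k n * (snd X n)\<^sup>2) + flux X"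
proof -
  have "(\<Sum>n\<in>Nt. snd X n * Ft X n) = - (\<Sum>n\<in>Nt. ksq k n * (snd X n)\<^sup>2)
     + (\<Sum>n\<in>Nt. snd X n * avg k (\<lambda>x. vel X x $ 3 * fmode k n x))
     - (\<Sum>n\<in>Nt. snd X n * avg k (\<lambda>x. advect (vel X) (temp X) x * fmode k n x))"
    by (simp add: Ft_def algebra_simps sum.distrib sum_subtractf sum_distrib_left sum_negf power2_eq_square)
  then show ?thesis
    by (simp add: avg_mult_temperature[OF cont_velocity] avg_mult_temperature[OF cont_advect_temperature] convective_energy_zero flux_def)
qed

text \<open>Young's inequality with a free parameter: the value 1 suffices for global existence,
  while small values serve \<open>R = 0\<close>, where the temperature part has to be kept
  small.\<close>

lemma flux_bound:
  assumes e: "\<epsilon> > 0"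
  shows "\<bar>flux X\<bar> \<le> (\<Sum>n\<in>Nu. (fst X n)\<^sup>2) / (2 * \<epsilon>) + \<epsilon> / 2 * (\<Sum>n\<in>Nt. (snd X n)\<^sup>2)"
proof -
  let ?u = "vel X" and ?t = "temp X"
  have "0 \<le> (\<Sum>n\<in>Nu. (fst X n)\<^sup>2) / \<epsilon> + \<epsilon> * (\<Sum>n\<in>Nt. (snd X n)\<^sup>2) + s * flux X" if s: "s = 2 \<or> s = -2" for s
  proof -
    have c: "continuous_on UNIV (\<lambda>x. 1 / \<epsilon> * (?u x \<bullet> ?u x))" "continuous_on UNIV (\<lambda>x. \<epsilon> * (?t x * ?t x))"
      "continuous_on UNIV (\<lambda>x. s * (?u x $ 3 * ?t x))"
      by (intro continuous_on_mult_left continuous_on_mult continuous_on_inner cont_velocity' cont_velocity cont_temperature)+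
    have "0 \<le> avg k (\<lambda>x. 1 / \<epsilon> * (?u x \<bullet> ?u x) + \<epsilon> * (?t x * ?t x) + s * (?u x $ 3 * ?t x))"
    proof (rule avg_nonneg)
      fix x
      have "(?u x $ 3)\<^sup>2 \<le> ?u x \<bullet> ?u x"
        unfolding inner_vec_def sum_3 by (simp add: power2_eq_square)
      then have "1 / \<epsilon> * (?u x $ 3)\<^sup>2 \<le> 1 / \<epsilon> * (?u x \<bullet> ?u x)"
        using e by (intro mult_left_mono) auto
      moreover have "1 / \<epsilon> * (?u x $ 3)\<^sup>2 + \<epsilon> * (?t x * ?t x) + s * (?u x $ 3 * ?t x) = 1 / \<epsilon> * (?u x $ 3 + s / 2 * \<epsilon> * ?t x)\<^sup>2"
        using s e by (auto simp: power2_eq_square field_simps)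
      moreover have "1 / \<epsilon> * (?u x $ 3 + s / 2 * \<epsilon> * ?t x)\<^sup>2 \<ge> 0" using e by simp
      ultimately show "0 \<le> 1 / \<epsilon> * (?u x \<bullet> ?u x) + \<epsilon> * (?t x * ?t x) + s * (?u x $ 3 * ?t x)" by linarith
    qed (intro continuous_on_add c)
    also have "\<dots> = 1 / \<epsilon> * (\<Sum>n\<in>Nu. (fst X n)\<^sup>2) + \<epsilon> * (\<Sum>n\<in>Nt. (snd X n)\<^sup>2) + s * flux X"
      unfolding avg_add[OF continuous_on_add[OF c(1,2)] c(3)] avg_add[OF c(1,2)] avg_cmult avg_velocity_sq avg_temperature_sq flux_def ..
    finally show ?thesis by simp
  qed
  from this[of 2] this[of "-2"] show ?thesis using e by (auto simp: abs_if field_simps)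
qed

text \<open>A disjoint sum, because the same index may name a velocity mode and a temperature
  mode.\<close>

definition vf_index :: "(mode + mode) set" where "vf_index = Nu <+> Nt"

definition of_sum :: "(mode + mode \<Rightarrow> real) \<Rightarrow> state" where
  "of_sum z = (\<lambda>n. z (Inl n), \<lambda>n. z (Inr n))"

definition vf :: "(mode + mode \<Rightarrow> real) \<Rightarrow> mode + mode \<Rightarrow> real" where
  "vf z = case_sum (Fu (of_sum z)) (Ft (of_sum z))"

section \<open>The coefficient equations as a polynomial vector field\<close>

lemma avg_temperature_w3:
  "avg k (\<lambda>x. temp X x * vmode k n x $ 3) = (\<Sum>b\<in>Nt. snd X b * avg k (\<lambda>x. vmode k n x $ 3 * fmode k b x))"
  using avg_mult_temperature[OF cont_vmode[of n 3], of X] by (simp add: mult.commute)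

lemma avg_coriolis:
  "avg k (\<lambda>x. cross3 e3 (vel X x) \<bullet> vmode k n x) = (\<Sum>a\<in>Nu. fst X a * avg k (\<lambda>x. cross3 e3 (vmode k a x) \<bullet> vmode k n x))"
proof -
  have "cross3 e3 (vel X x) \<bullet> vmode k n x = (\<Sum>a\<in>Nu. fst X a * (cross3 e3 (vmode k a x) \<bullet> vmode k n x))" for x
  proof -
    have l: "linear (cross3 e3)" using bilinear_cross by (simp add: bilinear_def)
    show ?thesis
      unfolding velocity_def linear_sum[OF l] linear_cmul[OF l] inner_sum_left inner_scaleR_left ..
  qed
  then show ?thesis
    unfolding avg_cmult[symmetric]
    by (simp only:) (intro avg_sum continuous_on_mult_left continuous_on_inner continuous_on_cross continuous_on_const cont_vmode')
qed

text \<open>Expanding the advective integral into a bilinear form with constant entries shows that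
  the field is polynomial. The family \<open>g\<close> covers both temperature modes and velocity
  components.\<close>

lemma avg_advect_sum:
  assumes g: "\<And>b. b \<in> B \<Longrightarrow> sep_sum k (g b)" and h: "continuous_on UNIV h"
  shows "avg k (\<lambda>x. advect (vel X) (\<lambda>x. \<Sum>b\<in>B. d b * g b x) x * h x) =
    (\<Sum>a\<in>Nu. \<Sum>b\<in>B. fst X a * d b * avg k (\<lambda>x. advect (vmode k a) (g b) x * h x))"
proof -
  have c: "b \<in> B \<Longrightarrow> continuous_on UNIV (\<lambda>x. advect (vmode k a) (g b) x * h x)" for a b
    unfolding advect_def
    by (intro continuous_on_sum continuous_on_mult cont_vmode sep_sum_pd_continuous[OF g] h)
  have pdg: "pd j (\<lambda>x. \<Sum>b\<in>B. d b * g b x) x = (\<Sum>b\<in>B. d b * pd j (g b) x)" for j x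
    by (subst pd_sum[of B k]) (simp_all add: sep_sum_cmult g pd_cmult[OF g])
  have "advect (vel X) (\<lambda>x. \<Sum>b\<in>B. d b * g b x) x * h x =
     (\<Sum>a\<in>Nu. \<Sum>b\<in>B. fst X a * d b * (advect (vmode k a) (g b) x * h x))" for x
  proof -
    have "advect (vel X) (\<lambda>x. \<Sum>b\<in>B. d b * g b x) x * h x =
      (\<Sum>j\<in>UNIV. \<Sum>a\<in>Nu. \<Sum>b\<in>B. fst X a * d b * (vmode k a x $ j * pd j (g b) x * h x))"
      unfolding advect_def pdg velocity_component unfolding sum_product unfolding sum_distrib_right
      by (intro sum.cong refl) (simp only: mult_ac)
    also have "\<dots> = (\<Sum>a\<in>Nu. \<Sum>b\<in>B. \<Sum>j\<in>UNIV. fst X a * d b * (vmode k a x $ j * pd j (g b) x * h x))"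
      by (subst sum.swap, rule sum.cong[OF refl], rule sum.swap)
    finally show ?thesis by (simp add: advect_def sum_distrib_left sum_distrib_right)
  qed
  then have "avg k (\<lambda>x. advect (vel X) (\<lambda>x. \<Sum>b\<in>B. d b * g b x) x * h x) =
     avg k (\<lambda>x. \<Sum>a\<in>Nu. \<Sum>b\<in>B. fst X a * d b * (advect (vmode k a) (g b) x * h x))" by simp
  also have "\<dots> = (\<Sum>a\<in>Nu. avg k (\<lambda>x. \<Sum>b\<in>B. fst X a * d b * (advect (vmode k a) (g b) x * h x)))"
    by (intro avg_sum continuous_on_sum continuous_on_mult_left c)
  also have "\<dots> = (\<Sum>a\<in>Nu. \<Sum>b\<in>B. fst X a * d b * avg k (\<lambda>x. advect (vmode k a) (g b) x * h x))"
    unfolding avg_cmult[symmetric] by (intro sum.cong refl avg_sum continuous_on_mult_left c)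
  finally show ?thesis .
qed

lemma avg_vadvect:
  "avg k (\<lambda>x. vadvect (vel X) (vel X) x \<bullet> vmode k n x) = (\<Sum>i\<in>UNIV. \<Sum>a\<in>Nu. \<Sum>b\<in>Nu.
     fst X a * fst X b * avg k (\<lambda>x. advect (vmode k a) (\<lambda>y. vmode k b y $ i) x * vmode k n x $ i))"
proof -
  have "avg k (\<lambda>x. vadvect (vel X) (vel X) x \<bullet> vmode k n x) =
     (\<Sum>i\<in>UNIV. avg k (\<lambda>x. advect (vel X) (\<lambda>y. vel X y $ i) x * vmode k n x $ i))"
    unfolding inner_vec_def inner_real_def vadvect_def vec_lambda_beta
    by (intro avg_sum) (unfold advect_def, intro continuous_intros cont_velocity cont_pd_velocity cont_vmode)
  then show ?thesis
    unfolding velocity_component[abs_def] by (simp only: avg_advect_sum[OF sep_sum_vmode cont_vmode])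
qed

lemma avg_u3:
  "avg k (\<lambda>x. vel X x $ 3 * fmode k n x) = (\<Sum>a\<in>Nu. fst X a * avg k (\<lambda>x. fmode k n x * vmode k a x $ 3))" if "n \<in> Nt"
  using avg_mult_velocity_3[OF cont_fmode_Nt[OF that], of X] by (simp add: mult.commute)

lemma avg_advect:
  assumes n: "n \<in> Nt"
  shows "avg k (\<lambda>x. advect (vel X) (temp X) x * fmode k n x) =
    (\<Sum>a\<in>Nu. \<Sum>b\<in>Nt. fst X a * snd X b * avg k (\<lambda>x. advect (vmode k a) (fmode k b) x * fmode k n x))"
  unfolding temperature_def[abs_def] using Nt by (intro avg_advect_sum sep_sum_fmode cont_fmode_Nt[OF n]) auto

text \<open>Dissipation has the right sign and the cubic terms cancel. The flux is left with weight
  \<open>P * R + 1\<close>, and Young's inequality with parameter 1 halves it.\<close>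

sublocale vf: poly_vf_energy vf_index vf "(P * R + 1) / 2"
proof
  show "finite vf_index" unfolding vf_index_def using fin_u fin_t by simp
  have cu: "n \<in> Nu \<Longrightarrow> polyfun vf_index (\<lambda>z. fst (of_sum z) n)" for n
    unfolding of_sum_def fst_conv by (rule polyfun.coord) (auto simp: vf_index_def)
  have ct: "n \<in> Nt \<Longrightarrow> polyfun vf_index (\<lambda>z. snd (of_sum z) n)" for n
    unfolding of_sum_def snd_conv by (rule polyfun.coord) (auto simp: vf_index_def)
  fix i assume i: "i \<in> vf_index"
  show "polyfun vf_index (\<lambda>z. vf z i)"
  proof (cases i)
    case (Inl n)
    then have "n \<in> Nu" using i by (auto simp: vf_index_def)
    then have "polyfun vf_index (\<lambda>z. Fu (of_sum z) n)"
      unfolding Fu_def avg_temperature_w3 avg_coriolis avg_vadvect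
      by (intro polyfun_diff polyfun.add polyfun.mult polyfun.const polyfun_sum cu ct)
    then show ?thesis by (simp add: vf_def Inl)
  next
    case (Inr n)
    then have n: "n \<in> Nt" using i by (auto simp: vf_index_def)
    then have "polyfun vf_index (\<lambda>z. Ft (of_sum z) n)"
      unfolding Ft_def avg_u3[OF n] avg_advect[OF n]
      by (intro polyfun_diff polyfun.add polyfun.mult polyfun.const polyfun_sum cu ct)
    then show ?thesis by (simp add: vf_def Inr)
  qed
next
  fix z :: "mode + mode \<Rightarrow> real"
  let ?X = "of_sum z"
  have k0: "ksq k n \<ge> 0" for n unfolding ksq_def by (intro sum_nonneg) auto
  have "(\<Sum>i\<in>vf_index. z i * vf z i) = (\<Sum>n\<in>Nu. fst ?X n * Fu ?X n) + (\<Sum>n\<in>Nt. snd ?X n * Ft ?X n)"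
    unfolding vf_index_def using fin_u fin_t by (subst sum.Plus) (auto simp: vf_def of_sum_def)
  also have "\<dots> \<le> (P * R + 1) * flux ?X"
    unfolding velocity_energy temperature_energy using P k0
    by (simp add: algebra_simps sum_nonneg add_nonneg_nonneg)
  also have "\<dots> \<le> (P * R + 1) * ((\<Sum>n\<in>Nu. (fst ?X n)\<^sup>2) / 2 + 1 / 2 * (\<Sum>n\<in>Nt. (snd ?X n)\<^sup>2))"
    using flux_bound[of 1 ?X] P R by (intro mult_left_mono) auto
  also have "\<dots> = (P * R + 1) / 2 * ((\<Sum>n\<in>Nu. (fst ?X n)\<^sup>2) + (\<Sum>n\<in>Nt. (snd ?X n)\<^sup>2))"
    by (simp add: algebra_simps)
  also have "(\<Sum>n\<in>Nu. (fst ?X n)\<^sup>2) + (\<Sum>n\<in>Nt. (snd ?X n)\<^sup>2) = (\<Sum>i\<in>vf_index. (z i)\<^sup>2)"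
    unfolding vf_index_def using fin_u fin_t by (subst sum.Plus) (auto simp: of_sum_def)
  finally show "(\<Sum>i\<in>vf_index. z i * vf z i) \<le> (P * R + 1) / 2 * (\<Sum>i\<in>vf_index. (z i)\<^sup>2)" .
qed

end

section \<open>The potential energy balance\<close>

lemma integral_trig:
  assumes "c > 0" "c * L = 2 * pi"
  shows "integral {0..L} (\<lambda>y. trig m p (c * y)) = (if m = 0 \<and> even p then L else 0)"
proof -
  have 1: "trig 0 0 = (\<lambda>x. 1)" by (auto simp: trig_def)
  show ?thesis
  proof (cases "even p")
    case True
    then show ?thesis using integral_trig_mult[of c L 2 p 0 m 0] assms by (simp add: 1)
  next
    case False
    then show ?thesis using integral_trig_mult_opposite[of c L p 0 m 0] assms by (simp add: 1)
  qed
qed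

text \<open>Up to normalisation these are the sine coefficients of the linear profile. Their decay
  like \<open>1 / m\<close> cancels the factor \<open>m\<close> from differentiating a mode, so all
  selected cosines enter the balance with the same weight.\<close>

lemma integral_linear_sin:
  assumes "c > 0" "c * L = pi" "m > 0"
  shows "integral {0..L} (\<lambda>y. (1 - c * y / pi) * trig m 1 (c * y)) = 1 / (real m * c)"
proof -
  define G where "G y = - (1 - c * y / pi) * cos (real m * (c * y)) / (real m * c) - sin (real m * (c * y)) / (pi * (real m)\<^sup>2 * c)" for y
  have "c * L \<ge> 0" using assms(2) by simp
  then have L: "L \<ge> 0" using assms(1) by (simp add: zero_le_mult_iff)
  have "(G has_real_derivative (1 - c * y / pi) * trig m 1 (c * y)) (at y within T)" for y T
    unfolding G_def using assms by (auto intro!: derivative_eq_intros simp: trig_def power2_eq_square field_simps)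
  then have "((\<lambda>y. (1 - c * y / pi) * trig m 1 (c * y)) has_integral (G L - G 0)) {0..L}"
    using L by (intro fundamental_theorem_of_calculus) (auto simp: has_real_derivative_iff_has_vector_derivative[symmetric])
  moreover have "G L - G 0 = 1 / (real m * c)" using assms by (simp add: G_def)
  ultimately show ?thesis by (simp add: integral_unique)
qed

text \<open>The product is a combination of four cosines, and only those of frequency zero
  contribute. The frequency \<open>m1 + m2 + j\<close> is never zero since \<open>m2\<close> is
  positive.\<close>

lemma integral_sin_sin_cos:
  assumes "c > 0" "c * L = pi" "m2 > 0"
  shows "integral {0..L} (\<lambda>y. trig m1 1 (c * y) * trig m2 1 (c * y) * trig j 0 (c * y)) =
    L / 4 * (of_bool (m1 = m2 + j) + of_bool (m2 = m1 + j) - of_bool (m1 + m2 = j))"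
proof -
  define C where "C i y = cos (of_int i * (c * y))" for i y
  have eq: "trig m1 1 (c * y) * trig m2 1 (c * y) * trig j 0 (c * y) =
     1/4 * (C (int m1 - int m2 - int j) y + C (int m1 - int m2 + int j) y - C (int m1 + int m2 - int j) y - C (int m1 + int m2 + int j) y)" for y
  proof -
    have 1: "of_int (int m1 - int m2 - int j) * (c * y) = real m1 * (c * y) - real m2 * (c * y) - real j * (c * y)"
      "of_int (int m1 - int m2 + int j) * (c * y) = real m1 * (c * y) - real m2 * (c * y) + real j * (c * y)"
      "of_int (int m1 + int m2 - int j) * (c * y) = real m1 * (c * y) + real m2 * (c * y) - real j * (c * y)"
      "of_int (int m1 + int m2 + int j) * (c * y) = real m1 * (c * y) + real m2 * (c * y) + real j * (c * y)"
      by (simp_all add: algebra_simps)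
    show ?thesis unfolding C_def 1 cos_diff cos_add sin_diff sin_add by (simp add: trig_def algebra_simps)
  qed
  have I: "(C i has_integral (if i = 0 then L else 0)) {0..L}" for i
    unfolding C_def using integral_cos_multiple[of c L 1 i] assms by simp
  have "((\<lambda>y. trig m1 1 (c * y) * trig m2 1 (c * y) * trig j 0 (c * y)) has_integral
     1/4 * ((if int m1 - int m2 - int j = 0 then L else 0) + (if int m1 - int m2 + int j = 0 then L else 0)
        - (if int m1 + int m2 - int j = 0 then L else 0) - (if int m1 + int m2 + int j = 0 then L else 0))) {0..L}"
    unfolding eq by (intro has_integral_mult_right has_integral_add has_integral_diff I)
  moreover have "int m1 - int m2 - int j = 0 \<longleftrightarrow> m1 = m2 + j" "int m1 - int m2 + int j = 0 \<longleftrightarrow> m2 = m1 + j"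
    "int m1 + int m2 - int j = 0 \<longleftrightarrow> m1 + m2 = j" "int m1 + int m2 + int j = 0 \<longleftrightarrow> False" using assms by auto
  ultimately show ?thesis by (simp add: integral_unique algebra_simps of_bool_def)
qed

lemma strat_inject: "strat i = strat j \<longleftrightarrow> i = j"
  by (auto simp: strat_def vec_eq_iff forall_3)

lemma strat_in_N_theta_iff: "strat j \<in> N_theta \<longleftrightarrow> j > 0"
  by (simp add: strat_def N_theta_def phases_def)

lemma N_theta_star_eq: "N_theta_star = strat ` {0<..}"
proof
  show "N_theta_star \<subseteq> strat ` {0<..}"
  proof
    fix n assume n: "n \<in> N_theta_star"
    obtain m p c where n': "n = (m, p, c)" by (metis prod_cases3)
    have m: "m$1 = 0" "m$2 = 0" and D: "(m, p, c) \<in> N_theta" using n by (auto simp: N_theta_star_def n')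
    note D' = N_theta_D[OF D]
    have "m = vector [0, 0, m$3]" "p = 0" using m D' by (auto simp: vec_eq_iff forall_3)
    then have "n = strat (m$3)" using D' by (simp add: n' strat_def)
    then show "n \<in> strat ` {0<..}" using D' by auto
  qed
  show "strat ` {0<..} \<subseteq> N_theta_star"
  proof
    fix n assume "n \<in> strat ` {0<..}"
    then obtain j where "n = strat j" "strat j \<in> N_theta" using strat_in_N_theta_iff by auto
    then show "n \<in> N_theta_star" by (simp add: N_theta_star_def strat_def)
  qed
qed

lemma (in wavenumbers) k_prod: "k$1 * k$2 * k$3 = 1"
  using k1 k2 unfolding k3 by (intro right_inverse) simp

section \<open>The derivative of the potential energy\<close>

context truncation
begin

definition strat_set :: "nat set" where "strat_set = {j. strat j \<in> Nt}"

lemma strat_set_pos: "j \<in> strat_set \<Longrightarrow> j > 0"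
  using Nt by (auto simp: strat_set_def simp flip: strat_in_N_theta_iff)

lemma Nt_star: "Nt \<inter> N_theta_star = strat ` strat_set"
proof -
  have "Nt \<inter> strat ` {0<..} = strat ` {j. strat j \<in> Nt}"
    using Nt strat_in_N_theta_iff by blast
  then show ?thesis by (simp add: N_theta_star_eq strat_set_def)
qed

lemma finite_strat_set: "finite strat_set"
proof -
  have "finite (strat ` strat_set)" using fin_t Nt_star by (metis finite_Int)
  then show ?thesis by (rule finite_imageD) (simp add: inj_on_def strat_inject)
qed

definition height_coeff :: "mode \<Rightarrow> real" where
  "height_coeff n = avg k (\<lambda>x. (1 - k$3 * x$3 / pi) * fmode k n x)"

text \<open>A horizontal factor has mean zero unless its frequency vanishes, so the weight,
  depending on height alone, sees only stratified modes.\<close>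

lemma height_coeff_eq:
  assumes "n \<in> N_theta"
  shows "height_coeff n = (if n \<in> N_theta_star then sqrt 2 * (4 * pi\<^sup>2) / (V * real (fst n $ 3)) else 0)"
proof -
  obtain m p c where n: "n = (m, p, c)" by (metis prod_cases3)
  note D = N_theta_D[OF assms[unfolded n]]
  define g where "g j y = (if j = 3 then (1 - k$3 * y / pi) * trig (m$3) 1 (k$3 * y) else trig (m$j) (p$j) (k$j * y))" for j :: 3 and y
  have "height_coeff n = avg k (\<lambda>x. eta m / V * (\<Prod>j\<in>UNIV. g j (x$j)))"
    unfolding height_coeff_def n by (intro arg_cong[of _ _ "avg k"] ext) (simp add: fmode.simps prod_3 g_def)
  also have "\<dots> = eta m / V * (\<Prod>j\<in>UNIV. integral {0..side k j} (g j))"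
    unfolding avg_cmult
  proof (subst avg_prod)
    show "continuous_on UNIV (g i)" for i
      unfolding g_def by (cases "i = 3") (simp_all, intro continuous_intros, simp, intro continuous_intros)
  qed simp
  also have "\<dots> = eta m / V * ((if m$1 = 0 \<and> even (p$1) then side k 1 else 0) *
      (if m$2 = 0 \<and> even (p$2) then side k 2 else 0) * (1 / (real (m$3) * k$3)))"
  proof -
    have "integral {0..side k 1} (g 1) = (if m$1 = 0 \<and> even (p$1) then side k 1 else 0)"
      "integral {0..side k 2} (g 2) = (if m$2 = 0 \<and> even (p$2) then side k 2 else 0)"
      using integral_trig[of "k$1" "side k 1"] integral_trig[of "k$2" "side k 2"] k_pos
      by (simp_all add: g_def[abs_def] k_side)
    moreover have "integral {0..side k 3} (g 3) = 1 / (real (m$3) * k$3)"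
      using integral_linear_sin[of "k$3" "side k 3" "m$3"] k_pos D by (simp add: g_def[abs_def] k_side)
    ultimately show ?thesis by (simp add: prod_3)
  qed
  also have "\<dots> = (if n \<in> N_theta_star then sqrt 2 * (4 * pi\<^sup>2) / (V * real (fst n $ 3)) else 0)"
  proof (cases "m$1 = 0 \<and> m$2 = 0")
    case True
    then have st: "n \<in> N_theta_star" using assms by (simp add: N_theta_star_def n)
    have "eta m = sqrt 2" using True D by (simp add: eta_def prod_3 iota_def)
    moreover have "side k 1 * side k 2 / k$3 = 4 * pi\<^sup>2 / (k$1 * k$2 * k$3)"
      by (simp add: side_def power2_eq_square)
    then have "side k 1 * side k 2 * (1 / (real (m$3) * k$3)) = 4 * pi\<^sup>2 / real (m$3)"
      unfolding k_prod by (simp add: mult.commute[of _ "k$3"] flip: divide_divide_eq_left)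
    moreover have "p$1 = 0" "p$2 = 0" using True D by auto
    ultimately show ?thesis using True st by (simp add: n)
  next
    case False
    then have "n \<notin> N_theta_star" by (auto simp: N_theta_star_def n)
    with False show ?thesis by auto
  qed
  finally show ?thesis .
qed

definition cosz :: "nat \<Rightarrow> real^3 \<Rightarrow> real" where
  "cosz j x = trig j 0 (k$3 * x$3)"

lemma cont_cosz: "continuous_on UNIV (cosz j)"
  unfolding cosz_def[abs_def] by (intro continuous_intros)

lemma pd_fmode_strat:
  "pd i (fmode k (strat j)) x = (if i = 3 then sqrt 2 ^ iota j / V * (k$3 * real j) * cosz j x else 0)"
proof -
  let ?m = "vector [0, 0, j] :: nat^3"
  have f: "fmode k (strat j) = (\<lambda>x. eta ?m / V * trig_prod k ?m (\<lambda>j. (0::nat^3)$j + kdelta 3 j) x)"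
    unfolding strat_def by (intro ext fmode_eq) simp
  have "pd i (fmode k (strat j)) x = eta ?m / V * pd i (trig_prod k ?m (\<lambda>j. (0::nat^3)$j + kdelta 3 j)) x"
    unfolding f by (rule pd_cmult[OF sep_sum_trig_prod])
  moreover have "eta ?m = sqrt 2 ^ iota j" by (simp add: eta_def prod_3 iota_def)
  moreover have "i = 1 \<or> i = 2 \<or> i = 3" by (rule exhaust_3)
  moreover have "trig 0 0 y = 1" "trig j (Suc (Suc 0)) y = trig j 0 y" for y by (simp_all add: trig_def)
  ultimately show ?thesis
    by (auto simp: pd_trig_prod trig_prod_def prod_3 kdelta_def cosz_def)
qed

definition cos_flux :: "nat \<Rightarrow> state \<Rightarrow> real" where
  "cos_flux j X = avg k (\<lambda>x. vel X x $ 3 * temp X x * cosz j x)"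

text \<open>Multiplied by \<open>k$3 / pi\<close>, it is the actual derivative of the potential
  energy minus the one claimed by the balance.\<close>

definition balance_defect :: "state \<Rightarrow> real" where
  "balance_defect X = flux X + 2 * (\<Sum>j\<in>strat_set. cos_flux j X)"

text \<open>A velocity mode without horizontal frequencies has no vertical component, and all others
  are orthogonal to functions of height alone. Hence the forcing by \<open>u\<^sub>3\<close> does
  not reach the stratified temperature modes.\<close>

lemma avg_vmode_strat_zero:
  assumes "a \<in> Nu" "j > 0"
  shows "avg k (\<lambda>x. fmode k (strat j) x * vmode k a x $ 3) = 0"
proof -
  obtain m p c where a: "a = (m, p, c)" by (metis prod_cases3)
  note D = N_u_D[of m p c]
  have aN: "(m, p, c) \<in> N_u" using assms Nu a by auto
  let ?m = "vector [0, 0, j] :: nat^3"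
  have f: "fmode k (strat j) x = eta ?m / V * trig_prod k ?m (\<lambda>j. (0::nat^3)$j + kdelta 3 j) x" for x
    unfolding strat_def by (intro fmode_eq) simp
  have "avg k (\<lambda>x. fmode k (strat j) x * vmode k a x $ 3) = eta ?m / V * vcoeff k a 3 *
     avg k (\<lambda>x. trig_prod k ?m (\<lambda>j. (0::nat^3)$j + kdelta 3 j) x * trig_prod k m (\<lambda>j. p$j + kdelta 3 j) x)"
    unfolding avg_cmult[symmetric] f a vmode_component by (simp only: mult_ac)
  also have "\<dots> = 0"
  proof (cases "?m = m")
    case True
    then have "m$1 = 0" "m$2 = 0" by auto
    then have "c = 1" using D(4)[OF aN] by (metis less_numeral_extra(3))
    then have "vcoeff k a 3 = 0" using gdiag_1(3)[of c k m p] \<open>m$1 = 0\<close> \<open>m$2 = 0\<close> by (simp add: a vcoeff_def)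
    then show ?thesis by simp
  next
    case False
    then show ?thesis using D(1)[OF aN] by (subst avg_trig_prod_different) (auto simp: kdelta_def)
  qed
  finally show ?thesis .
qed

text \<open>Weak incompressibility applied to the product of temperature and mode moves the
  derivative onto the mode. As the mode depends on height only, just its vertical derivative times
  \<open>u\<^sub>3 \<theta>\<close> is left.\<close>

lemma avg_advect_strat:
  assumes j: "strat j \<in> Nt"
  shows "avg k (\<lambda>x. advect (vel X) (temp X) x * fmode k (strat j) x) =
    - (sqrt 2 / V * (k$3 * real j)) * cos_flux j X"
proof -
  let ?u = "vel X" and ?t = "temp X" and ?f = "fmode k (strat j)"
  have jpos: "j > 0" using j Nt strat_in_N_theta_iff by auto
  have f: "sep_sum k ?f" using j Nt by (intro sep_sum_fmode) auto
  have e: "advect ?u (\<lambda>x. ?t x * ?f x) x = advect ?u ?t x * ?f x + (sqrt 2 / V * (k$3 * real j)) * (?u x $ 3 * ?t x * cosz j x)" for x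
    using jpos unfolding advect_def pd_mult[OF sep_sum_temperature f] pd_fmode_strat sum_3
    by (simp add: algebra_simps iota_def)
  have "0 = avg k (advect ?u (\<lambda>x. ?t x * ?f x))"
    by (rule avg_advect_velocity[symmetric]) (intro sep_sum_mult sep_sum_temperature f)
  also have "\<dots> = avg k (\<lambda>x. advect ?u ?t x * ?f x + (sqrt 2 / V * (k$3 * real j)) * (?u x $ 3 * ?t x * cosz j x))"
    by (rule arg_cong[of _ _ "avg k"]) (rule ext, rule e)
  also have "\<dots> = avg k (\<lambda>x. advect ?u ?t x * ?f x) + (sqrt 2 / V * (k$3 * real j)) * cos_flux j X"
    unfolding cos_flux_def avg_cmult[symmetric]
    by (intro avg_add continuous_on_mult continuous_on_const cont_advect_temperature cont_velocity cont_temperature cont_cosz sep_sum_continuous[OF f])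
  finally show ?thesis by simp
qed

lemma sum_height_coeff: "(\<Sum>n\<in>Nt. height_coeff n * g n) = (\<Sum>j\<in>strat_set. height_coeff (strat j) * g (strat j))"
proof -
  have "(\<Sum>n\<in>Nt. height_coeff n * g n) = (\<Sum>n\<in>Nt \<inter> N_theta_star. height_coeff n * g n)"
  proof (rule sum.mono_neutral_right)
    show "\<forall>n\<in>Nt - Nt \<inter> N_theta_star. height_coeff n * g n = 0"
    proof
      fix n assume "n \<in> Nt - Nt \<inter> N_theta_star"
      then have "n \<in> N_theta" "n \<notin> N_theta_star" using Nt by auto
      then show "height_coeff n * g n = 0" by (simp only: height_coeff_eq) simp
    qed
  qed (use fin_t in auto)
  also have "\<dots> = (\<Sum>j\<in>strat_set. height_coeff (strat j) * g (strat j))"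
    unfolding Nt_star by (subst sum.reindex) (auto simp: inj_on_def strat_inject)
  finally show ?thesis .
qed

lemma ksq_strat: "ksq k (strat j) = (k$3 * real j)\<^sup>2"
  by (simp add: ksq_def strat_def sum_3)

lemma height_coeff_Ft:
  "(\<Sum>n\<in>Nt. height_coeff n * Ft X n) =
     - (\<Sum>n\<in>Nt. height_coeff n * (ksq k n * snd X n)) + 2 * k$3 / pi * (\<Sum>j\<in>strat_set. cos_flux j X)"
proof -
  have "height_coeff (strat j) * Ft X (strat j) =
     - (height_coeff (strat j) * (ksq k (strat j) * snd X (strat j))) + 2 * k$3 / pi * cos_flux j X" if "j \<in> strat_set" for j
  proof -
    have j: "strat j \<in> Nt" "j > 0" using that strat_set_pos by (auto simp: strat_set_def)
    have st: "strat j \<in> N_theta_star" using j(2) by (simp add: N_theta_star_eq)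
    have z: "avg k (\<lambda>x. vel X x $ 3 * fmode k (strat j) x) = 0"
      unfolding avg_u3[OF j(1)] by (intro sum.neutral ballI) (simp add: avg_vmode_strat_zero j)
    have "strat j \<in> N_theta" using j Nt by blast
    then have h: "height_coeff (strat j) = sqrt 2 * (4 * pi\<^sup>2) / (V * real j)"
      using st by (simp only: height_coeff_eq) (simp add: strat_def)
    have "height_coeff (strat j) * (sqrt 2 / V * (k$3 * real j)) = (sqrt 2 * sqrt 2) * 4 * pi\<^sup>2 * k$3 / V\<^sup>2"
      unfolding h power2_eq_square using V_pos j(2) by (simp add: field_simps)
    also have "\<dots> = 2 * 4 * pi\<^sup>2 * k$3 / V\<^sup>2" by (simp only: real_sqrt_mult_self abs_numeral)
    also have "\<dots> = 2 * k$3 / pi" unfolding V_sq by (simp add: power2_eq_square power3_eq_cube)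
    finally have h: "height_coeff (strat j) * (sqrt 2 / V * (k$3 * real j)) = 2 * k$3 / pi" .
    have "height_coeff (strat j) * Ft X (strat j) =
      - (height_coeff (strat j) * (ksq k (strat j) * snd X (strat j))) + height_coeff (strat j) * (sqrt 2 / V * (k$3 * real j)) * cos_flux j X"
      unfolding Ft_def z avg_advect_strat[OF j(1)] by (simp add: algebra_simps)
    then show ?thesis unfolding h .
  qed
  then show ?thesis
    unfolding sum_height_coeff by (simp add: sum.distrib sum_negf sum_subtractf sum_distrib_left)
qed

lemma avg_height_temperature:
  "avg k (\<lambda>x. (1 - k$3 * x$3 / pi) * temp X x) = (\<Sum>n\<in>Nt. snd X n * height_coeff n)"
  unfolding height_coeff_def
  by (rule avg_mult_temperature[symmetric]) (intro continuous_intros, simp)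

lemma avg_height_pd_temperature:
  "avg k (\<lambda>x. (1 - k$3 * x$3 / pi) * pd 3 (pd 3 (temp X)) x) = - (\<Sum>n\<in>Nt. height_coeff n * (ksq k n * snd X n))"
proof -
  have c: "continuous_on UNIV (\<lambda>x::real^3. 1 - k$3 * x$3 / pi)" by (intro continuous_intros) simp
  have "avg k (\<lambda>x. (1 - k$3 * x$3 / pi) * pd 3 (pd 3 (temp X)) x) =
     avg k (\<lambda>x. \<Sum>n\<in>Nt. (- (k$3 * real (fst n $ 3))\<^sup>2 * snd X n) * ((1 - k$3 * x$3 / pi) * fmode k n x))"
    unfolding pd_pd_temperature sum_distrib_left by (intro arg_cong[of _ _ "avg k"] ext sum.cong refl) (simp only: mult_ac)
  also have "\<dots> = (\<Sum>n\<in>Nt. (- (k$3 * real (fst n $ 3))\<^sup>2 * snd X n) * height_coeff n)"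
    unfolding height_coeff_def avg_cmult[symmetric] by (intro avg_sum continuous_on_mult continuous_on_const c cont_fmode_Nt)
  also have "\<dots> = (\<Sum>n\<in>Nt. height_coeff n * (- (k$3 * real (fst n $ 3))\<^sup>2 * snd X n))"
    by (simp only: mult.commute)
  \<comment> \<open>Only stratified modes have a nonzero height coefficient, and for them the second
    vertical derivative is the whole Laplacian.\<close>
  also have "\<dots> = (\<Sum>n\<in>Nt. height_coeff n * (- (ksq k n * snd X n)))"
    unfolding sum_height_coeff ksq_strat by (simp add: strat_def)
  finally show ?thesis by (simp add: sum_negf)
qed

text \<open>Along a solution the potential energy always has a derivative, so by uniqueness of
  derivatives the balance becomes an algebraic condition on the state at each time.\<close>

lemma energy_balance_iff:
  assumes sol: "is_sol X"
  shows "energy_balance k Nu Nt X \<longleftrightarrow> (\<forall>t\<ge>0. balance_defect (X t) = 0)"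
proof -
  have "((\<lambda>s. avg k (\<lambda>x. (1 - k$3 * x$3 / pi) * temp (X s) x)) has_real_derivative
      (avg k (\<lambda>x. (1 - k$3 * x$3 / pi) * pd 3 (pd 3 (temp (X t))) x)
       - k$3 / pi * avg k (\<lambda>x. vel (X t) x $ 3 * temp (X t) x))) (at t within {0..})
     \<longleftrightarrow> balance_defect (X t) = 0" (is "(?f has_real_derivative ?d) _ \<longleftrightarrow> _") if t: "t \<ge> 0" for t
  proof -
    have "((\<lambda>s. \<Sum>n\<in>Nt. snd (X s) n * height_coeff n) has_real_derivative (\<Sum>n\<in>Nt. Ft (X t) n * height_coeff n)) (at t within {0..})"
      using sol t unfolding solution_iff by (intro DERIV_sum) (auto intro!: derivative_eq_intros)
    then have "(?f has_real_derivative (\<Sum>n\<in>Nt. height_coeff n * Ft (X t) n)) (at t within {0..})"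
      unfolding avg_height_temperature by (simp add: mult.commute)
    then have f: "(?f has_vector_derivative (\<Sum>n\<in>Nt. height_coeff n * Ft (X t) n)) (at t within {0..})"
      by (simp add: has_real_derivative_iff_has_vector_derivative)
    have "(?f has_real_derivative ?d) (at t within {0..}) \<longleftrightarrow> ?d = (\<Sum>n\<in>Nt. height_coeff n * Ft (X t) n)"
    proof
      assume "(?f has_real_derivative ?d) (at t within {0..})"
      then have "(?f has_vector_derivative ?d) (at t within {0..})"
        by (simp add: has_real_derivative_iff_has_vector_derivative)
      from vector_derivative_unique_within[OF at_ge_nontrivial[OF t] this f]
      show "?d = (\<Sum>n\<in>Nt. height_coeff n * Ft (X t) n)" .
    next
      assume "?d = (\<Sum>n\<in>Nt. height_coeff n * Ft (X t) n)"
      with f show "(?f has_real_derivative ?d) (at t within {0..})"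
        by (simp only: has_real_derivative_iff_has_vector_derivative)
    qed
    also have "\<dots> \<longleftrightarrow> - (k$3 / pi * flux (X t)) = 2 * k$3 / pi * (\<Sum>j\<in>strat_set. cos_flux j (X t))"
      unfolding avg_height_pd_temperature height_coeff_Ft flux_def by linarith
    also have "\<dots> \<longleftrightarrow> k$3 / pi * balance_defect (X t) = 0"
    proof -
      have "k$3 / pi * balance_defect (X t) = k$3 / pi * flux (X t) + 2 * k$3 / pi * (\<Sum>j\<in>strat_set. cos_flux j (X t))"
        by (simp add: balance_defect_def distrib_left)
      then show ?thesis by linarith
    qed
    also have "\<dots> \<longleftrightarrow> balance_defect (X t) = 0" by simp
    finally show ?thesis .
  qed
  then show ?thesis unfolding energy_balance_def by blast
qed

section \<open>The defect as a bilinear form, and the criterion\<close>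

definition interaction :: "nat \<Rightarrow> mode \<Rightarrow> mode \<Rightarrow> real" where
  "interaction j a b = avg k (\<lambda>x. vmode k a x $ 3 * fmode k b x * cosz j x)"

lemma cos_flux_eq: "cos_flux j X = (\<Sum>a\<in>Nu. \<Sum>b\<in>Nt. fst X a * snd X b * interaction j a b)"
proof -
  have "cos_flux j X = avg k (\<lambda>x. \<Sum>a\<in>Nu. \<Sum>b\<in>Nt. fst X a * snd X b * (vmode k a x $ 3 * fmode k b x * cosz j x))"
    unfolding cos_flux_def velocity_component temperature_def sum_product unfolding sum_distrib_right
    by (intro arg_cong[of _ _ "avg k"] ext sum.cong refl) (simp only: mult_ac)
  also have "\<dots> = (\<Sum>a\<in>Nu. avg k (\<lambda>x. \<Sum>b\<in>Nt. fst X a * snd X b * (vmode k a x $ 3 * fmode k b x * cosz j x)))"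
    by (intro avg_sum continuous_on_sum continuous_on_mult continuous_on_const cont_vmode cont_fmode_Nt cont_cosz)
  also have "\<dots> = (\<Sum>a\<in>Nu. \<Sum>b\<in>Nt. fst X a * snd X b * interaction j a b)"
    unfolding interaction_def avg_cmult[symmetric]
    by (intro sum.cong refl avg_sum continuous_on_mult continuous_on_const cont_vmode cont_fmode_Nt cont_cosz)
  finally show ?thesis .
qed

lemma flux_eq_cos_flux: "flux X = cos_flux 0 X"
  by (simp add: flux_def cos_flux_def cosz_def trig_def)

definition total_interaction :: "mode \<Rightarrow> mode \<Rightarrow> real" where
  "total_interaction a b = interaction 0 a b + 2 * (\<Sum>j\<in>strat_set. interaction j a b)"

lemma balance_defect_eq: "balance_defect X = (\<Sum>a\<in>Nu. \<Sum>b\<in>Nt. fst X a * snd X b * total_interaction a b)"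
proof -
  have "(\<Sum>j\<in>strat_set. cos_flux j X) = (\<Sum>a\<in>Nu. \<Sum>b\<in>Nt. \<Sum>j\<in>strat_set. fst X a * snd X b * interaction j a b)"
    unfolding cos_flux_eq by (subst sum.swap, rule sum.cong[OF refl], rule sum.swap)
  then show ?thesis
    unfolding balance_defect_def flux_eq_cos_flux cos_flux_eq total_interaction_def
    by (simp add: sum_distrib_left sum.distrib distrib_left mult_ac)
qed


definition horizontal :: "3 \<Rightarrow> mode \<Rightarrow> mode \<Rightarrow> real" where
  "horizontal i a b = integral {0..side k i} (\<lambda>y.
     trig (fst a $ i) (fst (snd a) $ i) (k$i * y) * trig (fst b $ i) (fst (snd b) $ i) (k$i * y))"

lemma interaction_eq:
  assumes a: "(m', p', c') \<in> N_u" and b: "(m, p, c) \<in> N_theta"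
  shows "interaction j (m', p', c') (m, p, c) =
    vcoeff k (m', p', c') 3 * (eta m / V) *
    horizontal 1 (m', p', c') (m, p, c) *
    horizontal 2 (m', p', c') (m, p, c) *
    (side k 3 / 4 * (of_bool (m'$3 = m$3 + j) + of_bool (m$3 = m'$3 + j) - of_bool (m'$3 + m$3 = j)))"
proof -
  note D = N_u_D[OF a] and D' = N_theta_D[OF b]
  define g where "g i y = trig (m'$i) (p'$i + kdelta 3 i) (k$i * y) * trig (m$i) (p$i + kdelta 3 i) (k$i * y) *
      (if i = 3 then trig j 0 (k$3 * y) else 1)" for i :: 3 and y
  have "interaction j (m', p', c') (m, p, c) = avg k (\<lambda>x. vcoeff k (m', p', c') 3 * (eta m / V) * (\<Prod>i\<in>UNIV. g i (x$i)))"
    unfolding interaction_def cosz_def vmode_component fmode_eq[OF D'(1)] trig_prod_def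
    by (intro arg_cong[of _ _ "avg k"] ext) (simp add: prod_3 g_def)
  also have "\<dots> = vcoeff k (m', p', c') 3 * (eta m / V) * (\<Prod>i\<in>UNIV. integral {0..side k i} (g i))"
    unfolding avg_cmult
  proof (subst avg_prod)
    show "continuous_on UNIV (g i)" for i
      unfolding g_def by (cases "i = 3") (simp_all, (intro continuous_intros)+)
  qed simp
  finally have "interaction j (m', p', c') (m, p, c) =
    vcoeff k (m', p', c') 3 * (eta m / V) * (\<Prod>i\<in>UNIV. integral {0..side k i} (g i))" .
  moreover have "integral {0..side k 3} (g 3) =
      side k 3 / 4 * (of_bool (m'$3 = m$3 + j) + of_bool (m$3 = m'$3 + j) - of_bool (m'$3 + m$3 = j))"
    using integral_sin_sin_cos[of "k$3" "side k 3" "m$3" "m'$3" j] k_pos D D'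
    by (simp add: g_def[abs_def] kdelta_def k_side)
  moreover have "g 1 = (\<lambda>y. trig (m'$1) (p'$1) (k$1 * y) * trig (m$1) (p$1) (k$1 * y))"
    "g 2 = (\<lambda>y. trig (m'$2) (p'$2) (k$2 * y) * trig (m$2) (p$2) (k$2 * y))"
    by (simp_all add: g_def[abs_def] kdelta_def)
  ultimately show ?thesis by (simp only: prod_3 mult.assoc horizontal_def fst_conv snd_conv)
qed

text \<open>Frequency 0 matches the difference of equal vertical frequencies twice, whereas a
  positive \<open>j\<close> matches a difference at most once. This compensates the weights 1 and 2
  and leaves three indicators with equal weight.\<close>

lemma total_interaction_eq:
  assumes a: "(m', p', c') \<in> N_u" and b: "(m, p, c) \<in> N_theta"
  shows "total_interaction (m', p', c') (m, p, c) =
    vcoeff k (m', p', c') 3 * (eta m / V) *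
    horizontal 1 (m', p', c') (m, p, c) *
    horizontal 2 (m', p', c') (m, p, c) * (side k 3 / 2) *
    (of_bool (m'$3 = m$3) + of_bool (nat \<bar>int (m'$3) - int (m$3)\<bar> \<in> strat_set) - of_bool (m'$3 + m$3 \<in> strat_set))"
proof -
  define A where "A = vcoeff k (m', p', c') 3 * (eta m / V) *
    horizontal 1 (m', p', c') (m, p, c) *
    horizontal 2 (m', p', c') (m, p, c)"
  define d where "d = nat \<bar>int (m'$3) - int (m$3)\<bar>"
  have i: "interaction j (m', p', c') (m, p, c) =
     A * (side k 3 / 4 * (of_bool (m'$3 = m$3 + j) + of_bool (m$3 = m'$3 + j) - of_bool (m'$3 + m$3 = j)))" for j
    unfolding interaction_eq[OF a b] A_def ..
  have pos: "m$3 > 0" using N_theta_D[OF b] by simp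
  have "(\<Sum>j\<in>strat_set. interaction j (m', p', c') (m, p, c)) =
     (\<Sum>j\<in>strat_set. A * (side k 3 / 4) * (of_bool (j = d) - of_bool (j = m'$3 + m$3)))"
  proof (rule sum.cong)
    fix j assume "j \<in> strat_set"
    then have "j > 0" by (rule strat_set_pos)
    then have "of_bool (m'$3 = m$3 + j) + of_bool (m$3 = m'$3 + j) = (of_bool (j = d) :: real)"
      by (auto simp: d_def of_bool_def)
    then show "interaction j (m', p', c') (m, p, c) = A * (side k 3 / 4) * (of_bool (j = d) - of_bool (j = m'$3 + m$3))"
      unfolding i by (auto simp: eq_commute[of j])
  qed simp
  also have "\<dots> = A * (side k 3 / 4) * (of_bool (d \<in> strat_set) - of_bool (m'$3 + m$3 \<in> strat_set))"
    unfolding sum_distrib_left[symmetric] sum_subtractf using finite_strat_set by (simp add: of_bool_def)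
  moreover have "interaction 0 (m', p', c') (m, p, c) = A * (side k 3 / 4) * (2 * of_bool (m'$3 = m$3))"
    unfolding i using pos by (auto simp: of_bool_def)
  ultimately show ?thesis
    unfolding total_interaction_def A_def[symmetric] d_def[symmetric] by (simp add: algebra_simps)
qed

text \<open>The side condition of the criterion is exactly that the vertical amplitude does not
  vanish: for \<open>c = 1\<close> it is proportional to
  \<open>k$2 * real (m$2) - k$1 * real (m$1)\<close>, and for \<open>c = 2\<close> to a negative
  number.\<close>

lemma vcoeff_3_nonzero_iff:
  assumes a: "(m, p, c) \<in> N_u"
  shows "vcoeff k (m, p, c) 3 \<noteq> 0 \<longleftrightarrow> (m$1, m$2) \<noteq> (0, 0) \<and> (k$1 * real (m$1) \<noteq> k$2 * real (m$2) \<or> c = 2)"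
proof -
  note D = N_u_D[OF a]
  have "eta m \<noteq> 0" by (simp add: eta_def)
  then have "vcoeff k (m, p, c) 3 \<noteq> 0 \<longleftrightarrow> gdiag k (m, p, c) $ 3 \<noteq> 0"
    using mode_amplitude_nonzero[OF a] V_pos by (simp add: vcoeff_def sgnp_def)
  also have "\<dots> \<longleftrightarrow> (m$1, m$2) \<noteq> (0, 0) \<and> (k$1 * real (m$1) \<noteq> k$2 * real (m$2) \<or> c = 2)"
  proof (cases "c = 1")
    case True
    then show ?thesis unfolding gdiag_1(3)[OF True] by auto
  next
    case False
    then have c: "c = 2" and m: "\<And>i. m$i > 0" using D(4) by auto
    have pos: "k$j * real (m$j) > 0" for j using m[of j] k_pos[of j] by simp
    have "A\<^sup>2 + B\<^sup>2 + D * (A + B) > 0" if "A > 0" "B > 0" "D > 0" for A B D :: real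
      using that by (simp add: add_pos_pos)
    from this[OF pos[of 1] pos[of 2] pos[of 3]] have "(k$1 * real (m$1))\<^sup>2 + (k$2 * real (m$2))\<^sup>2 + k$3 * real (m$3) * (k$1 * real (m$1) + k$2 * real (m$2)) > 0" .
    then show ?thesis unfolding gdiag_2[OF c] using c m[of 1] by simp
  qed
  finally show ?thesis .
qed

text \<open>A matching pair integrates to zero only if it is the sine of frequency zero, which the
  second hypothesis excludes on the temperature side. On the velocity side it may occur, but then it
  matches nothing.\<close>

lemma horizontal_integral_nonzero_iff:
  assumes "i \<noteq> 3" "m = 0 \<longrightarrow> even p"
  shows "integral {0..side k i} (\<lambda>y. trig m' p' (k$i * y) * trig m p (k$i * y)) \<noteq> 0 \<longleftrightarrow> m' = m \<and> even p' = even p"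
proof (cases "even p' = even p")
  case True
  have "k$i * side k i = pi * real 2" using assms(1) by (simp add: k_side)
  from integral_trig_mult[OF k_pos this _ True, of m' m]
  have I: "integral {0..side k i} (\<lambda>y. trig m' p' (k$i * y) * trig m p (k$i * y)) =
      side k i / 2 * (of_bool (m' = m) + (-1) ^ p' * of_bool (m' = 0 \<and> m = 0))" by simp
  show ?thesis
  proof (cases "m' = m")
    case mm: True
    show ?thesis unfolding I using side_pos[of i] assms(2) True mm by (cases "m = 0") auto
  next
    case False
    then show ?thesis unfolding I by auto
  qed
next
  case False
  have "k$i * side k i = 2 * pi" using assms(1) by (simp add: k_side)
  from integral_trig_mult_opposite[OF k_pos this False] show ?thesis using False by simp
qed

text \<open>The bracket in \<open>total_interaction_eq\<close> is \<open>1 - s\<close> for equal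
  vertical frequencies, as 0 is never a stratified frequency, and \<open>d - s\<close> otherwise. It
  vanishes iff the sum is selected in the first case, and iff sum and difference are selected
  together or not at all in the second.\<close>

theorem criterion_iff:
  "energy_balance_criterion k Nu Nt \<longleftrightarrow> (\<forall>a\<in>Nu. \<forall>b\<in>Nt. total_interaction a b = 0)"
proof -
  define C :: "nat^3 \<Rightarrow> nat^3 \<Rightarrow> nat \<Rightarrow> nat^3 \<Rightarrow> nat^3 \<Rightarrow> nat \<Rightarrow> bool" where "C m' p' c' m'' p'' c'' \<longleftrightarrow>
      ((m'$1, m'$2) = (m''$1, m''$2) \<and> (m'$1, m'$2) \<noteq> (0, 0) \<and> p' = p''
        \<and> (k$1 * real (m'$1) \<noteq> k$2 * real (m'$2) \<or> c' = 2)
      \<longrightarrow>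
        (let np = strat (m'$3 + m''$3); nm = strat (nat \<bar>int (m'$3) - int (m''$3)\<bar>) in
           (m'$3 = m''$3 \<longrightarrow> np \<in> Nt)
         \<and> (m'$3 \<noteq> m''$3 \<longrightarrow> (np \<in> Nt \<and> nm \<in> Nt) \<or> (np \<notin> Nt \<and> nm \<notin> Nt))))"
    for m' p' c' m'' p'' c''
  have "C m' p' c' m'' p'' c'' \<longleftrightarrow> total_interaction (m', p', c') (m'', p'', c'') = 0"
    if "(m', p', c') \<in> Nu" "(m'', p'', c'') \<in> Nt" for m' p' c' m'' p'' c''
  proof -
    have a: "(m', p', c') \<in> N_u" and b: "(m'', p'', c'') \<in> N_theta" using that Nu Nt by auto
    note D = N_u_D[OF a] and D' = N_theta_D[OF b]
    define s where "s \<longleftrightarrow> m'$3 + m''$3 \<in> strat_set"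
    define d where "d \<longleftrightarrow> nat \<bar>int (m'$3) - int (m''$3)\<bar> \<in> strat_set"
    have d0: "\<not> d" if "m'$3 = m''$3" using that strat_set_pos by (auto simp: d_def)
    have p: "even (p'$1) = even (p''$1) \<and> even (p'$2) = even (p''$2) \<longleftrightarrow> p' = p''"
    proof
      assume *: "even (p'$1) = even (p''$1) \<and> even (p'$2) = even (p''$2)"
      have "even (p'$j) = even (p''$j)" for j
        using * D(1) D'(1) exhaust_3[of j] by auto
      then show "p' = p''" using D D' by (intro phase_eqI)
    qed simp
    have eta: "eta m'' \<noteq> 0" by (simp add: eta_def)
    have e1: "m''$1 = 0 \<longrightarrow> even (p''$1)" and e2: "m''$2 = 0 \<longrightarrow> even (p''$2)" using D' by auto
    have "total_interaction (m', p', c') (m'', p'', c'') = 0 \<longleftrightarrow>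
       \<not> (vcoeff k (m', p', c') 3 \<noteq> 0 \<and> (m'$1 = m''$1 \<and> even (p'$1) = even (p''$1)) \<and> (m'$2 = m''$2 \<and> even (p'$2) = even (p''$2)))
       \<or> of_bool (m'$3 = m''$3) + of_bool d - of_bool s = (0::real)"
      unfolding total_interaction_eq[OF a b] horizontal_def fst_conv snd_conv s_def[symmetric] d_def[symmetric]
        horizontal_integral_nonzero_iff[of 1, OF _ e1, symmetric, simplified]
        horizontal_integral_nonzero_iff[of 2, OF _ e2, symmetric, simplified]
      using eta V_pos side_pos[of 3] by auto
    also have "of_bool (m'$3 = m''$3) + of_bool d - of_bool s = (0::real) \<longleftrightarrow>
        (m'$3 = m''$3 \<longrightarrow> s) \<and> (m'$3 \<noteq> m''$3 \<longrightarrow> (s \<and> d) \<or> (\<not> s \<and> \<not> d))"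
      using d0 by (auto simp: of_bool_def)
    also have "(\<not> (vcoeff k (m', p', c') 3 \<noteq> 0 \<and> (m'$1 = m''$1 \<and> even (p'$1) = even (p''$1)) \<and> (m'$2 = m''$2 \<and> even (p'$2) = even (p''$2)))
        \<or> (m'$3 = m''$3 \<longrightarrow> s) \<and> (m'$3 \<noteq> m''$3 \<longrightarrow> (s \<and> d) \<or> (\<not> s \<and> \<not> d))) \<longleftrightarrow> C m' p' c' m'' p'' c''"
      unfolding C_def vcoeff_3_nonzero_iff[OF a] Let_def s_def d_def strat_set_def mem_Collect_eq
      using p by auto
    finally show ?thesis by simp
  qed
  then have "(\<forall>a\<in>Nu. \<forall>b\<in>Nt. total_interaction a b = 0) \<longleftrightarrow>
     (\<forall>m' p' c' m'' p'' c''. (m', p', c') \<in> Nu \<and> (m'', p'', c'') \<in> Nt \<longrightarrow> C m' p' c' m'' p'' c'')"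
    by (metis prod_cases3)
  then show ?thesis unfolding energy_balance_criterion_def C_def by (simp add: imp_conjL conj_assoc)
qed

section \<open>Existence, uniqueness and the solution semiflow\<close>

lemma states_zero:
  assumes "X \<in> states Nu Nt"
  shows "n \<notin> Nu \<Longrightarrow> fst X n = 0" "n \<notin> Nt \<Longrightarrow> snd X n = 0"
  using assms unfolding states_def mem_Collect_eq case_prod_beta by blast+

definition to_sum :: "state \<Rightarrow> mode + mode \<Rightarrow> real" where
  "to_sum X = case_sum (fst X) (snd X)"

lemma of_sum_to_sum [simp]: "of_sum (to_sum X) = X"
  by (simp add: of_sum_def to_sum_def)

lemma solution_solves:
  assumes "is_sol X"
  shows "solves vf_index vf {0..} (\<lambda>t. to_sum (X t))"
  using assms unfolding solution_iff solves_def vf_index_def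
  by (auto simp: vf_def) (auto simp: to_sum_def)

lemma solution_exists:
  assumes X0: "X0 \<in> states Nu Nt"
  shows "\<exists>X. is_sol X \<and> X 0 = X0"
proof -
  obtain z where z0: "\<And>i. i \<in> vf_index \<Longrightarrow> z 0 i = to_sum X0 i" and z: "solves vf_index vf {0..} z"
    using vf.global_solution by blast
  \<comment> \<open>Off the selected modes \<open>z\<close> is arbitrary; setting those values to 0
    lands in \<open>states Nu Nt\<close> and changes neither the fields nor the right-hand
    sides.\<close>
  define X :: "real \<Rightarrow> state" where
    "X t = (\<lambda>n. if n \<in> Nu then z t (Inl n) else 0, \<lambda>n. if n \<in> Nt then z t (Inr n) else 0)" for t
  have v: "vel (of_sum (z t)) = vel (X t)" for t
    unfolding velocity_def by (intro ext sum.cong) (auto simp: X_def of_sum_def)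
  have T: "temp (of_sum (z t)) = temp (X t)" for t
    unfolding temperature_def by (intro ext sum.cong) (auto simp: X_def of_sum_def)
  have Fu: "Fu (of_sum (z t)) n = Fu (X t) n" if "n \<in> Nu" for t n
    unfolding Fu_def v T using that by (simp add: X_def of_sum_def)
  have Ft: "Ft (of_sum (z t)) n = Ft (X t) n" if "n \<in> Nt" for t n
    unfolding Ft_def v T using that by (simp add: X_def of_sum_def)
  have "is_sol X"
    unfolding solution_iff
  proof (intro allI impI conjI ballI)
    fix t :: real assume t: "t \<ge> 0"
    show "X t \<in> states Nu Nt" by (simp add: X_def states_def)
    show "((\<lambda>s. fst (X s) n) has_real_derivative Fu (X t) n) (at t within {0..})" if n: "n \<in> Nu" for n
    proof -
      have "((\<lambda>s. z s (Inl n)) has_real_derivative vf (z t) (Inl n)) (at t within {0..})"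
        using z t n unfolding solves_def vf_index_def by auto
      then show ?thesis using n Fu[OF n] by (simp add: vf_def X_def)
    qed
    show "((\<lambda>s. snd (X s) n) has_real_derivative Ft (X t) n) (at t within {0..})" if n: "n \<in> Nt" for n
    proof -
      have "((\<lambda>s. z s (Inr n)) has_real_derivative vf (z t) (Inr n)) (at t within {0..})"
        using z t n unfolding solves_def vf_index_def by auto
      then show ?thesis using n Ft[OF n] by (simp add: vf_def X_def)
    qed
  qed
  moreover have "X 0 = X0"
  proof (intro prod_eqI ext)
    fix n
    show "fst (X 0) n = fst X0 n"
      using z0[of "Inl n"] states_zero[OF X0] by (cases "n \<in> Nu") (auto simp: X_def vf_index_def to_sum_def)
    show "snd (X 0) n = snd X0 n"
      using z0[of "Inr n"] states_zero[OF X0] by (cases "n \<in> Nt") (auto simp: X_def vf_index_def to_sum_def)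
  qed
  ultimately show ?thesis by blast
qed

lemma solution_states: "is_sol X \<Longrightarrow> t \<ge> 0 \<Longrightarrow> X t \<in> states Nu Nt"
  by (simp add: solution_def)

lemma solution_unique:
  assumes "is_sol X" "is_sol Y" "X 0 = Y 0" "t \<ge> 0"
  shows "X t = Y t"
proof -
  have eq: "to_sum (X t) i = to_sum (Y t) i" if "i \<in> vf_index" for i
  proof (rule vf.uniqueness[of t "\<lambda>t. to_sum (X t)" "\<lambda>t. to_sum (Y t)"])
    show "solves vf_index vf {0..t} (\<lambda>t. to_sum (X t))"
      by (rule solves_subset[OF solution_solves[OF assms(1)]]) auto
    show "solves vf_index vf {0..t} (\<lambda>t. to_sum (Y t))"
      by (rule solves_subset[OF solution_solves[OF assms(2)]]) auto
  qed (use assms that in auto)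
  show ?thesis
  proof (intro prod_eqI ext)
    fix n
    show "fst (X t) n = fst (Y t) n"
      using eq[of "Inl n"] states_zero[OF solution_states[OF assms(1,4)]] states_zero[OF solution_states[OF assms(2,4)]]
      by (cases "n \<in> Nu") (auto simp: vf_index_def to_sum_def)
    show "snd (X t) n = snd (Y t) n"
      using eq[of "Inr n"] states_zero[OF solution_states[OF assms(1,4)]] states_zero[OF solution_states[OF assms(2,4)]]
      by (cases "n \<in> Nt") (auto simp: vf_index_def to_sum_def)
  qed
qed

lemma flow_eq: "is_sol X \<Longrightarrow> t \<ge> 0 \<Longrightarrow> semiflow t (X 0) = X t"
  unfolding flow_def by (rule the_equality) (use solution_unique in blast)+

lemma solution_shift:
  assumes "is_sol X" "s \<ge> 0"
  shows "is_sol (\<lambda>t. X (t + s))"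
proof -
  have sh: "((\<lambda>r. f (r + s)) has_real_derivative d) (at t within {0..})"
    if "(f has_real_derivative d) (at (t + s) within {0..})" for f d t
  proof -
    have "(f has_real_derivative d) (at (t + s) within (\<lambda>r. r + s) ` {0..})"
      by (rule DERIV_subset[OF that]) (use assms(2) in auto)
    then have "((f \<circ> (\<lambda>r. r + s)) has_real_derivative d * 1) (at t within {0..})"
      by (rule DERIV_image_chain) (auto intro!: derivative_eq_intros)
    then show ?thesis by (simp add: o_def)
  qed
  show ?thesis
    using assms unfolding solution_iff by (auto intro!: sh)
qed

lemma state_dist_sq: "(sdist X Y)\<^sup>2 = (\<Sum>i\<in>vf_index. (to_sum X i - to_sum Y i)\<^sup>2)"
  unfolding state_dist_def vf_index_def using fin_u fin_t
  by (subst sum.Plus) (auto simp: to_sum_def intro!: sum_nonneg add_nonneg_nonneg)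

lemma state_dist_nonneg: "sdist X Y \<ge> 0"
  by (simp add: state_dist_def sum_nonneg add_nonneg_nonneg)

lemma solution_dependence:
  obtains c where "\<And>T X Y. 0 \<le> T \<Longrightarrow> is_sol X \<Longrightarrow> is_sol Y \<Longrightarrow>
    (\<And>t n. t \<in> {0..T} \<Longrightarrow> n \<in> Nu \<Longrightarrow> \<bar>fst (X t) n\<bar> \<le> \<rho> \<and> \<bar>fst (Y t) n\<bar> \<le> \<rho>) \<Longrightarrow>
    (\<And>t n. t \<in> {0..T} \<Longrightarrow> n \<in> Nt \<Longrightarrow> \<bar>snd (X t) n\<bar> \<le> \<rho> \<and> \<bar>snd (Y t) n\<bar> \<le> \<rho>) \<Longrightarrow>
    (sdist (X T) (Y T))\<^sup>2 \<le> (sdist (X 0) (Y 0))\<^sup>2 * exp (c * T)"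
proof -
  obtain c where c: "\<And>T x y. 0 \<le> T \<Longrightarrow> solves vf_index vf {0..T} x \<Longrightarrow> solves vf_index vf {0..T} y \<Longrightarrow>
    (\<And>t i. t \<in> {0..T} \<Longrightarrow> i \<in> vf_index \<Longrightarrow> \<bar>x t i\<bar> \<le> \<rho> \<and> \<bar>y t i\<bar> \<le> \<rho>) \<Longrightarrow>
    (\<Sum>i\<in>vf_index. (x T i - y T i)\<^sup>2) \<le> (\<Sum>i\<in>vf_index. (x 0 i - y 0 i)\<^sup>2) * exp (c * T)"
    using vf.continuous_dependence by blast
  show ?thesis
  proof (rule that[of c])
    fix T :: real and X Y
    assume T: "0 \<le> T" and sol: "is_sol X" "is_sol Y"
      and b: "\<And>t n. t \<in> {0..T} \<Longrightarrow> n \<in> Nu \<Longrightarrow> \<bar>fst (X t) n\<bar> \<le> \<rho> \<and> \<bar>fst (Y t) n\<bar> \<le> \<rho>"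
        "\<And>t n. t \<in> {0..T} \<Longrightarrow> n \<in> Nt \<Longrightarrow> \<bar>snd (X t) n\<bar> \<le> \<rho> \<and> \<bar>snd (Y t) n\<bar> \<le> \<rho>"
    have s: "solves vf_index vf {0..T} (\<lambda>t. to_sum (Z t))" if "is_sol Z" for Z
      by (rule solves_subset[OF solution_solves[OF that]]) auto
    show "(sdist (X T) (Y T))\<^sup>2 \<le> (sdist (X 0) (Y 0))\<^sup>2 * exp (c * T)"
      unfolding state_dist_sq
    proof (rule c[OF T s[OF sol(1)] s[OF sol(2)]])
      fix t i assume "t \<in> {0..T}" "i \<in> vf_index"
      then show "\<bar>to_sum (X t) i\<bar> \<le> \<rho> \<and> \<bar>to_sum (Y t) i\<bar> \<le> \<rho>"
        using b unfolding vf_index_def by (auto simp: to_sum_def)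
    qed
  qed
qed

text \<open>Initial data with a single velocity and a single temperature coefficient, both equal to
  1, isolate one entry of the bilinear form at time 0. Existence of a solution from every state is
  what makes this test available.\<close>

theorem balance_iff_criterion:
  "(\<forall>X. is_sol X \<longrightarrow> energy_balance k Nu Nt X) \<longleftrightarrow> energy_balance_criterion k Nu Nt"
proof
  assume bal: "\<forall>X. is_sol X \<longrightarrow> energy_balance k Nu Nt X"
  show "energy_balance_criterion k Nu Nt"
    unfolding criterion_iff
  proof (intro ballI)
    fix a b assume a: "a \<in> Nu" and b: "b \<in> Nt"
    define X0 :: state where "X0 = (\<lambda>n. of_bool (n = a), \<lambda>n. of_bool (n = b))"
    have "X0 \<in> states Nu Nt" using a b by (auto simp: X0_def states_def)
    then obtain X where X: "is_sol X" "X 0 = X0" using solution_exists by blast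
    then have "balance_defect X0 = 0" using bal energy_balance_iff by force
    moreover have "balance_defect X0 = total_interaction a b"
    proof -
      have "balance_defect X0 = (\<Sum>a'\<in>Nu. of_bool (a' = a) * (\<Sum>b'\<in>Nt. of_bool (b' = b) * total_interaction a' b'))"
        by (simp add: balance_defect_eq X0_def sum_distrib_left mult.assoc)
      also have "\<dots> = (\<Sum>b'\<in>Nt. of_bool (b' = b) * total_interaction a b')"
        using a fin_u by (simp add: of_bool_def if_distrib[of "\<lambda>c. c * _"] cong: if_cong)
      also have "\<dots> = total_interaction a b"
        using b fin_t by (simp add: of_bool_def if_distrib[of "\<lambda>c. c * _"] cong: if_cong)
      finally show ?thesis .
    qed
    ultimately show "total_interaction a b = 0" by simp
  qed
next
  assume "energy_balance_criterion k Nu Nt"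
  then have "balance_defect X = 0" for X
    unfolding criterion_iff balance_defect_eq by (intro sum.neutral ballI) simp
  then show "\<forall>X. is_sol X \<longrightarrow> energy_balance k Nu Nt X"
    using energy_balance_iff by blast
qed

end

section \<open>The Lyapunov functional and the attractor\<close>

lemma sum_inverse_squares_le:
  assumes "finite M" "\<And>j. j \<in> M \<Longrightarrow> j > 0"
  shows "(\<Sum>j\<in>M. 1 / (real j)\<^sup>2) \<le> pi\<^sup>2 / 6"
proof -
  have s: "(\<lambda>n. 1 / (real n + 1)\<^sup>2) sums (pi\<^sup>2 / 6)"
    using inverse_squares_sums by (simp add: add.commute)
  have inj: "inj_on (\<lambda>j. j - 1) M"
  proof (rule inj_onI)
    fix x y assume "x \<in> M" "y \<in> M" "x - 1 = y - 1"
    then show "x = y" using assms(2)[of x] assms(2)[of y] by simp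
  qed
  have "(\<Sum>j\<in>M. 1 / (real j)\<^sup>2) = (\<Sum>j\<in>M. 1 / (real (j - 1) + 1)\<^sup>2)"
  proof (rule sum.cong)
    fix j assume "j \<in> M"
    then have "real (j - 1) + 1 = real j" using assms(2)[of j] by simp
    then show "1 / (real j)\<^sup>2 = 1 / (real (j - 1) + 1)\<^sup>2" by simp
  qed simp
  also have "\<dots> = (\<Sum>n\<in>(\<lambda>j. j - 1) ` M. 1 / (real n + 1)\<^sup>2)"
    by (subst sum.reindex[OF inj]) simp
  also have "\<dots> \<le> (\<Sum>n. 1 / (real n + 1)\<^sup>2)"
    using s assms(1) by (intro sum_le_suminf) (auto simp: sums_iff)
  also have "\<dots> = pi\<^sup>2 / 6" using s by (simp add: sums_iff)
  finally show ?thesis .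
qed

lemma exp_decay_eventually:
  fixes r c d :: real
  assumes "r > 0" "d > 0"
  shows "\<exists>T\<ge>0. \<forall>t\<ge>T. c * exp (- r * t) \<le> d"
proof -
  define T where "T = max 0 (ln ((\<bar>c\<bar> + 1) / d) / r)"
  have "c * exp (- r * t) \<le> d" if "t \<ge> T" for t
  proof -
    have "ln ((\<bar>c\<bar> + 1) / d) \<le> r * t" using that assms by (simp add: T_def field_simps)
    then have "exp (ln ((\<bar>c\<bar> + 1) / d)) \<le> exp (r * t)" by simp
    moreover have "(\<bar>c\<bar> + 1) / d > 0" using assms by (intro divide_pos_pos) auto
    ultimately have "(\<bar>c\<bar> + 1) / d \<le> exp (r * t)" by simp
    then have "\<bar>c\<bar> + 1 \<le> d * exp (r * t)" using assms by (simp add: field_simps)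
    then have "c \<le> d * exp (r * t)" by linarith
    then show ?thesis by (simp add: exp_minus field_simps)
  qed
  moreover have "T \<ge> 0" by (simp add: T_def)
  ultimately show ?thesis by blast
qed

lemma strat_3: "fst (strat j) $ 3 = j"
  by (simp add: strat_def)

section \<open>Dissipation estimates\<close>

context truncation
begin

definition kmin :: real where "kmin = (MIN i. (k$i)\<^sup>2)"

lemma kmin_le: "kmin \<le> (k$i)\<^sup>2"
  unfolding kmin_def by (rule Min_le) auto

lemma kmin_pos: "kmin > 0"
  unfolding kmin_def by (subst Min_gr_iff) auto

lemma ksq_ge_component:
  assumes "m$i > 0"
  shows "kmin * (real (m$i))\<^sup>2 \<le> ksq k (m, p, c)"
proof -
  have "kmin * (real (m$i))\<^sup>2 \<le> (k$i)\<^sup>2 * (real (m$i))\<^sup>2"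
    by (intro mult_right_mono kmin_le) simp
  also have "\<dots> = (k$i * real (m$i))\<^sup>2" by (simp add: power_mult_distrib)
  also have "\<dots> \<le> ksq k (m, p, c)" unfolding ksq_def fst_conv by (rule member_le_sum) auto
  finally show ?thesis .
qed

lemma ksq_ge_kmin:
  assumes "n \<in> Nu \<or> n \<in> Nt"
  shows "kmin \<le> ksq k n"
proof -
  obtain m p c where n: "n = (m, p, c)" by (metis prod_cases3)
  have "\<exists>i. m$i > 0"
  proof (cases "n \<in> Nu")
    case True
    then have "m \<noteq> 0" using Nu N_u_D(5) n by blast
    then show ?thesis by (auto simp: vec_eq_iff)
  next
    case False
    then show ?thesis using assms Nt N_theta_D(3) n by blast
  qed
  then obtain i where i: "m$i > 0" by blast
  have "kmin * 1 \<le> kmin * (real (m$i))\<^sup>2" using kmin_pos i by (intro mult_left_mono) auto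
  also have "\<dots> \<le> ksq k n" unfolding n by (rule ksq_ge_component[OF i])
  finally show ?thesis by simp
qed

text \<open>Completing the square halves the weight \<open>4 * pi / k$3\<close> of the potential
  energy; this checks that the explicit shift of the ellipsoid is the resulting multiple of the
  height coefficient.\<close>

lemma ball_shift_eq:
  assumes n: "n \<in> Nt"
  shows "ball_shift k n = 2 * pi / k$3 * height_coeff n"
proof (cases "n \<in> N_theta_star")
  case True
  obtain m p c where n': "n = (m, p, c)" by (metis prod_cases3)
  have m: "real (m$3) > 0" using True by (simp add: n' N_theta_star_def N_theta_def)
  have V: "V = 2 * (pi * sqrt pi)"
    unfolding V_def by (rule real_sqrt_unique) (auto simp: power2_eq_square power3_eq_cube)
  have pw: "(2 * pi) powr (3/2) = 2 * pi * (sqrt 2 * sqrt pi)"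
  proof -
    have "(2 * pi) powr (3/2) = (2 * pi) powr (1 + 1/2)" by simp
    also have "\<dots> = 2 * pi * sqrt (2 * pi)" unfolding powr_add by (simp add: powr_half_sqrt)
    finally show ?thesis by (simp add: real_sqrt_mult)
  qed
  have sp: "pi = sqrt pi * sqrt pi" by simp
  have h: "height_coeff n = sqrt 2 * (4 * pi\<^sup>2) / (V * real (m$3))"
    using height_coeff_eq[of n] n Nt True by (auto simp: n')
  have "2 * pi / k$3 * height_coeff n = 4 * pi * sqrt 2 * (pi / sqrt pi) / (k$3 * real (m$3))"
    unfolding h V using m by (simp add: power2_eq_square field_simps)
  also have "pi / sqrt pi = sqrt pi" using sp by (metis nonzero_mult_div_cancel_right pi_gt_zero real_sqrt_gt_zero less_irrefl)
  finally show ?thesis using True by (simp add: n' pw)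
next
  case False
  moreover have "ball_shift k n = 0" using False by (cases n) simp
  ultimately show ?thesis using height_coeff_eq[of n] n Nt by auto
qed

text \<open>The shift decays like \<open>1 / j\<close> while the eigenvalue grows like
  \<open>j\<^sup>2\<close>. The forcing is therefore the same for every stratified mode, and the
  radius merely counts these modes up to a convergent correction.\<close>

lemma ball_shift_strat:
  assumes "j > 0"
  shows "(ball_shift k (strat j))\<^sup>2 * ksq k (strat j) = 32 * pi ^ 3"
proof -
  have "strat j \<in> N_theta_star" using assms by (simp add: N_theta_star_eq)
  then have "ball_shift k (strat j) = 2 * (2 * pi) powr (3/2) / (k$3 * real j)"
    by (simp add: strat_def)
  moreover have "((2 * pi) powr (3/2))\<^sup>2 = (2 * pi) ^ 3"
  proof -
    have "((2 * pi) powr (3/2))\<^sup>2 = (2 * pi) powr (3/2 + 3/2)"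
      unfolding power2_eq_square powr_add ..
    also have "\<dots> = (2 * pi) ^ 3" by (simp add: powr_numeral)
    finally show ?thesis .
  qed
  ultimately show ?thesis
    using assms by (simp add: ksq_strat power_divide power_mult_distrib)
qed

definition \<mu> :: real where "\<mu> = min P 1"

lemma mu_pos: "\<mu> > 0" and mu_le: "\<mu> \<le> 1" "\<mu> \<le> P"
  using P by (auto simp: \<mu>_def)

definition lam0 :: real where "lam0 = kmin * \<mu>"

lemma lam0_pos: "lam0 > 0"
  by (simp add: lam0_def kmin_pos mu_pos)

definition nstar :: nat where "nstar = card (Nt \<inter> N_theta_star)"

definition radius :: real where
  "radius = 16 * pi ^ 3 / kmin * (real nstar / \<mu> + pi ^ 3 / 6)"

definition radius0 :: real where
  "radius0 = 16 * pi ^ 3 / kmin * (real nstar / \<mu> + pi\<^sup>2 / 6)"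

lemma radius0_nonneg: "radius0 \<ge> 0"
  unfolding radius0_def using kmin_pos mu_pos by (intro mult_nonneg_nonneg add_nonneg_nonneg) auto

lemma radius0_less: "radius0 < radius"
  unfolding radius_def radius0_def
proof (rule mult_strict_left_mono)
  have "pi\<^sup>2 < pi ^ 3" using pi_gt3 by (intro power_strict_increasing) auto
  then show "real nstar / \<mu> + pi\<^sup>2 / 6 < real nstar / \<mu> + pi ^ 3 / 6" by simp
  show "0 < 16 * pi ^ 3 / kmin" using kmin_pos by simp
qed

text \<open>Setting aside \<open>lam0 / 2\<close> of the dissipation for decay leaves a quadratic in
  the shifted coefficient with leading coefficient \<open>A\<close>; its linear term costs
  \<open>8 * pi ^ 3 * \<kappa> / A\<close>. Since \<open>x\<close> bounds
  \<open>lam0 / \<kappa>\<close>, this is at most \<open>8 * pi ^ 3 * (1 + x)\<close>. Summed over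
  the modes, the 1 yields their number and \<open>x\<close> the inverse squares.\<close>

lemma mode_dissipation:
  assumes n: "n \<in> Nt"
  shows "- (ksq k n * (\<theta> * (\<theta> + ball_shift k n))) \<le>
    - (lam0 / 2) * (\<theta> + ball_shift k n)\<^sup>2 +
    (if n \<in> N_theta_star then 8 * pi ^ 3 * (1 + \<mu> / (real (fst n $ 3))\<^sup>2) else 0)"
proof (cases "n \<in> N_theta_star")
  case False
  have "ball_shift k n = 0" using False by (cases n) simp
  moreover have "lam0 / 2 \<le> ksq k n"
  proof -
    have "lam0 \<le> kmin * 1" unfolding lam0_def using kmin_pos mu_le by (intro mult_left_mono) auto
    moreover have "kmin \<le> ksq k n" using ksq_ge_kmin n by blast
    ultimately show ?thesis using lam0_pos by simp
  qed
  then have "lam0 / 2 * \<theta>\<^sup>2 \<le> ksq k n * \<theta>\<^sup>2" by (rule mult_right_mono) simp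
  ultimately show ?thesis using False by (simp add: power2_eq_square)
next
  case True
  then obtain j where j: "n = strat j" "j > 0" by (auto simp: N_theta_star_eq)
  define \<kappa> where "\<kappa> = ksq k n"
  define s where "s = ball_shift k n"
  define \<phi> where "\<phi> = \<theta> + s"
  define x where "x = \<mu> / (real j)\<^sup>2"
  define A where "A = \<kappa> - lam0 / 2"
  define c where "c = 8 * pi ^ 3 * (1 + x)"
  have m3: "fst n $ 3 = j" by (simp add: j strat_def)
  have j2: "(real j)\<^sup>2 \<ge> 1" using j by simp
  have "\<mu> \<le> (real j)\<^sup>2" using mu_le(1) j2 by linarith
  then have x: "0 < x" "x \<le> 1" unfolding x_def using mu_pos j(2) by simp_all
  have sk: "s\<^sup>2 * \<kappa> = 32 * pi ^ 3" unfolding s_def \<kappa>_def j(1) using ball_shift_strat j(2) by blast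
  have "kmin * (real j)\<^sup>2 \<le> \<kappa>"
    using ksq_ge_component[of "fst n" 3 "fst (snd n)" "snd (snd n)"] j(2) unfolding m3 \<kappa>_def by simp
  then have l: "lam0 \<le> \<kappa> * x"
    unfolding lam0_def x_def using mu_pos j(2) by (simp add: field_simps mult_left_mono)
  have kap: "\<kappa> > 0" unfolding \<kappa>_def using ksq_ge_kmin[of n] n kmin_pos by simp
  have "A \<ge> \<kappa> * (1 - x / 2)" using l by (simp add: A_def algebra_simps)
  moreover have "\<kappa> * (1 - x / 2) > 0" using kap x by (intro mult_pos_pos) auto
  ultimately have A: "A > 0" by simp
  \<comment> \<open>The discriminant condition \<open>\<kappa>\<^sup>2 s\<^sup>2 \<le> 4 A c\<close> reduces to \<open>1 \<le> (1 - x / 2) (1 + x)\<close> because \<open>\<kappa> s\<^sup>2\<close>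
    does not depend on the mode.\<close>
  have "\<kappa> \<le> \<kappa> * (1 - x / 2) * (1 + x)"
  proof -
    have "\<kappa> * (1 - x / 2) * (1 + x) = \<kappa> + \<kappa> * (x / 2) * (1 - x)" by (simp add: field_simps)
    moreover have "\<kappa> * (x / 2) * (1 - x) \<ge> 0" using kap x by simp
    ultimately show ?thesis by simp
  qed
  also have "\<dots> \<le> A * (1 + x)"
    using \<open>A \<ge> \<kappa> * (1 - x / 2)\<close> x by (intro mult_right_mono) auto
  finally have "8 * pi ^ 3 * \<kappa> \<le> 8 * pi ^ 3 * (A * (1 + x))" by (intro mult_left_mono) auto
  then have Ac: "8 * pi ^ 3 * \<kappa> \<le> A * c" by (simp add: c_def mult_ac)
  have "\<kappa>\<^sup>2 * s\<^sup>2 / 4 = (s\<^sup>2 * \<kappa>) * \<kappa> / 4" by (simp add: power2_eq_square)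
  then have "A * c - \<kappa>\<^sup>2 * s\<^sup>2 / 4 \<ge> 0" using Ac unfolding sk by linarith
  then have "0 \<le> (A * \<phi> - \<kappa> * s / 2)\<^sup>2 + (A * c - \<kappa>\<^sup>2 * s\<^sup>2 / 4)"
    by (intro add_nonneg_nonneg zero_le_power2)
  also have "\<dots> = A * (A * \<phi>\<^sup>2 - \<kappa> * s * \<phi> + c)" by (simp add: power2_eq_square algebra_simps)
  finally have "0 \<le> A * \<phi>\<^sup>2 - \<kappa> * s * \<phi> + c" using A by (simp add: zero_le_mult_iff)
  moreover have "- (\<kappa> * (\<theta> * (\<theta> + s))) = - (\<kappa> * \<phi>\<^sup>2) + \<kappa> * s * \<phi>"
    by (simp add: \<phi>_def power2_eq_square algebra_simps)
  ultimately have "- (\<kappa> * (\<theta> * (\<theta> + s))) \<le> - (lam0 / 2) * \<phi>\<^sup>2 + c" by (simp add: A_def algebra_simps)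
  then show ?thesis using True m3 by (simp add: \<kappa>_def s_def \<phi>_def c_def x_def)
qed

lemma temperature_dissipation:
  "- (\<Sum>n\<in>Nt. ksq k n * (snd X n * (snd X n + ball_shift k n))) \<le>
     - (lam0 / 2) * (\<Sum>n\<in>Nt. (snd X n + ball_shift k n)\<^sup>2) + lam0 / 2 * radius0"
proof -
  define c where "c n = (if n \<in> N_theta_star then 8 * pi ^ 3 * (1 + \<mu> / (real (fst n $ 3))\<^sup>2) else 0)" for n :: mode
  have "- (\<Sum>n\<in>Nt. ksq k n * (snd X n * (snd X n + ball_shift k n))) \<le>
     (\<Sum>n\<in>Nt. - (lam0 / 2) * (snd X n + ball_shift k n)\<^sup>2 + c n)"
    unfolding sum_negf[symmetric] c_def by (intro sum_mono mode_dissipation)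
  also have "\<dots> = - (lam0 / 2) * (\<Sum>n\<in>Nt. (snd X n + ball_shift k n)\<^sup>2) + (\<Sum>n\<in>Nt. c n)"
    by (simp only: sum.distrib sum_distrib_left)
  also have "(\<Sum>n\<in>Nt. c n) = (\<Sum>n\<in>Nt \<inter> N_theta_star. c n)"
    using fin_t by (intro sum.mono_neutral_right) (auto simp: c_def)
  also have "\<dots> = (\<Sum>j\<in>strat_set. 8 * pi ^ 3 * (1 + \<mu> * (1 / (real j)\<^sup>2)))"
    unfolding Nt_star
    by (subst sum.reindex) (auto simp: inj_on_def strat_inject c_def N_theta_star_eq strat_set_pos strat_3 intro!: sum.cong)
  also have "\<dots> = 8 * pi ^ 3 * (real (card strat_set) + \<mu> * (\<Sum>j\<in>strat_set. 1 / (real j)\<^sup>2))"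
    by (simp only: sum_distrib_left[symmetric] sum.distrib sum_constant) simp
  also have "\<dots> \<le> 8 * pi ^ 3 * (real (card strat_set) + \<mu> * (pi\<^sup>2 / 6))"
    using mu_pos strat_set_pos finite_strat_set
    by (intro mult_left_mono add_left_mono sum_inverse_squares_le) auto
  also have "card strat_set = nstar"
    unfolding nstar_def Nt_star by (rule card_image[symmetric]) (simp add: inj_on_def strat_inject)
  also have "8 * pi ^ 3 * (real nstar + \<mu> * (pi\<^sup>2 / 6)) = lam0 / 2 * radius0"
    unfolding lam0_def radius0_def using kmin_pos mu_pos by (simp add: field_simps)
  finally show ?thesis by simp
qed

text \<open>Up to an additive constant, the functional of the overview with a free velocity weight
  \<open>a\<close> in place of \<open>1 / (P * R)\<close>.\<close>

definition lyap :: "real \<Rightarrow> state \<Rightarrow> real" where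
  "lyap a X = a * (\<Sum>n\<in>Nu. (fst X n)\<^sup>2) + (\<Sum>n\<in>Nt. (snd X n + ball_shift k n)\<^sup>2)"

text \<open>Half the derivative of \<open>lyap\<close> along solutions, written as a function of the
  state so that the Lyapunov inequality can be stated for all states.\<close>

definition lyap_rate :: "real \<Rightarrow> state \<Rightarrow> real" where
  "lyap_rate a X = a * (\<Sum>n\<in>Nu. fst X n * Fu X n) + (\<Sum>n\<in>Nt. (snd X n + ball_shift k n) * Ft X n)"

lemma velocity_dissipation: "kmin * (\<Sum>n\<in>Nu. (fst X n)\<^sup>2) \<le> (\<Sum>n\<in>Nu. ksq k n * (fst X n)\<^sup>2)"
  unfolding sum_distrib_left by (intro sum_mono mult_right_mono ksq_ge_kmin) auto

lemma solution_continuous_on: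
  assumes "is_sol X"
  shows "n \<in> Nu \<Longrightarrow> continuous_on {0..} (\<lambda>s. fst (X s) n)"
    and "n \<in> Nt \<Longrightarrow> continuous_on {0..} (\<lambda>s. snd (X s) n)"
  using assms unfolding solution_iff continuous_on_eq_continuous_within by (auto intro: DERIV_continuous)

lemma solution_has_derivative:
  assumes "is_sol X" "t > 0"
  shows "n \<in> Nu \<Longrightarrow> ((\<lambda>s. fst (X s) n) has_real_derivative Fu (X t) n) (at t)"
    and "n \<in> Nt \<Longrightarrow> ((\<lambda>s. snd (X s) n) has_real_derivative Ft (X t) n) (at t)"
proof -
  have w: "at t within {0..} = at t" using assms(2) by (intro at_within_interior) (auto simp: interior_Ici)
  show "n \<in> Nu \<Longrightarrow> ((\<lambda>s. fst (X s) n) has_real_derivative Fu (X t) n) (at t)"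
    "n \<in> Nt \<Longrightarrow> ((\<lambda>s. snd (X s) n) has_real_derivative Ft (X t) n) (at t)"
    using assms unfolding solution_iff w[symmetric] by auto
qed

lemma lyap_has_derivative:
  assumes "is_sol X" "t > 0"
  shows "((\<lambda>t. lyap a (X t)) has_real_derivative 2 * lyap_rate a (X t)) (at t)"
proof -
  have "((\<lambda>t. a * (\<Sum>n\<in>Nu. (fst (X t) n)\<^sup>2) + (\<Sum>n\<in>Nt. (snd (X t) n + ball_shift k n)\<^sup>2)) has_real_derivative
      a * (\<Sum>n\<in>Nu. 2 * (fst (X t) n * Fu (X t) n)) + (\<Sum>n\<in>Nt. 2 * ((snd (X t) n + ball_shift k n) * Ft (X t) n))) (at t)"
    by (intro DERIV_add DERIV_cmult DERIV_sum) (auto intro!: derivative_eq_intros solution_has_derivative[OF assms])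
  then show ?thesis
    unfolding lyap_def lyap_rate_def
    by (simp add: sum_distrib_left[symmetric] distrib_left mult.left_commute[of 2 a])
qed

lemma lyap_continuous:
  assumes "is_sol X"
  shows "continuous_on {0..} (\<lambda>t. lyap a (X t))"
  unfolding lyap_def by (intro continuous_intros solution_continuous_on[OF assms])

text \<open>Without buoyancy the kinetic energy is only dissipated. This gives convergence to the
  hyperplane into which the ellipsoid degenerates.\<close>

lemma velocity_decay:
  assumes sol: "is_sol X" and R0: "R = 0" and t: "t \<ge> 0"
  shows "(\<Sum>n\<in>Nu. (fst (X t) n)\<^sup>2) \<le> (\<Sum>n\<in>Nu. (fst (X 0) n)\<^sup>2) * exp (- (2 * P * kmin) * t)"
proof (rule gronwall[OF t, where g = "\<lambda>t. \<Sum>n\<in>Nu. (fst (X t) n)\<^sup>2"])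
  have "continuous_on {0..} (\<lambda>t. \<Sum>n\<in>Nu. (fst (X t) n)\<^sup>2)" by (intro continuous_intros solution_continuous_on[OF sol])
  then show "continuous_on {0..t} (\<lambda>t. \<Sum>n\<in>Nu. (fst (X t) n)\<^sup>2)" by (rule continuous_on_subset) auto
  fix s :: real assume s: "0 < s"
  have "((\<lambda>t. \<Sum>n\<in>Nu. (fst (X t) n)\<^sup>2) has_real_derivative (\<Sum>n\<in>Nu. 2 * (fst (X s) n * Fu (X s) n))) (at s)"
    by (intro DERIV_sum) (auto intro!: derivative_eq_intros solution_has_derivative[OF sol s])
  moreover have "(\<Sum>n\<in>Nu. 2 * (fst (X s) n * Fu (X s) n)) \<le> - (2 * P * kmin) * (\<Sum>n\<in>Nu. (fst (X s) n)\<^sup>2)"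
    using mult_left_mono[OF velocity_dissipation[of "X s"], of "2 * P"] P
    unfolding sum_distrib_left[symmetric] velocity_energy by (simp add: R0)
  ultimately show "\<exists>g'. ((\<lambda>t. \<Sum>n\<in>Nu. (fst (X t) n)\<^sup>2) has_real_derivative g') (at s) \<and>
      g' \<le> - (2 * P * kmin) * (\<Sum>n\<in>Nu. (fst (X s) n)\<^sup>2)" by blast
qed


section \<open>The ellipsoid and compact Lyapunov balls\<close>

definition centre :: state where
  "centre = (\<lambda>n. 0, \<lambda>n. if n \<in> Nt then - ball_shift k n else 0)"

lemma centre_states: "centre \<in> states Nu Nt"
  by (simp add: centre_def states_def)

lemma radius_pos: "radius > 0"
  using radius0_nonneg radius0_less by simp

lemma ellipsoid_iff:
  "X \<in> ellipsoid k P R Nu Nt \<longleftrightarrow> X \<in> states Nu Nt \<and> (R = 0 \<longrightarrow> (\<forall>n\<in>Nu. fst X n = 0)) \<and>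
     (\<Sum>n\<in>Nu. (fst X n)\<^sup>2 / (P * R)) + (\<Sum>n\<in>Nt. (snd X n + ball_shift k n)\<^sup>2) \<le> radius"
  unfolding ellipsoid_def radius_def kmin_def nstar_def \<mu>_def by (cases X) auto

lemma centre_ellipsoid: "centre \<in> ellipsoid k P R Nu Nt"
  unfolding ellipsoid_iff using centre_states radius_pos by (simp add: centre_def)

lemma state_dist_centre_sq:
  "(sdist X centre)\<^sup>2 = (\<Sum>n\<in>Nu. (fst X n)\<^sup>2) + (\<Sum>n\<in>Nt. (snd X n + ball_shift k n)\<^sup>2)"
  unfolding state_dist_def by (simp add: centre_def sum_nonneg add_nonneg_nonneg cong: sum.cong)

lemma lyap_parts:
  assumes "a > 0"
  shows "(\<Sum>n\<in>Nu. (fst X n)\<^sup>2) \<le> lyap a X / a" "(\<Sum>n\<in>Nt. (snd X n + ball_shift k n)\<^sup>2) \<le> lyap a X"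
    "lyap a X \<ge> 0"
proof -
  have 1: "(\<Sum>n\<in>Nu. (fst X n)\<^sup>2) \<ge> 0" "(\<Sum>n\<in>Nt. (snd X n + ball_shift k n)\<^sup>2) \<ge> 0"
    by (intro sum_nonneg; simp)+
  then have 2: "a * (\<Sum>n\<in>Nu. (fst X n)\<^sup>2) \<ge> 0" using assms by simp
  show "(\<Sum>n\<in>Nu. (fst X n)\<^sup>2) \<le> lyap a X / a"
    using 1 assms by (simp add: lyap_def field_simps)
  show "(\<Sum>n\<in>Nt. (snd X n + ball_shift k n)\<^sup>2) \<le> lyap a X" "lyap a X \<ge> 0"
    using 1 2 by (simp_all add: lyap_def)
qed

lemma flow_of_state:
  assumes "X0 \<in> states Nu Nt"
  obtains X where "is_sol X" "X 0 = X0" "\<And>t. t \<ge> 0 \<Longrightarrow> semiflow t X0 = X t"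
  using solution_exists[OF assms] flow_eq by metis

lemma flow_states: "X0 \<in> states Nu Nt \<Longrightarrow> t \<ge> 0 \<Longrightarrow> semiflow t X0 \<in> states Nu Nt"
  by (metis flow_of_state solution_states)

lemma flow_zero: "X0 \<in> states Nu Nt \<Longrightarrow> semiflow 0 X0 = X0"
  by (metis flow_of_state order_refl)

lemma flow_add:
  assumes X0: "X0 \<in> states Nu Nt" and s: "s \<ge> 0" and t: "t \<ge> 0"
  shows "semiflow (s + t) X0 = semiflow s (semiflow t X0)"
proof -
  obtain X where X: "is_sol X" "X 0 = X0" "\<And>t. t \<ge> 0 \<Longrightarrow> semiflow t X0 = X t"
    using flow_of_state[OF X0] by metis
  have "semiflow s (X (0 + t)) = X (s + t)"
    by (rule flow_eq[OF solution_shift[OF X(1) t] s])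
  then show ?thesis using X(3) s t by simp
qed

lemma cont_fst_coord: "continuous_on A (\<lambda>X :: state. fst X n)"
  by (rule continuous_on_product_then_coordinatewise[OF continuous_on_fst[OF continuous_on_id]])

lemma cont_snd_coord: "continuous_on A (\<lambda>X :: state. snd X n)"
  by (rule continuous_on_product_then_coordinatewise[OF continuous_on_snd[OF continuous_on_id]])

lemma cont_state_dist: "continuous_on A (\<lambda>X. sdist X Y)"
  unfolding state_dist_def by (intro continuous_intros cont_fst_coord cont_snd_coord)

lemma cont_lyap: "continuous_on A (lyap a)"
  unfolding lyap_def[abs_def] by (intro continuous_intros cont_fst_coord cont_snd_coord)

lemma lyap_decay:
  assumes "\<And>X. 2 * lyap_rate a X \<le> - r * (lyap a X - q)" "is_sol X" "t \<ge> 0"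
  shows "lyap a (X t) - q \<le> (lyap a (X 0) - q) * exp (- r * t)"
proof (rule gronwall[OF assms(3), where g = "\<lambda>t. lyap a (X t) - q"])
  show "continuous_on {0..t} (\<lambda>t. lyap a (X t) - q)"
    by (intro continuous_intros continuous_on_subset[OF lyap_continuous[OF assms(2)]]) auto
  fix s :: real assume "0 < s"
  then have "((\<lambda>t. lyap a (X t) - q) has_real_derivative 2 * lyap_rate a (X s)) (at s)"
    using lyap_has_derivative[OF assms(2)] by (auto intro!: derivative_eq_intros)
  then show "\<exists>g'. ((\<lambda>t. lyap a (X t) - q) has_real_derivative g') (at s) \<and> g' \<le> - r * (lyap a (X s) - q)"
    using assms(1) by blast
qed

text \<open>For positive \<open>R\<close> and \<open>a = 1 / (P * R)\<close> this is the ellipsoid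
  itself. For \<open>R = 0\<close> it is a compact neighbourhood, within
  \<open>states Nu Nt\<close>, of the centre, with room in the velocity directions.\<close>

definition lyap_ball :: "real \<Rightarrow> state set" where
  "lyap_ball a = {X \<in> states Nu Nt. lyap a X \<le> radius}"

lemma lyap_ball_bounded:
  assumes a: "a > 0"
  obtains \<rho> where "\<rho> \<ge> 0" "\<And>X n. X \<in> lyap_ball a \<Longrightarrow> n \<in> Nu \<Longrightarrow> \<bar>fst X n\<bar> \<le> \<rho>"
    "\<And>X n. X \<in> lyap_ball a \<Longrightarrow> n \<in> Nt \<Longrightarrow> \<bar>snd X n\<bar> \<le> \<rho>"
proof -
  define s where "s = (\<Sum>n\<in>Nt. \<bar>ball_shift k n\<bar>)"
  have s: "s \<ge> 0" "\<And>n. n \<in> Nt \<Longrightarrow> \<bar>ball_shift k n\<bar> \<le> s"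
    unfolding s_def using fin_t by (auto intro: sum_nonneg member_le_sum)
  have u0: "sqrt (radius / a) \<ge> 0" "sqrt radius \<ge> 0" using radius_pos a by auto
  show ?thesis
  proof (rule that[of "sqrt (radius / a) + sqrt radius + s"])
    show "sqrt (radius / a) + sqrt radius + s \<ge> 0" using s u0 by simp
    fix X n assume X: "X \<in> lyap_ball a"
    then have l: "lyap a X \<le> radius" by (simp add: lyap_ball_def)
    show "\<bar>fst X n\<bar> \<le> sqrt (radius / a) + sqrt radius + s" if n: "n \<in> Nu"
    proof -
      have "(fst X n)\<^sup>2 \<le> (\<Sum>n\<in>Nu. (fst X n)\<^sup>2)" using n fin_u by (intro member_le_sum) auto
      also have "\<dots> \<le> lyap a X / a" using lyap_parts(1)[OF a] .
      also have "\<dots> \<le> radius / a" using l a by (intro divide_right_mono) auto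
      finally have "\<bar>fst X n\<bar> \<le> sqrt (radius / a)" by (intro real_le_rsqrt) simp
      then show ?thesis using s(1) u0 by linarith
    qed
    show "\<bar>snd X n\<bar> \<le> sqrt (radius / a) + sqrt radius + s" if n: "n \<in> Nt"
    proof -
      have "(snd X n + ball_shift k n)\<^sup>2 \<le> (\<Sum>n\<in>Nt. (snd X n + ball_shift k n)\<^sup>2)" using n fin_t by (intro member_le_sum) auto
      also have "\<dots> \<le> radius" using lyap_parts(2)[OF a, of X] l by simp
      finally have "\<bar>snd X n + ball_shift k n\<bar> \<le> sqrt radius" by (intro real_le_rsqrt) simp
      then show ?thesis using s(2)[OF n] u0 by linarith
    qed
  qed
qed

text \<open>Tychonoff's theorem: the ball is a closed part of a product of intervals, where the
  factors belonging to modes off the selection are the singleton of 0.\<close>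

lemma lyap_ball_compact:
  assumes a: "a > 0"
  shows "compact (lyap_ball a)"
proof -
  obtain \<rho> where rho: "\<rho> \<ge> 0" "\<And>X n. X \<in> lyap_ball a \<Longrightarrow> n \<in> Nu \<Longrightarrow> \<bar>fst X n\<bar> \<le> \<rho>"
    "\<And>X n. X \<in> lyap_ball a \<Longrightarrow> n \<in> Nt \<Longrightarrow> \<bar>snd X n\<bar> \<le> \<rho>"
    using lyap_ball_bounded[OF a] by blast
  define I :: "mode set \<Rightarrow> mode \<Rightarrow> real set" where "I N n = (if n \<in> N then {-\<rho>..\<rho>} else {0})" for N n
  have "compact (PiE UNIV (I N))" for N
  proof -
    have "compactin (product_topology (\<lambda>n::mode. euclidean :: real topology) UNIV) (PiE UNIV (I N))"
      unfolding compactin_PiE by (auto simp: I_def)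
    then show ?thesis by (simp add: euclidean_product_topology)
  qed
  then have "compact (PiE UNIV (I Nu) \<times> PiE UNIV (I Nt))" by (intro compact_Times)
  moreover have "closed {X. lyap a X \<le> radius}"
    by (intro closed_Collect_le cont_lyap continuous_on_const)
  ultimately have "compact ((PiE UNIV (I Nu) \<times> PiE UNIV (I Nt)) \<inter> {X. lyap a X \<le> radius})"
    by (rule compact_Int_closed)
  moreover have "(PiE UNIV (I Nu) \<times> PiE UNIV (I Nt)) \<inter> {X. lyap a X \<le> radius} = lyap_ball a"
  proof (intro set_eqI iffI)
    fix X assume X: "X \<in> (PiE UNIV (I Nu) \<times> PiE UNIV (I Nt)) \<inter> {X. lyap a X \<le> radius}"
    then have f: "fst X \<in> PiE UNIV (I Nu)" and s: "snd X \<in> PiE UNIV (I Nt)" by (simp_all add: mem_Times_iff)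
    have "fst X n = 0" if "n \<notin> Nu" for n using PiE_mem[OF f UNIV_I, of n] that by (simp add: I_def)
    moreover have "snd X n = 0" if "n \<notin> Nt" for n using PiE_mem[OF s UNIV_I, of n] that by (simp add: I_def)
    ultimately have "X \<in> states Nu Nt" unfolding states_def mem_Collect_eq case_prod_beta by blast
    then show "X \<in> lyap_ball a" using X by (simp add: lyap_ball_def)
  next
    fix X assume X: "X \<in> lyap_ball a"
    then have st: "X \<in> states Nu Nt" by (simp add: lyap_ball_def)
    have "fst X n \<in> I Nu n" for n
      using rho(2)[OF X, of n] states_zero(1)[OF st, of n] by (auto simp: I_def abs_le_iff)
    moreover have "snd X n \<in> I Nt n" for n
      using rho(3)[OF X, of n] states_zero(2)[OF st, of n] by (auto simp: I_def abs_le_iff)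
    ultimately show "X \<in> (PiE UNIV (I Nu) \<times> PiE UNIV (I Nt)) \<inter> {X. lyap a X \<le> radius}"
      using X by (simp add: lyap_ball_def mem_Times_iff PiE_iff)
  qed
  ultimately show ?thesis by simp
qed

lemma lyap_ball_invariant:
  assumes ineq: "\<And>X. 2 * lyap_rate a X \<le> - r * (lyap a X - q)" and r: "r > 0" and q: "q < radius"
    and X0: "X0 \<in> lyap_ball a" and t: "t \<ge> 0"
  shows "semiflow t X0 \<in> lyap_ball a"
proof -
  have st: "X0 \<in> states Nu Nt" and l: "lyap a X0 \<le> radius" using X0 by (auto simp: lyap_ball_def)
  obtain X where X: "is_sol X" "X 0 = X0" "\<And>t. t \<ge> 0 \<Longrightarrow> semiflow t X0 = X t"
    using flow_of_state[OF st] by metis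
  have "lyap a (X t) - q \<le> (lyap a X0 - q) * exp (- r * t)"
    using lyap_decay[OF ineq X(1) t] X(2) by simp
  also have "\<dots> \<le> (radius - q) * exp (- r * t)" using l by (intro mult_right_mono) auto
  also have "\<dots> \<le> (radius - q) * 1" using q r t by (intro mult_left_mono) auto
  finally show ?thesis using X(3)[OF t] flow_states[OF st t] by (simp add: lyap_ball_def)
qed

text \<open>Trajectories starting in the ball stay in one box, so the time map is Lipschitz for
  \<open>state_dist\<close>. Continuity in the product topology is coordinatewise: selected
  coordinates are controlled by \<open>state_dist\<close>, the others are constantly 0.\<close>

lemma flow_continuous_on_lyap_ball:
  assumes a: "a > 0" and inv: "\<And>X t. X \<in> lyap_ball a \<Longrightarrow> t \<ge> 0 \<Longrightarrow> semiflow t X \<in> lyap_ball a"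
    and t: "t \<ge> 0"
  shows "continuous_on (lyap_ball a) (semiflow t)"
proof -
  let ?\<phi> = "semiflow"
  obtain \<rho> where rho: "\<rho> \<ge> 0" "\<And>X n. X \<in> lyap_ball a \<Longrightarrow> n \<in> Nu \<Longrightarrow> \<bar>fst X n\<bar> \<le> \<rho>"
    "\<And>X n. X \<in> lyap_ball a \<Longrightarrow> n \<in> Nt \<Longrightarrow> \<bar>snd X n\<bar> \<le> \<rho>"
    using lyap_ball_bounded[OF a] by blast
  obtain c where c: "\<And>T X Y. 0 \<le> T \<Longrightarrow> is_sol X \<Longrightarrow> is_sol Y \<Longrightarrow>
    (\<And>t n. t \<in> {0..T} \<Longrightarrow> n \<in> Nu \<Longrightarrow> \<bar>fst (X t) n\<bar> \<le> \<rho> \<and> \<bar>fst (Y t) n\<bar> \<le> \<rho>) \<Longrightarrow>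
    (\<And>t n. t \<in> {0..T} \<Longrightarrow> n \<in> Nt \<Longrightarrow> \<bar>snd (X t) n\<bar> \<le> \<rho> \<and> \<bar>snd (Y t) n\<bar> \<le> \<rho>) \<Longrightarrow>
    (sdist (X T) (Y T))\<^sup>2 \<le> (sdist (X 0) (Y 0))\<^sup>2 * exp (c * T)"
    using solution_dependence by blast
  define C where "C = sqrt (exp (c * t))"
  have lip: "sdist (?\<phi> t X0) (?\<phi> t Y0) \<le> C * sdist X0 Y0"
    if X0: "X0 \<in> lyap_ball a" and Y0: "Y0 \<in> lyap_ball a" for X0 Y0
  proof -
    obtain X where X: "is_sol X" "X 0 = X0" "\<And>t. t \<ge> 0 \<Longrightarrow> ?\<phi> t X0 = X t"
      using flow_of_state[of X0] X0 by (auto simp: lyap_ball_def)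
    obtain Y where Y: "is_sol Y" "Y 0 = Y0" "\<And>t. t \<ge> 0 \<Longrightarrow> ?\<phi> t Y0 = Y t"
      using flow_of_state[of Y0] Y0 by (auto simp: lyap_ball_def)
    have XB: "X s \<in> lyap_ball a" "Y s \<in> lyap_ball a" if "s \<in> {0..t}" for s
      using inv[OF X0, of s] inv[OF Y0, of s] X(3)[of s] Y(3)[of s] that by auto
    have "(sdist (X t) (Y t))\<^sup>2 \<le> (sdist (X 0) (Y 0))\<^sup>2 * exp (c * t)"
      using rho(2,3) XB by (intro c[OF t X(1) Y(1)]) auto
    then have "sqrt ((sdist (X t) (Y t))\<^sup>2) \<le> sqrt ((sdist (X 0) (Y 0))\<^sup>2 * exp (c * t))"
      by (rule real_sqrt_le_mono)
    then show ?thesis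
      using X(2,3) Y(2,3) t state_dist_nonneg by (simp add: real_sqrt_mult C_def mult.commute)
  qed
  have coord: "continuous_on (lyap_ball a) g"
    if g: "\<And>X Y. X \<in> lyap_ball a \<Longrightarrow> Y \<in> lyap_ball a \<Longrightarrow> \<bar>g X - g Y\<bar> \<le> sdist (?\<phi> t X) (?\<phi> t Y)" for g :: "state \<Rightarrow> real"
    unfolding continuous_on_def
  proof
    fix Y assume Y: "Y \<in> lyap_ball a"
    have "((\<lambda>X. C * sdist X Y) \<longlongrightarrow> C * sdist Y Y) (at Y within lyap_ball a)"
      using cont_state_dist[of "lyap_ball a" Y] Y unfolding continuous_on_def by (intro tendsto_intros) auto
    then have 0: "((\<lambda>X. C * sdist X Y) \<longlongrightarrow> 0) (at Y within lyap_ball a)"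
      by (simp add: state_dist_def)
    have "((\<lambda>X. g X - g Y) \<longlongrightarrow> 0) (at Y within lyap_ball a)"
    proof (rule Lim_null_comparison[OF _ 0])
      show "\<forall>\<^sub>F X in at Y within lyap_ball a. norm (g X - g Y) \<le> C * sdist X Y"
        unfolding eventually_at_filter
        by (rule always_eventually) (use order_trans[OF g lip] Y in auto)
    qed
    then show "(g \<longlongrightarrow> g Y) (at Y within lyap_ball a)" by (rule LIM_zero_cancel)
  qed
  have le: "\<bar>fst X n - fst Y n\<bar> \<le> sdist X Y" if "n \<in> Nu" for X Y n
  proof -
    have "(fst X n - fst Y n)\<^sup>2 \<le> (\<Sum>n\<in>Nu. (fst X n - fst Y n)\<^sup>2)" using that fin_u by (intro member_le_sum) auto
    also have "\<dots> \<le> (\<Sum>n\<in>Nu. (fst X n - fst Y n)\<^sup>2) + (\<Sum>n\<in>Nt. (snd X n - snd Y n)\<^sup>2)" by (simp add: sum_nonneg)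
    finally show ?thesis unfolding state_dist_def by (intro real_le_rsqrt) simp
  qed
  have le': "\<bar>snd X n - snd Y n\<bar> \<le> sdist X Y" if "n \<in> Nt" for X Y n
  proof -
    have "(snd X n - snd Y n)\<^sup>2 \<le> (\<Sum>n\<in>Nt. (snd X n - snd Y n)\<^sup>2)" using that fin_t by (intro member_le_sum) auto
    also have "\<dots> \<le> (\<Sum>n\<in>Nu. (fst X n - fst Y n)\<^sup>2) + (\<Sum>n\<in>Nt. (snd X n - snd Y n)\<^sup>2)" by (simp add: sum_nonneg)
    finally show ?thesis unfolding state_dist_def by (intro real_le_rsqrt) simp
  qed
  have st: "?\<phi> t X \<in> states Nu Nt" if "X \<in> lyap_ball a" for X
    using that t by (intro flow_states) (auto simp: lyap_ball_def)
  have "continuous_on (lyap_ball a) (\<lambda>X. fst (?\<phi> t X) n)" for n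
    by (cases "n \<in> Nu") (auto intro!: coord simp: le states_zero[OF st] state_dist_nonneg)
  moreover have "continuous_on (lyap_ball a) (\<lambda>X. snd (?\<phi> t X) n)" for n
    by (cases "n \<in> Nt") (auto intro!: coord simp: le' states_zero[OF st] state_dist_nonneg)
  ultimately have "continuous_on (lyap_ball a) (\<lambda>X. (fst (?\<phi> t X), snd (?\<phi> t X)))"
    by (intro continuous_on_Pair continuous_on_coordinatewise_then_product)
  then show ?thesis by simp
qed

text \<open>A bound on the distance from the origin bounds the initial value of \<open>lyap\<close>
  uniformly, which gives one entry time for the whole set.\<close>

lemma bounded_set_absorbed:
  assumes a: "a > 0" and ineq: "\<And>X. 2 * lyap_rate a X \<le> - r * (lyap a X - q)" and r: "r > 0" and q: "q < radius"
    and D: "D \<subseteq> states Nu Nt" "\<And>X. X \<in> D \<Longrightarrow> sdist X (\<lambda>n. 0, \<lambda>n. 0) \<le> \<delta>"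
  shows "\<exists>T\<ge>0. \<forall>X\<in>D. semiflow T X \<in> lyap_ball a"
proof -
  define M where "M = a * \<delta>\<^sup>2 + 2 * \<delta>\<^sup>2 + 2 * (\<Sum>n\<in>Nt. (ball_shift k n)\<^sup>2)"
  have M: "lyap a X \<le> M" if X: "X \<in> D" for X
  proof -
    have U: "(\<Sum>n\<in>Nu. (fst X n)\<^sup>2) \<ge> 0" "(\<Sum>n\<in>Nt. (snd X n)\<^sup>2) \<ge> 0" by (intro sum_nonneg; simp)+
    have "(\<Sum>n\<in>Nu. (fst X n)\<^sup>2) + (\<Sum>n\<in>Nt. (snd X n)\<^sup>2) \<le> \<delta>\<^sup>2"
      using D(2)[OF X] U unfolding state_dist_def by (simp add: sqrt_le_D)
    then have 1: "(\<Sum>n\<in>Nu. (fst X n)\<^sup>2) \<le> \<delta>\<^sup>2" "(\<Sum>n\<in>Nt. (snd X n)\<^sup>2) \<le> \<delta>\<^sup>2" using U by linarith+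
    have "(\<Sum>n\<in>Nt. (snd X n + ball_shift k n)\<^sup>2) \<le> (\<Sum>n\<in>Nt. 2 * (snd X n)\<^sup>2 + 2 * (ball_shift k n)\<^sup>2)"
    proof (rule sum_mono)
      fix n
      have "0 \<le> (snd X n - ball_shift k n)\<^sup>2" by simp
      then show "(snd X n + ball_shift k n)\<^sup>2 \<le> 2 * (snd X n)\<^sup>2 + 2 * (ball_shift k n)\<^sup>2"
        by (simp add: power2_eq_square algebra_simps)
    qed
    also have "\<dots> = 2 * (\<Sum>n\<in>Nt. (snd X n)\<^sup>2) + 2 * (\<Sum>n\<in>Nt. (ball_shift k n)\<^sup>2)"
      by (simp add: sum.distrib sum_distrib_left)
    finally show ?thesis
      using 1 mult_left_mono[OF 1(1), of a] a unfolding lyap_def M_def by linarith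
  qed
  obtain T where T: "T \<ge> 0" "(M - q) * exp (- r * T) \<le> radius - q"
    using exp_decay_eventually[OF r, of "radius - q" "M - q"] q by auto
  have "semiflow T X0 \<in> lyap_ball a" if X0: "X0 \<in> D" for X0
  proof -
    have st: "X0 \<in> states Nu Nt" using X0 D(1) by blast
    obtain X where X: "is_sol X" "X 0 = X0" "\<And>t. t \<ge> 0 \<Longrightarrow> semiflow t X0 = X t"
      using flow_of_state[OF st] by metis
    have "lyap a (X T) - q \<le> (lyap a X0 - q) * exp (- r * T)"
      using lyap_decay[OF ineq X(1) T(1)] X(2) by simp
    also have "\<dots> \<le> (M - q) * exp (- r * T)" using M[OF X0] by (intro mult_right_mono) auto
    finally show ?thesis using X(3)[OF T(1)] flow_states[OF st T(1)] T(2) by (simp add: lyap_ball_def)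
  qed
  with T(1) show ?thesis by blast
qed

end

section \<open>The Lyapunov inequality and its consequences under the criterion\<close>

locale balanced_truncation = truncation +
  assumes balanced: "energy_balance_criterion k Nu Nt"
begin

lemma balance_defect_zero: "balance_defect X = 0"
  using balanced unfolding criterion_iff balance_defect_eq by (intro sum.neutral ballI) simp

text \<open>The criterion enters here: the vanishing defect replaces the cosine integrals by a
  multiple of the flux, with the sign opposite to that of the exchange terms.\<close>

lemma ball_shift_Ft:
  "(\<Sum>n\<in>Nt. ball_shift k n * Ft X n) = - (\<Sum>n\<in>Nt. ksq k n * (ball_shift k n * snd X n)) - 2 * flux X"
proof -
  have "(\<Sum>n\<in>Nt. ball_shift k n * Ft X n) = 2 * pi / k$3 * (\<Sum>n\<in>Nt. height_coeff n * Ft X n)"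
    unfolding sum_distrib_left by (intro sum.cong refl) (simp add: ball_shift_eq)
  also have "\<dots> = - (2 * pi / k$3 * (\<Sum>n\<in>Nt. height_coeff n * (ksq k n * snd X n))) + 4 * (\<Sum>j\<in>strat_set. cos_flux j X)"
    unfolding height_coeff_Ft by (simp add: field_simps)
  also have "2 * pi / k$3 * (\<Sum>n\<in>Nt. height_coeff n * (ksq k n * snd X n)) = (\<Sum>n\<in>Nt. ksq k n * (ball_shift k n * snd X n))"
    unfolding sum_distrib_left by (intro sum.cong refl) (simp add: ball_shift_eq)
  also have "4 * (\<Sum>j\<in>strat_set. cos_flux j X) = - 2 * flux X"
    using balance_defect_zero[of X] unfolding balance_defect_def by simp
  finally show ?thesis by simp
qed

text \<open>Velocity contributes \<open>a * P * R\<close>, temperature 1 and the shift -2 to the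
  coefficient of the flux, so \<open>a = 1 / (P * R)\<close> removes it.\<close>

lemma lyap_rate_eq:
  "lyap_rate a X = - a * P * (\<Sum>n\<in>Nu. ksq k n * (fst X n)\<^sup>2)
     - (\<Sum>n\<in>Nt. ksq k n * (snd X n * (snd X n + ball_shift k n))) + (a * P * R - 1) * flux X"
proof -
  have "(\<Sum>n\<in>Nt. (snd X n + ball_shift k n) * Ft X n) = (\<Sum>n\<in>Nt. snd X n * Ft X n) + (\<Sum>n\<in>Nt. ball_shift k n * Ft X n)"
    by (simp add: distrib_right sum.distrib)
  also have "\<dots> = - ((\<Sum>n\<in>Nt. ksq k n * (snd X n)\<^sup>2) + (\<Sum>n\<in>Nt. ksq k n * (ball_shift k n * snd X n))) - flux X"
    unfolding temperature_energy ball_shift_Ft by simp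
  also have "(\<Sum>n\<in>Nt. ksq k n * (snd X n)\<^sup>2) + (\<Sum>n\<in>Nt. ksq k n * (ball_shift k n * snd X n)) =
      (\<Sum>n\<in>Nt. ksq k n * (snd X n * (snd X n + ball_shift k n)))"
    unfolding sum.distrib[symmetric] by (intro sum.cong refl) (simp add: power2_eq_square algebra_simps)
  finally show ?thesis unfolding lyap_rate_def velocity_energy by (simp add: algebra_simps)
qed

lemma lyapunov_inequality:
  obtains a r q where "a > 0" "r > 0" "q < radius" "R > 0 \<Longrightarrow> a = 1 / (P * R)"
    "\<And>X. 2 * lyap_rate a X \<le> - r * (lyap a X - q)"
proof (cases "R > 0")
  case True
  define a where "a = 1 / (P * R)"
  have a: "a > 0" "a * P * R = 1" using True P by (auto simp: a_def)
  have lP: "lam0 \<le> 2 * P * kmin"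
    unfolding lam0_def using kmin_pos mu_le P by (simp add: mult.commute)
  show ?thesis
  proof (rule that[of a lam0 radius0])
    fix X :: state
    let ?U = "\<Sum>n\<in>Nu. (fst X n)\<^sup>2"
    have U: "?U \<ge> 0" by (intro sum_nonneg) auto
    have "lam0 * (a * ?U) \<le> (2 * P * kmin) * (a * ?U)" using lP a U by (intro mult_right_mono) auto
    also have "\<dots> = (2 * a * P) * (kmin * ?U)" by simp
    also have "\<dots> \<le> (2 * a * P) * (\<Sum>n\<in>Nu. ksq k n * (fst X n)\<^sup>2)"
      using a P by (intro mult_left_mono velocity_dissipation) auto
    finally show "2 * lyap_rate a X \<le> - lam0 * (lyap a X - radius0)"
      using temperature_dissipation[of X] unfolding lyap_rate_eq a(2) lyap_def by (simp add: algebra_simps)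
  qed (use a lam0_pos radius0_less a_def in auto)
next
  case False
  then have R0: "R = 0" using R by simp
  define S2 where "S2 = (\<Sum>n\<in>Nt. (ball_shift k n)\<^sup>2)"
  have S2: "S2 \<ge> 0" unfolding S2_def by (intro sum_nonneg) auto
  \<comment> \<open>The requirement \<open>q < radius\<close> amounts to
    \<open>2 * \<epsilon> * (radius + S2) < lam0 * (radius - radius0)\<close>; this \<epsilon>
    spends half of the available margin.\<close>
  define \<epsilon> where "\<epsilon> = lam0 * (radius - radius0) / (4 * (radius + S2))"
  have rp: "radius > 0" using radius0_nonneg radius0_less by simp
  have e: "\<epsilon> > 0" unfolding \<epsilon>_def using lam0_pos radius0_less rp S2 by (intro divide_pos_pos mult_pos_pos) auto
  have e2: "4 * \<epsilon> * (radius + S2) = lam0 * (radius - radius0)"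
    unfolding \<epsilon>_def using rp S2 by (simp add: field_simps)
  have "4 * \<epsilon> * (radius + S2) \<le> lam0 * (radius + S2)"
    unfolding e2 using lam0_pos radius0_nonneg S2 by (intro mult_left_mono) auto
  then have "4 * \<epsilon> \<le> lam0" using rp S2 by (simp add: mult_le_cancel_right)
  \<comment> \<open>Young's inequality costs \<epsilon> times the squared temperature, at most
    \<open>2 * \<epsilon>\<close> times the squared shifted coefficients plus
    \<open>2 * \<epsilon> * S2\<close>. The first part lowers the rate from \<open>lam0\<close> to
    \<open>r\<close>, the second enters \<open>q\<close>.\<close>
  define r where "r = lam0 - 2 * \<epsilon>"
  have l: "r > 0" using \<open>4 * \<epsilon> \<le> lam0\<close> e by (simp add: r_def)
  define q where "q = (lam0 * radius0 + 2 * \<epsilon> * S2) / r"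
  \<comment> \<open>With this weight, twice the viscous dissipation is at least
    \<open>2 * ?U / \<epsilon>\<close>: one half pays for the velocity part of the flux estimate,
    the other for the decay of \<open>a * ?U\<close> at rate \<open>r\<close>.\<close>
  define a where "a = 1 / (\<epsilon> * P * kmin)"
  have a: "a > 0" "a * P * kmin = 1 / \<epsilon>" using e P kmin_pos by (auto simp: a_def)
  show ?thesis
  proof (rule that[of a r q])
    have "lam0 * (radius - radius0) > 0" using lam0_pos radius0_less by (intro mult_pos_pos) auto
    then have "2 * \<epsilon> * (radius + S2) < lam0 * (radius - radius0)" using e2 by linarith
    then have "lam0 * radius0 + 2 * \<epsilon> * S2 < radius * r" by (simp add: r_def algebra_simps)
    then show "q < radius" using l by (simp add: q_def divide_less_eq)
    fix X :: state
    let ?U = "\<Sum>n\<in>Nu. (fst X n)\<^sup>2" and ?T = "\<Sum>n\<in>Nt. (snd X n)\<^sup>2"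
      and ?\<Phi> = "\<Sum>n\<in>Nt. (snd X n + ball_shift k n)\<^sup>2"
    have U: "?U \<ge> 0" by (intro sum_nonneg) auto
    have "?T \<le> (\<Sum>n\<in>Nt. 2 * (snd X n + ball_shift k n)\<^sup>2 + 2 * (ball_shift k n)\<^sup>2)"
    proof (rule sum_mono)
      fix n
      have "0 \<le> (snd X n + 2 * ball_shift k n)\<^sup>2" by simp
      then show "(snd X n)\<^sup>2 \<le> 2 * (snd X n + ball_shift k n)\<^sup>2 + 2 * (ball_shift k n)\<^sup>2"
        by (simp add: power2_eq_square algebra_simps)
    qed
    also have "\<dots> = 2 * ?\<Phi> + 2 * S2" by (simp add: sum.distrib sum_distrib_left S2_def)
    finally have "\<epsilon> * ?T \<le> \<epsilon> * (2 * ?\<Phi> + 2 * S2)" using e by (intro mult_left_mono) auto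
    moreover have "- 2 * flux X \<le> ?U / \<epsilon> + \<epsilon> * ?T"
      using flux_bound[OF e, of X] by (simp add: abs_le_iff field_simps)
    ultimately have fl: "- 2 * flux X \<le> ?U / \<epsilon> + \<epsilon> * (2 * ?\<Phi> + 2 * S2)" by linarith
    have "(2 * a * P) * (kmin * ?U) \<le> (2 * a * P) * (\<Sum>n\<in>Nu. ksq k n * (fst X n)\<^sup>2)"
      using a P by (intro mult_left_mono velocity_dissipation) auto
    moreover have "(2 * a * P) * (kmin * ?U) = 2 * (a * P * kmin) * ?U" by simp
    ultimately have vd: "2 * ?U / \<epsilon> \<le> (2 * a * P) * (\<Sum>n\<in>Nu. ksq k n * (fst X n)\<^sup>2)"
      unfolding a(2) by simp
    have "r * a * ?U \<le> ?U / \<epsilon>"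
    proof -
      have "r \<le> P * kmin"
        using mult_right_mono[OF mu_le(2), of kmin] kmin_pos e unfolding r_def lam0_def mult.commute[of kmin] by linarith
      then have "r * a \<le> (P * kmin) * a" using a by (intro mult_right_mono) auto
      also have "\<dots> = 1 / \<epsilon>" using a(2) by (simp add: mult_ac)
      finally have "r * a * ?U \<le> 1 / \<epsilon> * ?U" using U by (rule mult_right_mono)
      then show ?thesis by simp
    qed
    moreover have "2 * lyap_rate a X = - ((2 * a * P) * (\<Sum>n\<in>Nu. ksq k n * (fst X n)\<^sup>2))
        + 2 * (- (\<Sum>n\<in>Nt. ksq k n * (snd X n * (snd X n + ball_shift k n)))) - 2 * flux X"
      unfolding lyap_rate_eq by (simp add: R0 algebra_simps)
    moreover have "2 * (- (\<Sum>n\<in>Nt. ksq k n * (snd X n * (snd X n + ball_shift k n)))) \<le> - lam0 * ?\<Phi> + lam0 * radius0"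
      using temperature_dissipation[of X] by linarith
    ultimately have "2 * lyap_rate a X \<le> - (r * a * ?U) - lam0 * ?\<Phi> + lam0 * radius0 + \<epsilon> * (2 * ?\<Phi> + 2 * S2)"
      using fl vd by linarith
    also have "\<dots> = - r * lyap a X + (lam0 * radius0 + 2 * \<epsilon> * S2)"
      unfolding lyap_def r_def by (simp add: algebra_simps)
    also have "lam0 * radius0 + 2 * \<epsilon> * S2 = r * q" using l by (simp add: q_def)
    finally show "2 * lyap_rate a X \<le> - r * (lyap a X - q)" by (simp add: algebra_simps)
  qed (use a l False in auto)
qed

theorem ellipsoid_attracting: "exponentially_attracting k P R S Nu Nt (ellipsoid k P R Nu Nt)"
proof -
  obtain a r q where a: "a > 0" and r: "r > 0" and q: "q < radius" and aR: "R > 0 \<Longrightarrow> a = 1 / (P * R)"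
    and ineq: "\<And>X. 2 * lyap_rate a X \<le> - r * (lyap a X - q)"
    using lyapunov_inequality by blast
  \<comment> \<open>For positive \<open>R\<close> the ellipsoid is entered in finite time and any
    rate would do. For \<open>R = 0\<close> this is the decay rate of the velocity norm, half that
    of the kinetic energy.\<close>
  define \<rho> where "\<rho> = P * kmin"
  have rho: "\<rho> > 0" using P kmin_pos by (simp add: \<rho>_def)
  show ?thesis unfolding exponentially_attracting_def
  proof (rule exI[of _ \<rho>], intro conjI allI impI)
    fix X assume sol: "is_sol X"
    define Q where "Q t = lyap a (X t)" for t
    have dec: "Q t - q \<le> (Q 0 - q) * exp (- r * t)" if "t \<ge> 0" for t
      unfolding Q_def by (rule lyap_decay[OF ineq sol that])
    define M where "M = \<bar>q\<bar> + \<bar>Q 0 - q\<bar>"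
    have QM: "Q t \<le> M" if "t \<ge> 0" for t
    proof -
      have "(Q 0 - q) * exp (- r * t) \<le> \<bar>Q 0 - q\<bar> * 1" using r that by (intro mult_mono) auto
      then show ?thesis using dec[OF that] by (simp add: M_def)
    qed
    obtain T where T: "T \<ge> 0" "\<And>t. t \<ge> T \<Longrightarrow> (Q 0 - q) * exp (- r * t) \<le> radius - q"
      using exp_decay_eventually[OF r, of "radius - q" "Q 0 - q"] q by auto
    define D where "D = sqrt (M / a + M)"
    define U where "U = sqrt (\<Sum>n\<in>Nu. (fst (X 0) n)\<^sup>2)"
    have nn: "U \<ge> 0" unfolding U_def by (simp add: sum_nonneg)
    have Dd: "sdist (X t) centre \<le> D" if "t \<ge> 0" for t
    proof -
      have "(sdist (X t) centre)\<^sup>2 \<le> Q t / a + Q t"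
        unfolding state_dist_centre_sq Q_def using lyap_parts[OF a, of "X t"] by linarith
      also have "\<dots> \<le> M / a + M" using QM[OF that] a by (intro add_mono divide_right_mono) auto
      finally show ?thesis unfolding D_def by (rule real_le_rsqrt)
    qed
    have D: "D \<ge> 0" using Dd[of 0] state_dist_nonneg[of "X 0" centre] by simp
    show "\<exists>C. \<forall>t\<ge>0. \<exists>b\<in>ellipsoid k P R Nu Nt. sdist (X t) b \<le> C * exp (- \<rho> * t)"
    \<comment> \<open>Before the entry time \<open>T\<close> the distance to the centre is at most
      \<open>D\<close>, and \<open>exp (\<rho> * T)\<close> makes up for the decaying factor;
      afterwards only the distance to the degenerate hyperplane, governed by \<open>U\<close>, can
      remain.\<close>
    proof (intro exI[of _ "D * exp (\<rho> * T) + U"] allI impI)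
      fix t :: real assume t: "t \<ge> 0"
      show "\<exists>b\<in>ellipsoid k P R Nu Nt. sdist (X t) b \<le> (D * exp (\<rho> * T) + U) * exp (- \<rho> * t)"
      proof (cases "t < T")
        case True
        have "sdist (X t) centre \<le> D * 1" using Dd[OF t] by simp
        also have "\<dots> \<le> D * (exp (\<rho> * T) * exp (- \<rho> * t))"
          using True rho D by (intro mult_left_mono) (auto simp flip: exp_add)
        also have "\<dots> \<le> (D * exp (\<rho> * T) + U) * exp (- \<rho> * t)" using nn by (simp add: algebra_simps)
        finally show ?thesis using centre_ellipsoid by blast
      next
        case False
        \<comment> \<open>For \<open>R = 0\<close> the state is projected onto the hyperplane of
          zero velocity; for positive \<open>R\<close> it already lies in the ellipsoid.\<close>
        define b :: state where "b = ((if R = 0 then (\<lambda>_. 0) else fst (X t)), snd (X t))"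
        have QR: "Q t \<le> radius" using dec[OF t] T(2)[of t] False by simp
        have st: "X t \<in> states Nu Nt" by (rule solution_states[OF sol t])
        have "b \<in> ellipsoid k P R Nu Nt"
        proof (cases "R = 0")
          case True
          then show ?thesis unfolding ellipsoid_iff using st lyap_parts(2)[OF a, of "X t"] QR
            by (auto simp: b_def states_def Q_def split: prod.splits)
        next
          case False
          then have "R > 0" using R by simp
          have "b = X t" using False by (simp add: b_def)
          have "(\<Sum>n\<in>Nu. (fst (X t) n)\<^sup>2 / (P * R)) = a * (\<Sum>n\<in>Nu. (fst (X t) n)\<^sup>2)"
            unfolding aR[OF \<open>R > 0\<close>] by (simp add: sum_divide_distrib)
          then show ?thesis unfolding ellipsoid_iff \<open>b = X t\<close> using st QR False
            by (simp add: Q_def lyap_def)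
        qed
        moreover have "sdist (X t) b \<le> U * exp (- \<rho> * t)"
        proof (cases "R = 0")
          case True
          have "sdist (X t) b = sqrt (\<Sum>n\<in>Nu. (fst (X t) n)\<^sup>2)"
            using True by (simp add: state_dist_def b_def)
          also have "\<dots> \<le> sqrt ((\<Sum>n\<in>Nu. (fst (X 0) n)\<^sup>2) * (exp (- \<rho> * t))\<^sup>2)"
          proof (rule real_sqrt_le_mono)
            have "2 * (- \<rho> * t) = - (2 * P * kmin) * t" by (simp add: \<rho>_def)
            then have "(exp (- \<rho> * t))\<^sup>2 = exp (- (2 * P * kmin) * t)" by (metis exp_double)
            then show "(\<Sum>n\<in>Nu. (fst (X t) n)\<^sup>2) \<le> (\<Sum>n\<in>Nu. (fst (X 0) n)\<^sup>2) * (exp (- \<rho> * t))\<^sup>2"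
              using velocity_decay[OF sol True t] by simp
          qed
          also have "\<dots> = U * exp (- \<rho> * t)" by (simp add: U_def real_sqrt_mult)
          finally show ?thesis .
        next
          case False
          then show ?thesis using nn by (simp add: state_dist_def b_def)
        qed
        moreover have "U * exp (- \<rho> * t) \<le> (D * exp (\<rho> * T) + U) * exp (- \<rho> * t)"
          using D by (intro mult_right_mono) auto
        ultimately show ?thesis by (meson order_trans)
      qed
    qed
  qed (rule rho)
qed

text \<open>The attractor is the omega-limit set of a Lyapunov ball. A bounded set is first absorbed
  by this ball and then carried along with its images, so the two waiting times add up.\<close>

theorem attractor_exists: "\<exists>A. compact_global_attractor k P R S Nu Nt A"
proof -
  let ?\<phi> = "semiflow"
  obtain a r q where a: "a > 0" and r: "r > 0" and q: "q < radius" and "R > 0 \<Longrightarrow> a = 1 / (P * R)"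
    and ineq: "\<And>X. 2 * lyap_rate a X \<le> - r * (lyap a X - q)"
    using lyapunov_inequality by blast
  have inv: "?\<phi> t X \<in> lyap_ball a" if "X \<in> lyap_ball a" "t \<ge> 0" for X t
    using lyap_ball_invariant[OF ineq r q that] .
  have sub: "lyap_ball a \<subseteq> states Nu Nt" by (auto simp: lyap_ball_def)
  interpret sf: compact_semiflow ?\<phi> "lyap_ball a"
  proof
    show "compact (lyap_ball a)" by (rule lyap_ball_compact[OF a])
    have "centre \<in> lyap_ball a"
      unfolding lyap_ball_def using centre_states radius_pos by (simp add: lyap_def centre_def)
    then show "lyap_ball a \<noteq> {}" by blast
  qed (use inv flow_continuous_on_lyap_ball[OF a inv] flow_zero flow_add sub in auto)
  show ?thesis
  proof (intro exI[of _ sf.attractor], unfold compact_global_attractor_def, intro conjI allI impI)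
    show "sf.attractor \<subseteq> states Nu Nt" using sf.attractor_subset sub by blast
    fix D \<delta> and \<epsilon> :: real
    assume D: "D \<subseteq> states Nu Nt \<and> (\<forall>X\<in>D. sdist X (\<lambda>n. 0, \<lambda>n. 0) \<le> \<delta>)" and e: "\<epsilon> > 0"
    \<comment> \<open>On the full function space \<open>state_dist\<close> is only a pseudometric,
      but its balls are open in the product topology, so the topological form of attraction
      applies.\<close>
    define U where "U = (\<Union>b\<in>sf.attractor. {X. sdist X b < \<epsilon>})"
    have "open U" unfolding U_def
      by (intro open_UN ballI open_Collect_less cont_state_dist continuous_on_const)
    moreover have "sf.attractor \<subseteq> U" unfolding U_def using e by (auto simp: state_dist_def)
    ultimately obtain T1 where T1: "T1 \<ge> 0" "\<And>t. t \<ge> T1 \<Longrightarrow> ?\<phi> t ` lyap_ball a \<subseteq> U"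
      using sf.attractor_attracts by blast
    obtain T2 where T2: "T2 \<ge> 0" "\<And>X. X \<in> D \<Longrightarrow> ?\<phi> T2 X \<in> lyap_ball a"
      using bounded_set_absorbed[OF a ineq r q, of D \<delta>] D by blast
    show "\<exists>T\<ge>0. \<forall>t\<ge>T. \<forall>X\<in>D. \<exists>b\<in>sf.attractor. sdist (?\<phi> t X) b < \<epsilon>"
    proof (intro exI[of _ "T1 + T2"] conjI allI impI ballI)
      fix t X assume t: "t \<ge> T1 + T2" and X: "X \<in> D"
      have "?\<phi> t X = ?\<phi> (t - T2) (?\<phi> T2 X)"
        using flow_add[of X "t - T2" T2] X D t T1 T2 by auto
      also have "\<dots> \<in> U" using T1(2)[of "t - T2"] T2(2)[OF X] t by auto
      finally show "\<exists>b\<in>sf.attractor. sdist (?\<phi> t X) b < \<epsilon>" by (auto simp: U_def)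
    qed (use T1 T2 in auto)
  qed (use sf.attractor_nonempty sf.attractor_compact sf.attractor_invariant in auto)
qed

end

theorem proposition3p2:
  fixes k :: "real^3" and P R S :: real and Nu Nt :: "mode set"
  assumes "R \<ge> 0" and "S \<ge> 0" and "P > 0"
    and "k$1 > 0" and "k$2 > 0" and "k$3 = inverse (k$1 * k$2)"
    and "finite Nu" and "Nu \<subseteq> N_u" and "finite Nt" and "Nt \<subseteq> N_theta"
  shows "((\<forall>X. solution k P R S Nu Nt X \<longrightarrow> energy_balance k Nu Nt X)
            \<longleftrightarrow> energy_balance_criterion k Nu Nt)
       \<and> (energy_balance_criterion k Nu Nt \<longrightarrow>
            exponentially_attracting k P R S Nu Nt (ellipsoid k P R Nu Nt)
          \<and> (\<exists>A. compact_global_attractor k P R S Nu Nt A))"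
proof -
  interpret truncation k P R S Nu Nt
    using assms by unfold_locales auto
  have "exponentially_attracting k P R S Nu Nt (ellipsoid k P R Nu Nt)
          \<and> (\<exists>A. compact_global_attractor k P R S Nu Nt A)" if "energy_balance_criterion k Nu Nt"
  proof -
    interpret balanced_truncation k P R S Nu Nt using that by unfold_locales
    show ?thesis using ellipsoid_attracting attractor_exists by blast
  qed
  then show ?thesis using balance_iff_criterion by blast
qed

end
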